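(* Let $S_{g,n}$ be a surface with triangulation $\mathcal{T}=(V,E,F)$ as in the context. For any prescribed geodesic curvatures $\hat{k}\in\mathbb{R}_{>0}^{|V^{\partial}|}$ on the boundary vertices and prescribed total geodesic curvatures $\hat{T}\in\mathbb{R}_{>0}^{|V^{\circ}|}$ on the interior vertices, there exists a generalized circle packing $P$ on $S_{g,n}$ that realizes the pair $(\hat{k},\hat{T})$ if and only if $\hat{T}\in\mathfrak{T}$, where $$\mathfrak{T}=\Big\{(T_1,\ldots,T_{|V^{\circ}|})\in\mathbb{R}^{|V^{\circ}|}_{>0}\ \Big|\ \sum_{v\in I}T_v<\pi|F_I|\ \text{ for all nonempty } I\subset V^{\circ}\Big\}.$$ Furthermore, the generalized circle packing $P$, if it exists, is unique up to isometry.
   Context: **Generalized circles.** In the hyperbolic plane $\mathbb{H}^2$ (curvature $-1$) a generalized circle is a circle, a horocycle or a hypercycle (a curve at constant distance from a geodesic, its axis). Its shape is determined by its constant geodesic curvature $k>0$: if $k>1$ it is a circle of radius $\operatorname{arccoth}k$; if $k=1$ a horocycle (radius $+\infty$); if $0<k<1$ a hypercycle at distance $\operatorname{arctanh}k$ from its axis. The center is the usual center, the limiting ideal point, or the axis, respectively. Externally tangent means tangent with the convex sides (disk, horodisk, side containing the axis) having disjoint interiors. **Packing of one triangle.** For a triangle $f$ with vertices $v_1,v_2,v_3$ and $(k_1,k_2,k_3)\in\mathbb{R}_{>0}^3$, it is known that there is a configuration $P(f)$, determined by $(k_1,k_2,k_3)$ up to isometry, of three mutually externally tangent generalized circles $C_1,C_2,C_3$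 in $\mathbb{H}^2$ with geodesic curvatures $k_1,k_2,k_3$, together with a hyperbolic circle $C_f$ (the dual circle) perpendicular to each $C_i$ and passing through all the tangent points. $P(f)$ is the generalized circle packing of $f$. Let $l_i^f$ be the length of the sub-arc $C_i^f$ of $C_i$ contained in (inside) $C_f$, and let $T_i^f=k_i\,l_i^f$ be its total geodesic curvature. Joining the centers of $C_1,C_2,C_3$ by shortest geodesics gives the (generalized) hyperbolic triangle $\hat f$. **Surface and triangulation.** $S_{g,n}$ is obtained by removing $n\ge 1$ topological open disks from an oriented compact surface of genus $g\ge 0$. $\mathcal{T}=(V,E,F)$ is a triangulation with vertices $V$, edges $E$, faces $F$; $V_f$ is the set of three vertices of $f\in F$. $V^{\partial}$ and $V^{\circ}$ are the sets of boundary and interior vertices, $V=V^{\circ}\cup V^{\partial}$, each enumerated $1,2,\dots$. It is assumed that there are at least two boundary vertices and that each face has at most two boundary vertices. **Packing on the surface.** Given $k\in\mathbb{R}_{>0}^{|V|}$, form for each $f\in F$ the packing $P(f)$ with the curvatures of its vertices, and glue the triangles $\hat f$ along their edges; this gives a surface with hyperbolic conical metric (a generalized circle packing metric). The resulting pattern $P$ formed by all the $P(f)$ is called a generalized circle packing on $S_{g,n}$ with geodesic curvatures $k$. The total geodesic curvature at $v\in V^{\circ}$ is $T_v=\sum_{f\in F,\,v\in V_f}T_v^f$. $P$ realizes $(\hat k,\hat T)$ if its geodesic curvature equals $\hat k$ on $V^{\partial}$ and its total geodesic curvature equals $\hat T$ on $V^{\circ}$. For $I\subset V^{\circ}$, $F_I=\{f\in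 F\mid \exists v\in I,\ v\in V_f\}$. *)

theory Defs
  imports "HOL-Analysis.Analysis"
begin

section \<open>The hyperbolic plane\<close>

text \<open>Upper half-plane model with metric \<open>|dz| / Im z\<close> (curvature -1). It is conformal, so
  hyperbolic angles are Euclidean angles.\<close>

definition H2 :: "complex set" where
  "H2 = {z. Im z > 0}"

definition hdist :: "complex \<Rightarrow> complex \<Rightarrow> real" where
  "hdist z w = arcosh (1 + (cmod (z - w))\<^sup>2 / (2 * Im z * Im w))"

definition h_isometry :: "(complex \<Rightarrow> complex) \<Rightarrow> bool" where
  "h_isometry \<phi> \<longleftrightarrow> bij_betw \<phi> H2 H2 \<and> (\<forall>z\<in>H2. \<forall>w\<in>H2. hdist (\<phi> z) (\<phi> w) = hdist z w)"

definition hsegment :: "complex \<Rightarrow> complex \<Rightarrow> complex set" where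
  "hsegment x y = {z\<in>H2. hdist x z + hdist z y = hdist x y}"

definition hconvex :: "complex set \<Rightarrow> bool" where
  "hconvex S \<longleftrightarrow> S \<subseteq> H2 \<and> (\<forall>x\<in>S. \<forall>y\<in>S. hsegment x y \<subseteq> S)"

text \<open>Hyperbolic length of a subset that is a piecewise smooth simple arc.\<close>

definition hlength :: "complex set \<Rightarrow> real" where
  "hlength A = (THE l. \<exists>\<gamma>. arc \<gamma> \<and> valid_path \<gamma> \<and> path_image \<gamma> = A \<and>
      l = integral {0..1} (\<lambda>t. cmod (vector_derivative \<gamma> (at t)) / Im (\<gamma> t)))"

text \<open>Complete geodesics, with a function that is positive on one side, zero on the geodesic and
  negative on the other side.\<close>

datatype geodesic = Vertical real | Semicircle real real

fun geodesic_wf :: "geodesic \<Rightarrow> bool" where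
  "geodesic_wf (Vertical a) = True"
| "geodesic_wf (Semicircle a r) = (r > 0)"

fun geodesic_side :: "geodesic \<Rightarrow> complex \<Rightarrow> real" where
  "geodesic_side (Vertical a) z = Re z - a"
| "geodesic_side (Semicircle a r) z = cmod (z - complex_of_real a) - r"

definition geodesic_points :: "geodesic \<Rightarrow> complex set" where
  "geodesic_points A = {z\<in>H2. geodesic_side A z = 0}"

definition dist_geodesic :: "geodesic \<Rightarrow> complex \<Rightarrow> real" where
  "dist_geodesic A z = (INF w\<in>geodesic_points A. hdist z w)"

datatype ideal_point = Infty | Bdry real

text \<open>The distance to an ideal point, in the usual sense of a Busemann function; it is determined
  up to an additive constant.\<close>

fun busemann :: "ideal_point \<Rightarrow> complex \<Rightarrow> real" where
  "busemann Infty z = - ln (Im z)"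
| "busemann (Bdry a) z = ln ((cmod (z - complex_of_real a))\<^sup>2 / Im z)"

section \<open>Generalized circles\<close>

text \<open>A generalized circle together with its center: \<open>Circle c r\<close> is the circle with center \<open>c\<close> and
  radius \<open>r\<close>; \<open>Horocycle \<xi> h\<close> is the horocycle centered at \<open>\<xi>\<close> on which the Busemann function equals
  \<open>h\<close>; \<open>Hypercycle A d\<close> is the curve at distance \<open>|d|\<close> from the axis \<open>A\<close>, on the side of \<open>A\<close> given by
  the sign of \<open>d\<close>.\<close>

datatype gcircle = Circle complex real | Horocycle ideal_point real | Hypercycle geodesic real

fun gcircle_wf :: "gcircle \<Rightarrow> bool" where
  "gcircle_wf (Circle c r) = (c \<in> H2 \<and> r > 0)"
| "gcircle_wf (Horocycle \<xi> h) = True"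
| "gcircle_wf (Hypercycle A d) = (geodesic_wf A \<and> d \<noteq> 0)"

text \<open>Geodesic curvature: \<open>coth r\<close>, 1, \<open>tanh\<close> of the distance to the axis.\<close>

fun geod_curvature :: "gcircle \<Rightarrow> real" where
  "geod_curvature (Circle c r) = 1 / tanh r"
| "geod_curvature (Horocycle \<xi> h) = 1"
| "geod_curvature (Hypercycle A d) = tanh \<bar>d\<bar>"

fun curve :: "gcircle \<Rightarrow> complex set" where
  "curve (Circle c r) = {z\<in>H2. hdist c z = r}"
| "curve (Horocycle \<xi> h) = {z\<in>H2. busemann \<xi> z = h}"
| "curve (Hypercycle A d) = {z\<in>H2. sgn (geodesic_side A z) = sgn d \<and> dist_geodesic A z = \<bar>d\<bar>}"

text \<open>The (open) convex side: disk, horodisk, side containing the axis.\<close>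

fun convex_side :: "gcircle \<Rightarrow> complex set" where
  "convex_side (Circle c r) = {z\<in>H2. hdist c z < r}"
| "convex_side (Horocycle \<xi> h) = {z\<in>H2. busemann \<xi> z < h}"
| "convex_side (Hypercycle A d) =
     {z\<in>H2. sgn (geodesic_side A z) = sgn d \<longrightarrow> dist_geodesic A z < \<bar>d\<bar>}"

fun dist_center :: "gcircle \<Rightarrow> complex \<Rightarrow> real" where
  "dist_center (Circle c r) z = hdist c z"
| "dist_center (Horocycle \<xi> h) z = busemann \<xi> z"
| "dist_center (Hypercycle A d) z = dist_geodesic A z"

text \<open>Two such curves with disjoint convex sides and a common point are tangent there.\<close>

definition ext_tangent :: "gcircle \<Rightarrow> gcircle \<Rightarrow> bool" where
  "ext_tangent C D \<longleftrightarrow> (\<exists>p. curve C \<inter> curve D = {p}) \<and> convex_side C \<inter> convex_side D = {}"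

definition tangent_vector :: "complex set \<Rightarrow> complex \<Rightarrow> complex \<Rightarrow> bool" where
  "tangent_vector C p s \<longleftrightarrow>
     (\<exists>\<gamma>. (\<forall>t::real. \<gamma> t \<in> C) \<and> \<gamma> 0 = p \<and> (\<gamma> has_vector_derivative s) (at 0))"

definition perpendicular :: "complex set \<Rightarrow> complex set \<Rightarrow> bool" where
  "perpendicular C D \<longleftrightarrow> C \<inter> D \<noteq> {} \<and>
     (\<forall>p\<in>C \<inter> D. \<forall>s t. tangent_vector C p s \<longrightarrow> tangent_vector D p t \<longrightarrow> s \<bullet> t = 0)"

text \<open>The shortest geodesic joining the centers of \<open>C\<close> and \<open>D\<close>: the points at which the sum of the
  distances to the two centers is smallest. This is the segment between two points, the ray from a
  point to an ideal point, the geodesic between two ideal points, the perpendicular from a point or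
  an ideal point to an axis (ending on the axis), or the common perpendicular segment of two axes.\<close>

definition center_geodesic :: "gcircle \<Rightarrow> gcircle \<Rightarrow> complex set" where
  "center_geodesic C D = {x\<in>H2. \<forall>y\<in>H2.
     dist_center C x + dist_center D x \<le> dist_center C y + dist_center D y}"

section \<open>Triangulated surfaces\<close>

text \<open>\<open>ends\<close>, \<open>fverts\<close>, \<open>fedges\<close> give the end points of an edge and the vertices and edges of a face.
  Faces have three distinct vertices, but distinct edges (faces) may have the same vertices, so
  simplicial complexes are a special case.\<close>

record ('v, 'e, 'f) triangulation =
  Verts :: "'v set"
  Edges :: "'e set"
  Faces :: "'f set"
  ends :: "'e \<Rightarrow> 'v set"
  fverts :: "'f \<Rightarrow> 'v set"
  fedges :: "'f \<Rightarrow> 'e set"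

definition cell_complex :: "('v, 'e, 'f) triangulation \<Rightarrow> bool" where
  "cell_complex T \<longleftrightarrow>
     finite (Verts T) \<and> finite (Edges T) \<and> finite (Faces T) \<and>
     (\<forall>e\<in>Edges T. ends T e \<subseteq> Verts T \<and> card (ends T e) = 2) \<and>
     (\<forall>f\<in>Faces T. fverts T f \<subseteq> Verts T \<and> card (fverts T f) = 3 \<and> fedges T f \<subseteq> Edges T \<and>
        bij_betw (ends T) (fedges T f) {p. p \<subseteq> fverts T f \<and> card p = 2})"

definition edge_faces :: "('v, 'e, 'f) triangulation \<Rightarrow> 'e \<Rightarrow> 'f set" where
  "edge_faces T e = {f\<in>Faces T. e \<in> fedges T f}"

definition boundary_edges :: "('v, 'e, 'f) triangulation \<Rightarrow> 'e set" where
  "boundary_edges T = {e\<in>Edges T. card (edge_faces T e) = 1}"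

definition boundary_verts :: "('v, 'e, 'f) triangulation \<Rightarrow> 'v set" where
  "boundary_verts T = (\<Union>e\<in>boundary_edges T. ends T e)"

definition interior_verts :: "('v, 'e, 'f) triangulation \<Rightarrow> 'v set" where
  "interior_verts T = Verts T - boundary_verts T"

definition adjacency :: "('v, 'e, 'f) triangulation \<Rightarrow> 'e set \<Rightarrow> ('v \<times> 'v) set" where
  "adjacency T A = {(u, v). \<exists>e\<in>A. ends T e = {u, v}}"

text \<open>The complex is a surface with boundary: every edge lies in one or two faces, and the faces at a
  vertex are connected through edges at that vertex (so its link is a path or a cycle).\<close>

definition surface_complex :: "('v, 'e, 'f) triangulation \<Rightarrow> bool" where
  "surface_complex T \<longleftrightarrow> cell_complex T \<and>
     (\<forall>e\<in>Edges T. card (edge_faces T e) \<in> {1, 2}) \<and>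
     (\<forall>v\<in>Verts T. \<exists>f\<in>Faces T. v \<in> fverts T f) \<and>
     (\<forall>v\<in>Verts T. \<forall>f\<in>Faces T. \<forall>f'\<in>Faces T. v \<in> fverts T f \<longrightarrow> v \<in> fverts T f' \<longrightarrow>
        (f, f') \<in> {(h, h'). h \<in> Faces T \<and> h' \<in> Faces T \<and>
                     (\<exists>e\<in>fedges T h \<inter> fedges T h'. v \<in> ends T e)}\<^sup>*)"

definition connected_complex :: "('v, 'e, 'f) triangulation \<Rightarrow> bool" where
  "connected_complex T \<longleftrightarrow> Verts T \<noteq> {} \<and>
     (\<forall>u\<in>Verts T. \<forall>v\<in>Verts T. (u, v) \<in> (adjacency T (Edges T))\<^sup>*)"

text \<open>An orientation is a cyclic order \<open>\<sigma> f\<close> of the vertices of each face \<open>f\<close>, such that two faces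
  induce opposite directions on a common edge.\<close>

definition orientable_complex :: "('v, 'e, 'f) triangulation \<Rightarrow> bool" where
  "orientable_complex T \<longleftrightarrow> (\<exists>\<sigma> :: 'f \<Rightarrow> 'v \<Rightarrow> 'v.
     (\<forall>f\<in>Faces T. bij_betw (\<sigma> f) (fverts T f) (fverts T f) \<and> (\<forall>v\<in>fverts T f. \<sigma> f v \<noteq> v)) \<and>
     (\<forall>f\<in>Faces T. \<forall>f'\<in>Faces T. \<forall>e\<in>fedges T f \<inter> fedges T f'. \<forall>u v.
        f \<noteq> f' \<longrightarrow> ends T e = {u, v} \<longrightarrow> (\<sigma> f u = v \<longleftrightarrow> \<sigma> f' v = u)))"

text \<open>\<open>T\<close> triangulates \<open>S\<^bsub>g,n\<^esub>\<close>: the boundary has \<open>n\<close> components, and filling them with disks gives a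
  closed oriented surface of Euler characteristic \<open>2 - 2 g\<close>.\<close>

definition triangulates_S :: "nat \<Rightarrow> nat \<Rightarrow> ('v, 'e, 'f) triangulation \<Rightarrow> bool" where
  "triangulates_S g n T \<longleftrightarrow>
     surface_complex T \<and> connected_complex T \<and> orientable_complex T \<and>
     card (boundary_verts T // (adjacency T (boundary_edges T))\<^sup>*) = n \<and>
     int (card (Verts T)) - int (card (Edges T)) + int (card (Faces T)) = 2 - 2 * int g - int n"

definition faces_at :: "('v, 'e, 'f) triangulation \<Rightarrow> 'v set \<Rightarrow> 'f set" where
  "faces_at T I = {f\<in>Faces T. \<exists>v\<in>I. v \<in> fverts T f}"

section \<open>Generalized circle packings\<close>

text \<open>\<open>gcirc P f v\<close> is the generalized circle of the vertex \<open>v\<close> in the configuration \<open>P(f)\<close>; the dual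
  circle of \<open>f\<close> has center \<open>dual_center P f\<close> and radius \<open>dual_radius P f\<close>.\<close>

record ('v, 'f) packing =
  curv :: "'v \<Rightarrow> real"
  gcirc :: "'f \<Rightarrow> 'v \<Rightarrow> gcircle"
  dual_center :: "'f \<Rightarrow> complex"
  dual_radius :: "'f \<Rightarrow> real"

definition dual_circle :: "('v, 'f) packing \<Rightarrow> 'f \<Rightarrow> gcircle" where
  "dual_circle P f = Circle (dual_center P f) (dual_radius P f)"

definition triangle_packing ::
    "('v, 'e, 'f) triangulation \<Rightarrow> ('v, 'f) packing \<Rightarrow> 'f \<Rightarrow> bool" where
  "triangle_packing T P f \<longleftrightarrow>
     (\<forall>v\<in>fverts T f. gcircle_wf (gcirc P f v) \<and> geod_curvature (gcirc P f v) = curv P v) \<and>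
     (\<forall>u\<in>fverts T f. \<forall>v\<in>fverts T f. u \<noteq> v \<longrightarrow> ext_tangent (gcirc P f u) (gcirc P f v)) \<and>
     gcircle_wf (dual_circle P f) \<and>
     (\<forall>v\<in>fverts T f. perpendicular (curve (gcirc P f v)) (curve (dual_circle P f))) \<and>
     (\<forall>u\<in>fverts T f. \<forall>v\<in>fverts T f. u \<noteq> v \<longrightarrow>
        curve (gcirc P f u) \<inter> curve (gcirc P f v) \<subseteq> curve (dual_circle P f))"

definition gc_packing :: "('v, 'e, 'f) triangulation \<Rightarrow> ('v, 'f) packing \<Rightarrow> bool" where
  "gc_packing T P \<longleftrightarrow> (\<forall>v\<in>Verts T. curv P v > 0) \<and> (\<forall>f\<in>Faces T. triangle_packing T P f)"

definition sub_arc :: "('v, 'f) packing \<Rightarrow> 'f \<Rightarrow> 'v \<Rightarrow> complex set" where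
  "sub_arc P f v = {z\<in>curve (gcirc P f v). hdist (dual_center P f) z \<le> dual_radius P f}"

definition face_total_curv :: "('v, 'f) packing \<Rightarrow> 'f \<Rightarrow> 'v \<Rightarrow> real" where
  "face_total_curv P f v = curv P v * hlength (sub_arc P f v)"

definition total_curv :: "('v, 'e, 'f) triangulation \<Rightarrow> ('v, 'f) packing \<Rightarrow> 'v \<Rightarrow> real" where
  "total_curv T P v = (\<Sum>f | f \<in> Faces T \<and> v \<in> fverts T f. face_total_curv P f v)"

definition realizes ::
    "('v, 'e, 'f) triangulation \<Rightarrow> ('v, 'f) packing \<Rightarrow> ('v \<Rightarrow> real) \<Rightarrow> ('v \<Rightarrow> real) \<Rightarrow> bool" where
  "realizes T P k \<tau> \<longleftrightarrow> (\<forall>v\<in>boundary_verts T. curv P v = k v) \<and>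
                        (\<forall>v\<in>interior_verts T. total_curv T P v = \<tau> v)"

definition feasible :: "('v, 'e, 'f) triangulation \<Rightarrow> ('v \<Rightarrow> real) set" where
  "feasible T = {\<tau>. (\<forall>v\<in>interior_verts T. \<tau> v > 0) \<and>
     (\<forall>I. I \<subseteq> interior_verts T \<longrightarrow> I \<noteq> {} \<longrightarrow> (\<Sum>v\<in>I. \<tau> v) < pi * real (card (faces_at T I)))}"

section \<open>The glued surface and isometries of packings\<close>

text \<open>The side of the generalized triangle lying on the edge \<open>e\<close>.\<close>

definition tri_side ::
    "('v, 'e, 'f) triangulation \<Rightarrow> ('v, 'f) packing \<Rightarrow> 'f \<Rightarrow> 'e \<Rightarrow> complex set" where
  "tri_side T P f e = {x. \<exists>u v. ends T e = {u, v} \<and> u \<noteq> v \<and>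
                               x \<in> center_geodesic (gcirc P f u) (gcirc P f v)}"

text \<open>The generalized triangle, as a closed region of the plane. It is a convex polygon, bounded by
  the three sides and, at a hypercycle, by the piece of the axis between two sides.\<close>

definition gen_triangle ::
    "('v, 'e, 'f) triangulation \<Rightarrow> ('v, 'f) packing \<Rightarrow> 'f \<Rightarrow> complex set" where
  "gen_triangle T P f = hconvex hull (\<Union>e\<in>fedges T f. tri_side T P f e)"

definition tri_points ::
    "('v, 'e, 'f) triangulation \<Rightarrow> ('v, 'f) packing \<Rightarrow> ('f \<times> complex) set" where
  "tri_points T P = (SIGMA f:Faces T. gen_triangle T P f)"

text \<open>The sides of two faces on a common edge are glued by the isometry between them that matches the
  generalized circles at the two end points; this determines the gluing also along sides of infinite
  length.\<close>

definition glue_rel ::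
    "('v, 'e, 'f) triangulation \<Rightarrow> ('v, 'f) packing \<Rightarrow> (('f \<times> complex) \<times> ('f \<times> complex)) set" where
  "glue_rel T P = {((f, x), (f', x')). f \<in> Faces T \<and> f' \<in> Faces T \<and>
     (\<exists>e\<in>fedges T f \<inter> fedges T f'. x \<in> tri_side T P f e \<and> x' \<in> tri_side T P f' e \<and>
       (\<exists>\<phi>. h_isometry \<phi> \<and>
          (\<forall>v\<in>ends T e. \<phi> ` curve (gcirc P f v) = curve (gcirc P f' v)) \<and> \<phi> x = x'))}"

definition surface_points ::
    "('v, 'e, 'f) triangulation \<Rightarrow> ('v, 'f) packing \<Rightarrow> ('f \<times> complex) set set" where
  "surface_points T P = tri_points T P // (glue_rel T P)\<^sup>*"

text \<open>The metric of the glued surface: the infimum of the lengths of chains of geodesic segments, each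
  contained in one triangle.\<close>

inductive chain ::
    "('v, 'e, 'f) triangulation \<Rightarrow> ('v, 'f) packing \<Rightarrow> 'f \<times> complex \<Rightarrow> 'f \<times> complex \<Rightarrow> real \<Rightarrow> bool"
  for T P where
  chain_refl: "p \<in> tri_points T P \<Longrightarrow> chain T P p p 0"
| chain_move: "chain T P p (f, x) l \<Longrightarrow> y \<in> gen_triangle T P f \<Longrightarrow> chain T P p (f, y) (l + hdist x y)"
| chain_glue: "chain T P p q l \<Longrightarrow> (q, q') \<in> glue_rel T P \<Longrightarrow> chain T P p q' l"

definition surface_dist :: "('v, 'e, 'f) triangulation \<Rightarrow> ('v, 'f) packing \<Rightarrow>
    ('f \<times> complex) set \<Rightarrow> ('f \<times> complex) set \<Rightarrow> real" where
  "surface_dist T P A B = Inf {l. \<exists>p\<in>A. \<exists>q\<in>B. chain T P p q l}"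

text \<open>The image in the glued surface of a subset of the triangle of \<open>f\<close>.\<close>

definition surface_image :: "('v, 'e, 'f) triangulation \<Rightarrow> ('v, 'f) packing \<Rightarrow>
    'f \<Rightarrow> complex set \<Rightarrow> ('f \<times> complex) set set" where
  "surface_image T P f S = {(glue_rel T P)\<^sup>* `` {(f, x)} | x. x \<in> S \<inter> gen_triangle T P f}"

text \<open>An isometry between the glued surfaces that carries one pattern to the other, respecting the
  triangulation.\<close>

definition packing_isometry :: "('v, 'e, 'f) triangulation \<Rightarrow> ('v, 'f) packing \<Rightarrow>
    ('v, 'f) packing \<Rightarrow> (('f \<times> complex) set \<Rightarrow> ('f \<times> complex) set) \<Rightarrow> bool" where
  "packing_isometry T P Q \<Phi> \<longleftrightarrow>
     bij_betw \<Phi> (surface_points T P) (surface_points T Q) \<and>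
     (\<forall>A\<in>surface_points T P. \<forall>B\<in>surface_points T P.
        surface_dist T Q (\<Phi> A) (\<Phi> B) = surface_dist T P A B) \<and>
     (\<forall>f\<in>Faces T.
        \<Phi> ` surface_image T P f (gen_triangle T P f) = surface_image T Q f (gen_triangle T Q f) \<and>
        \<Phi> ` surface_image T P f (curve (dual_circle P f)) =
            surface_image T Q f (curve (dual_circle Q f)) \<and>
        (\<forall>v\<in>fverts T f. \<Phi> ` surface_image T P f (sub_arc P f v) =
                        surface_image T Q f (sub_arc Q f v)))"

definition packings_isometric ::
    "('v, 'e, 'f) triangulation \<Rightarrow> ('v, 'f) packing \<Rightarrow> ('v, 'f) packing \<Rightarrow> bool" where
  "packings_isometric T P Q \<longleftrightarrow> (\<exists>\<Phi>. packing_isometry T P Q \<Phi>)"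

end

theory Submission
  imports Defs
begin

text \<open>The proof has a geometric half, about a single triangle, and an analytic half, about the system of
  equations that the total curvatures impose on the geodesic curvatures.

  Geometry of one triangle. In the upper half-plane a generalized circle of geodesic curvature \<open>k\<close> has an
  equation \<open>A |z|\<^sup>2 + B Re z + C = k Im z\<close> with \<open>B\<^sup>2 - 4 A C = 1 - k\<^sup>2\<close>; its convex side is where \<open><\<close>
  holds. So circles, horocycles and hypercycles all become vectors \<open>(A, B, C)\<close> of norm \<open>1 - k\<^sup>2\<close> in a
  three-dimensional Lorentzian space, acting as linear functionals on the hyperboloid model
  (\<open>gcircle_level\<close>, \<open>gcircle_of_vector\<close>). External tangency and perpendicularity prescribe inner products
  (\<open>disjoint_imp_opposite\<close>, \<open>perpendicular_iff\<close>). Hence the Gram matrix of the three vectors of a triangle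
  depends on the curvatures only. It is nonsingular, so two configurations with the same curvatures differ by
  a linear isometry of the hyperboloid (\<open>config_isometry\<close>), and explicit vectors with this Gram matrix give
  a configuration (\<open>face_packing_exists\<close>). The same algebra shows that the dual circle has curvature \<open>s\<close>
  with \<open>s\<^sup>2 = 1 + \<sigma>\<close>, where \<open>\<sigma> = k\<^sub>1 k\<^sub>2 + k\<^sub>2 k\<^sub>3 + k\<^sub>3 k\<^sub>1\<close> (\<open>config_dual_vector\<close>). A rational
  parametrization of the arc of \<open>C\<^sub>i\<close> inside the dual circle then gives its total curvature
  \<open>T\<^sub>i\<close>, the integral of \<open>2 k\<^sub>i / (1 + (k\<^sub>i\<^sup>2 - 1) u\<^sup>2)\<close> over \<open>0 \<le> u \<le> 1 / s\<close> (\<open>hlength_arc_set\<close>).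

  Analysis of one triangle. Put \<open>u = sin \<theta>\<close> and integrate by parts: \<open>T\<^sub>i\<close> is the integral over
  \<open>0 \<le> \<theta> \<le> \<pi>/2\<close> of \<open>2 sin \<theta> arctan (k\<^sub>i tan (min \<theta> \<theta>\<^sub>0))\<close>, where \<open>tan \<theta>\<^sub>0 = 1 / sqrt \<sigma>\<close>
  (\<open>arc_curv_angular\<close>). All the monotonicity of the total curvatures can be read off the integrand. When
  some \<open>k\<^sub>j\<close> with \<open>j \<noteq> i\<close> grows, \<open>\<theta>\<^sub>0\<close> and with it \<open>T\<^sub>i\<close> decreases (\<open>face_curv_antimono\<close>). The three
  arctangents add up to exactly \<open>\<pi>/2\<close> for \<open>\<theta> \<ge> \<theta>\<^sub>0\<close> and to less before, and so \<open>T\<^sub>1 + T\<^sub>2 + T\<^sub>3\<close> is less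
  than \<open>\<pi>\<close> and strictly increasing in every \<open>k\<^sub>j\<close> (\<open>face_curv_sum_less_pi\<close>, \<open>face_curv_sum_strict_mono\<close>).

  The surface. Summing \<open>T\<^sub>1 + T\<^sub>2 + T\<^sub>3 < \<pi>\<close> over the faces that meet \<open>I\<close> gives the necessity of the
  inequalities. If two curvature functions \<open>k\<close>, \<open>k'\<close> have the same total curvatures, then raising \<open>k\<close> to
  \<open>k'\<close> on \<open>I = {v. k v < k' v}\<close> and lowering it elsewhere would increase the sum of the total curvatures
  over \<open>I\<close>, so \<open>I\<close> is empty (\<open>vertex_curv_inj\<close>). For existence, take the pointwise supremum of all
  curvature functions whose total curvatures are at most the prescribed ones (\<open>vertex_curv_exists\<close>). If it
  were infinite exactly on \<open>I \<noteq> {}\<close>, the total curvature of \<open>I\<close> would come arbitrarily close to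
  \<open>\<pi> |F\<^sub>I|\<close>, against the inequality for \<open>I\<close>; if it missed a prescribed value, it could be enlarged there.

  Finally, two packings that realize the same data have the same curvatures, hence isometric triangles. The
  isometries of the triangles respect the gluing, because the gluing is described by the generalized circles
  alone, and so they induce an isometry of the surfaces (\<open>packing_isometry_map\<close>).\<close>

section \<open>The total curvature of an arc inside a perpendicular circle\<close>

text \<open>The total curvature of the arc that a circle of radius \<open>r\<close> with \<open>x = tanh r\<close> cuts out of a
  perpendicular generalized circle of curvature \<open>k\<close>. For \<open>k > 1\<close> it is
  \<open>2 k / sqrt (k\<^sup>2 - 1) * arctan (x * sqrt (k\<^sup>2 - 1))\<close>, for \<open>k < 1\<close> the same with the area hyperbolic
  tangent; the integral treats all cases uniformly.\<close>

definition arc_curv :: "real \<Rightarrow> real \<Rightarrow> real" where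
  "arc_curv k x = integral {0..x} (\<lambda>u. 2 * k / (1 + (k\<^sup>2 - 1) * u\<^sup>2))"

lemma arc_curv_denominator_pos:
  fixes k u :: real
  assumes "k > 0" "\<bar>u\<bar> < 1"
  shows "1 + (k\<^sup>2 - 1) * u\<^sup>2 > 0"
proof -
  have "u\<^sup>2 < 1" using assms(2) by (simp add: abs_square_less_1)
  moreover have "k\<^sup>2 * u\<^sup>2 \<ge> 0" by simp
  moreover have "1 + (k\<^sup>2 - 1) * u\<^sup>2 = (1 - u\<^sup>2) + k\<^sup>2 * u\<^sup>2" by (simp add: algebra_simps)
  ultimately show ?thesis by linarith
qed

lemma continuous_on_arc_curv_integrand:
  fixes k x :: real
  assumes "k > 0" "x < 1"
  shows "continuous_on {0..x} (\<lambda>u. 2 * k / (1 + (k\<^sup>2 - 1) * u\<^sup>2))"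
proof -
  have "1 + (k\<^sup>2 - 1) * u\<^sup>2 \<noteq> 0" if "u \<in> {0..x}" for u
    using arc_curv_denominator_pos[of k u] assms that by auto
  then show ?thesis by (intro continuous_intros) auto
qed

lemma arc_curv_has_derivative:
  assumes "k > 0" "b < 1" "x \<in> {0..b}"
  shows "(arc_curv k has_real_derivative 2 * k / (1 + (k\<^sup>2 - 1) * x\<^sup>2)) (at x within {0..b})"
  unfolding arc_curv_def
  using integral_has_real_derivative[OF continuous_on_arc_curv_integrand[OF assms(1,2)] assms(3)] .

lemma arc_curv_0: "arc_curv k 0 = 0" by (simp add: arc_curv_def)

text \<open>The substitution \<open>u = sin \<theta>\<close> turns \<open>arc_curv k (sin t)\<close> into the integral of
  \<open>2 k cos \<theta> / (cos\<^sup>2 \<theta> + k\<^sup>2 sin\<^sup>2 \<theta>)\<close>, that is, of \<open>2 cos \<theta>\<close> against the differential of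
  \<open>arctan (k tan \<theta>)\<close>; integration by parts moves the derivative to the cosine. The boundary term is the
  integral over \<open>t \<le> \<theta> \<le> \<pi>/2\<close>, where the arctangent is frozen at its value at \<open>t\<close>.\<close>

lemma arc_curv_angular:
  assumes k: "k > 0" and t: "0 \<le> t" "t < pi / 2"
  shows "((\<lambda>\<theta>. 2 * sin \<theta> * arctan (k * tan (min \<theta> t))) has_integral arc_curv k (sin t)) {0..pi/2}"
proof -
  have st: "sin t < 1" using sin_monotone_2pi[of t "pi/2"] t by auto
  have 1: "((\<lambda>\<theta>. 2 * sin \<theta> * arctan (k * tan (min \<theta> t))) has_integral
      (arc_curv k (sin t) - 2 * cos t * arctan (k * tan t)) - (arc_curv k (sin 0) - 2 * cos 0 * arctan (k * tan 0))) {0..t}"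
  proof (rule fundamental_theorem_of_calculus[OF t(1)])
    fix x assume x: "x \<in> {0..t}"
    have c: "cos x > 0" using x t by (intro cos_gt_zero_pi) auto
    have sub: "sin ` {0..t} \<subseteq> {0..sin t}" using t by (auto intro!: sin_ge_zero sin_monotone_2pi_le)
    have sx: "sin x \<in> {0..sin t}" using sub x by blast
    have "(arc_curv k has_real_derivative 2 * k / (1 + (k\<^sup>2 - 1) * (sin x)\<^sup>2)) (at (sin x) within sin ` {0..t})"
      using DERIV_subset[OF arc_curv_has_derivative[OF k st sx] sub] .
    moreover have "(sin has_real_derivative cos x) (at x within {0..t})"
      by (auto intro!: derivative_eq_intros)
    ultimately have D1: "((\<lambda>x. arc_curv k (sin x)) has_real_derivative (2 * k / (1 + (k\<^sup>2 - 1) * (sin x)\<^sup>2)) * cos x) (at x within {0..t})"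
      using DERIV_image_chain[of "arc_curv k" _ sin x "{0..t}" "cos x"] unfolding o_def by blast
    have D2: "((\<lambda>x. 2 * cos x * arctan (k * tan x)) has_real_derivative
        2 * cos x * (inverse (1 + (k * tan x)\<^sup>2) * (k * inverse ((cos x)\<^sup>2))) - 2 * sin x * arctan (k * tan x)) (at x within {0..t})"
      using c by (auto intro!: derivative_eq_intros)
    have e: "2 * cos x * (inverse (1 + (k * tan x)\<^sup>2) * (k * inverse ((cos x)\<^sup>2))) = (2 * k / (1 + (k\<^sup>2 - 1) * (sin x)\<^sup>2)) * cos x"
    proof -
      have "(1 + (k * tan x)\<^sup>2) * (cos x)\<^sup>2 = (cos x)\<^sup>2 + k\<^sup>2 * (sin x)\<^sup>2"
        using c by (simp add: tan_def power_mult_distrib power_divide algebra_simps)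
      also have "\<dots> = 1 + (k\<^sup>2 - 1) * (sin x)\<^sup>2" by (simp add: cos_squared_eq algebra_simps)
      finally have "inverse (1 + (k * tan x)\<^sup>2) * inverse ((cos x)\<^sup>2) = inverse (1 + (k\<^sup>2 - 1) * (sin x)\<^sup>2)"
        by (metis inverse_mult_distrib)
      then show ?thesis by (simp add: divide_inverse algebra_simps)
    qed
    have "((\<lambda>x. arc_curv k (sin x) - 2 * cos x * arctan (k * tan x)) has_real_derivative 2 * sin x * arctan (k * tan x)) (at x within {0..t})"
      using DERIV_diff[OF D1 D2] e by (simp add: algebra_simps)
    moreover have "min x t = x" using x by auto
    ultimately show "((\<lambda>x. arc_curv k (sin x) - 2 * cos x * arctan (k * tan x)) has_vector_derivative 2 * sin x * arctan (k * tan (min x t))) (at x within {0..t})"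
      by (simp add: has_real_derivative_iff_has_vector_derivative)
  qed
  have 2: "((\<lambda>\<theta>. 2 * sin \<theta> * arctan (k * tan (min \<theta> t))) has_integral
      (- 2 * cos (pi/2) * arctan (k * tan t)) - (- 2 * cos t * arctan (k * tan t))) {t..pi/2}"
  proof (rule fundamental_theorem_of_calculus)
    show "t \<le> pi/2" using t by simp
    fix x assume x: "x \<in> {t..pi/2}"
    have "((\<lambda>x. - 2 * cos x * arctan (k * tan t)) has_real_derivative 2 * sin x * arctan (k * tan t)) (at x within {t..pi/2})"
      by (auto intro!: derivative_eq_intros)
    moreover have "min x t = t" using x by auto
    ultimately show "((\<lambda>x. - 2 * cos x * arctan (k * tan t)) has_vector_derivative 2 * sin x * arctan (k * tan (min x t))) (at x within {t..pi/2})"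
      by (simp add: has_real_derivative_iff_has_vector_derivative)
  qed
  show ?thesis using has_integral_combine[OF _ _ 1 2] t by (simp add: arc_curv_0)
qed

text \<open>Since \<open>a b < 1\<close>, the sum of the first two angles is acute, and by the hypothesis its tangent is
  \<open>1 / c\<close>.\<close>

lemma arctan_sum_eq_pi_half:
  fixes a b c :: real
  assumes "a > 0" "b > 0" "c > 0" "a * b + b * c + c * a = 1"
  shows "arctan a + arctan b + arctan c = pi / 2"
proof -
  have ab: "a * b < 1" using assms mult_pos_pos[of b c] mult_pos_pos[of c a] by linarith
  have bd: "0 < arctan a" "0 < arctan b" "arctan a < pi/2" "arctan b < pi/2"
    using assms arctan_ubound by auto
  have ca: "cos (arctan a) > 0" "cos (arctan b) > 0" by (simp_all add: cos_arctan) (simp_all add: add_pos_nonneg)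
  have "cos (arctan a + arctan b) = cos (arctan a) * cos (arctan b) * (1 - a * b)"
  proof -
    have "sin (arctan a) = cos (arctan a) * a" "sin (arctan b) = cos (arctan b) * b"
      by (simp_all add: sin_arctan cos_arctan)
    then show ?thesis by (simp add: cos_add algebra_simps)
  qed
  then have cpos: "cos (arctan a + arctan b) > 0" using ca ab by simp
  have lt: "arctan a + arctan b < pi / 2"
  proof (rule ccontr)
    assume "\<not> ?thesis"
    then have "cos (arctan a + arctan b) \<le> cos (pi/2)" using bd by (intro cos_monotone_0_pi_le) auto
    with cpos show False by simp
  qed
  have "tan (arctan a + arctan b) = (a + b) / (1 - a * b)"
    using tan_add[of "arctan a" "arctan b"] ca cpos by (simp add: tan_arctan)
  also have "\<dots> = 1 / c"
    using assms ab by (simp add: field_simps)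
  finally have "arctan a + arctan b = arctan (1 / c)"
    using arctan_tan[of "arctan a + arctan b"] lt bd by simp
  also have "\<dots> = pi / 2 - arctan c"
    using arctan_inverse[of c] assms by (simp add: inverse_eq_divide)
  finally show ?thesis by simp
qed

section \<open>Total curvatures in one triangle\<close>

text \<open>The second elementary symmetric function of the curvatures when \<open>F\<close> has three elements; this form
  makes sense without naming the three vertices.\<close>

definition sig2 :: "'v set \<Rightarrow> ('v \<Rightarrow> real) \<Rightarrow> real" where
  "sig2 F k = ((\<Sum>v\<in>F. k v)\<^sup>2 - (\<Sum>v\<in>F. (k v)\<^sup>2)) / 2"

text \<open>The total curvature, inside the dual circle, of the generalized circle at the vertex \<open>v\<close> of a triangle
  \<open>F\<close>; the dual circle has radius \<open>r\<close> with \<open>1 / tanh r = sqrt (1 + sig2 F k)\<close>.\<close>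

definition face_curv :: "'v set \<Rightarrow> ('v \<Rightarrow> real) \<Rightarrow> 'v \<Rightarrow> real" where
  "face_curv F k v = arc_curv (k v) (1 / sqrt (1 + sig2 F k))"

text \<open>The Gudermannian \<open>arctan (sinh r)\<close> of the radius of the dual circle.\<close>

definition dual_angle :: "'v set \<Rightarrow> ('v \<Rightarrow> real) \<Rightarrow> real" where
  "dual_angle F k = arctan (1 / sqrt (sig2 F k))"

lemma sig2_triple:
  assumes "a \<noteq> b" "b \<noteq> c" "a \<noteq> c"
  shows "sig2 {a, b, c} k = k a * k b + k b * k c + k c * k a"
  using assms by (simp add: sig2_def power2_eq_square algebra_simps)

lemma sig2_bound:
  assumes "card F = 3" "\<forall>v\<in>F. 0 < k v" "u \<in> F" "v \<in> F" "u \<noteq> v"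
  shows "sig2 F k > k u * k v"
proof -
  have fin: "finite F" using assms(1) card.infinite by fastforce
  have "card (F - {u, v}) = 1" using assms fin by (simp add: card_Diff_subset)
  then obtain w where w: "F - {u, v} = {w}" using card_1_singletonE by blast
  have F: "F = {u, v, w}" using w assms by auto
  have "w \<noteq> u" "w \<noteq> v" using w by auto
  then have "sig2 F k = k u * k v + k v * k w + k w * k u" using F assms(5) by (simp add: sig2_triple)
  moreover have "k v * k w > 0" "k w * k u > 0" using assms(2) F by simp_all
  ultimately show ?thesis by linarith
qed

lemma sig2_pos:
  assumes "card F = 3" "\<forall>v\<in>F. 0 < k v"
  shows "sig2 F k > 0"
proof -
  obtain a b c where F: "F = {a, b, c}" "a \<noteq> b" "b \<noteq> c" "a \<noteq> c"
    using assms(1) unfolding card_3_iff by auto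
  have "sig2 F k > k a * k b" using sig2_bound[of F k a b] assms F by auto
  moreover have "k a * k b > 0" using assms(2) F by simp
  ultimately show ?thesis by linarith
qed

lemma sig2_mono:
  assumes "card F = 3" "\<forall>v\<in>F. 0 < k v" "\<forall>v\<in>F. k v \<le> k' v"
  shows "sig2 F k \<le> sig2 F k'"
proof -
  obtain a b c where F: "F = {a, b, c}" "a \<noteq> b" "b \<noteq> c" "a \<noteq> c"
    using assms(1) unfolding card_3_iff by auto
  have "0 < k a" "0 < k b" "0 < k c" "k a \<le> k' a" "k b \<le> k' b" "k c \<le> k' c" using assms F by auto
  then show ?thesis unfolding F(1) sig2_triple[OF F(2-4)]
    by (intro add_mono mult_mono) auto
qed

lemma dual_angle_bounds:
  assumes "card F = 3" "\<forall>v\<in>F. 0 < k v"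
  shows "0 < dual_angle F k" "dual_angle F k < pi / 2" "tan (dual_angle F k) = 1 / sqrt (sig2 F k)"
    "sin (dual_angle F k) = 1 / sqrt (1 + sig2 F k)"
proof -
  note s = sig2_pos[OF assms]
  show "0 < dual_angle F k" "dual_angle F k < pi / 2" "tan (dual_angle F k) = 1 / sqrt (sig2 F k)"
    using s arctan_ubound[of "1 / sqrt (sig2 F k)"] by (simp_all add: dual_angle_def tan_arctan)
  have "sqrt (1 + (1 / sqrt (sig2 F k))\<^sup>2) = sqrt (1 + sig2 F k) / sqrt (sig2 F k)"
    using s by (simp add: power_divide real_sqrt_divide[symmetric] field_simps)
  then show "sin (dual_angle F k) = 1 / sqrt (1 + sig2 F k)"
    using s by (simp add: dual_angle_def sin_arctan)
qed

lemma dual_angle_antimono: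
  assumes "card F = 3" "\<forall>v\<in>F. 0 < k v" "\<forall>v\<in>F. k v \<le> k' v"
  shows "dual_angle F k' \<le> dual_angle F k"
proof -
  have "sig2 F k > 0" by (rule sig2_pos[OF assms(1,2)])
  then show ?thesis using sig2_mono[OF assms]
    by (auto simp: dual_angle_def arctan_le_iff intro!: divide_left_mono)
qed

lemma face_curv_has_integral:
  assumes "card F = 3" "\<forall>v\<in>F. 0 < k v" "v \<in> F"
  shows "((\<lambda>\<theta>. 2 * sin \<theta> * arctan (k v * tan (min \<theta> (dual_angle F k)))) has_integral face_curv F k v) {0..pi/2}"
  using arc_curv_angular[of "k v" "dual_angle F k"] dual_angle_bounds[OF assms(1,2)] assms(2,3)
  by (simp add: face_curv_def)

lemma tan_mono_le_0: "0 \<le> x \<Longrightarrow> x \<le> y \<Longrightarrow> y < pi/2 \<Longrightarrow> tan x \<le> tan y"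
  by (rule tan_mono_le) auto

text \<open>Raising the other two curvatures shrinks the dual angle, and with it the integrand at every
  \<open>\<theta>\<close>.\<close>

lemma face_curv_antimono:
  assumes F: "card F = 3" "\<forall>v\<in>F. 0 < k v" "\<forall>v\<in>F. k v \<le> k' v"
    and v: "v \<in> F" "k' v = k v"
  shows "face_curv F k' v \<le> face_curv F k v"
proof (rule has_integral_le[OF face_curv_has_integral face_curv_has_integral])
  have k': "\<forall>v\<in>F. 0 < k' v" using F(2,3) by force
  show "card F = 3" "v \<in> F" "card F = 3" "v \<in> F" "\<forall>v\<in>F. 0 < k v" "\<forall>v\<in>F. 0 < k' v"
    using assms k' by auto
  fix \<theta> :: real assume t: "\<theta> \<in> {0..pi/2}"
  have "tan (min \<theta> (dual_angle F k')) \<le> tan (min \<theta> (dual_angle F k))"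
    using t dual_angle_antimono[OF F] dual_angle_bounds[OF F(1,2)] dual_angle_bounds[OF F(1) k']
    by (intro tan_mono_le_0) (auto simp: min_def)
  moreover have "sin \<theta> \<ge> 0" using t by (intro sin_ge_zero) auto
  ultimately show "2 * sin \<theta> * arctan (k' v * tan (min \<theta> (dual_angle F k'))) \<le> 2 * sin \<theta> * arctan (k v * tan (min \<theta> (dual_angle F k)))"
    using bspec[OF F(2) v(1)] v by (intro mult_left_mono) (auto simp: arctan_le_iff)
qed

definition angle_sum :: "'v set \<Rightarrow> ('v \<Rightarrow> real) \<Rightarrow> real \<Rightarrow> real" where
  "angle_sum F k \<theta> = (\<Sum>v\<in>F. arctan (k v * tan (min \<theta> (dual_angle F k))))"

lemma face_curv_sum_has_integral:
  assumes "card F = 3" "\<forall>v\<in>F. 0 < k v"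
  shows "((\<lambda>\<theta>. 2 * sin \<theta> * angle_sum F k \<theta>) has_integral (\<Sum>v\<in>F. face_curv F k v)) {0..pi/2}"
proof -
  have fin: "finite F" using assms(1) card.infinite by fastforce
  show ?thesis unfolding angle_sum_def sum_distrib_left
    by (rule has_integral_sum[OF fin]) (use face_curv_has_integral[OF assms] in auto)
qed

lemma continuous_on_angle_sum:
  assumes "card F = 3" "\<forall>v\<in>F. 0 < k v"
  shows "continuous_on {0..pi/2} (angle_sum F k)"
  unfolding angle_sum_def
proof (intro continuous_intros ballI)
  fix x :: real assume "x \<in> {0..pi/2}"
  then show "cos (min x (dual_angle F k)) \<noteq> 0"
    using dual_angle_bounds(1,2)[OF assms] cos_gt_zero_pi[of "min x (dual_angle F k)"] by (auto simp: min_def)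
qed

text \<open>Beyond the dual angle the arguments of the three arctangents are \<open>k v / sqrt (sig2 F k)\<close>, whose
  pairwise products add up to 1. Geometrically: the three arcs divide the full angle at the center of the
  dual circle.\<close>

lemma angle_sum_saturated:
  assumes "card F = 3" "\<forall>v\<in>F. 0 < k v" "dual_angle F k \<le> \<theta>"
  shows "angle_sum F k \<theta> = pi / 2"
proof -
  obtain a b c where F: "F = {a, b, c}" "a \<noteq> b" "b \<noteq> c" "a \<noteq> c"
    using assms(1) unfolding card_3_iff by auto
  define s where "s = sqrt (sig2 F k)"
  have s: "s > 0" "s\<^sup>2 = k a * k b + k b * k c + k c * k a"
    using sig2_pos[OF assms(1,2)] sig2_triple[OF F(2-4), of k] F(1) by (auto simp: s_def)
  have "arctan (k a / s) + arctan (k b / s) + arctan (k c / s) = pi / 2"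
  proof (rule arctan_sum_eq_pi_half)
    have "k a / s * (k b / s) + k b / s * (k c / s) + k c / s * (k a / s) = (k a * k b + k b * k c + k c * k a) / s\<^sup>2"
      by (simp add: power2_eq_square add_divide_distrib)
    then show "k a / s * (k b / s) + k b / s * (k c / s) + k c / s * (k a / s) = 1"
      unfolding s(2)[symmetric] using s(1) by simp
  qed (use s(1) assms(2) F(1) in simp_all)
  then show ?thesis
    using assms(3) dual_angle_bounds(3)[OF assms(1,2)] F s_def by (simp add: angle_sum_def min_def)
qed

lemma angle_sum_unsaturated:
  assumes "\<theta> \<le> dual_angle F k"
  shows "angle_sum F k \<theta> = (\<Sum>v\<in>F. arctan (k v * tan \<theta>))"
  using assms by (simp add: angle_sum_def min_def)

lemma sum_arctan_mono:
  assumes "\<forall>v\<in>F. 0 \<le> k v" "\<forall>v\<in>F. k v \<le> k' v" "0 \<le> x" "x \<le> y"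
  shows "(\<Sum>v\<in>F. arctan (k v * x)) \<le> (\<Sum>v\<in>F. arctan (k' v * y))"
proof (rule sum_mono)
  fix v assume "v \<in> F"
  then have "k v * x \<le> k' v * y" using assms by (intro mult_mono) (auto intro: order_trans)
  then show "arctan (k v * x) \<le> arctan (k' v * y)" by (simp add: arctan_le_iff)
qed

lemma angle_sum_le:
  assumes "card F = 3" "\<forall>v\<in>F. 0 < k v" "0 \<le> \<theta>"
  shows "angle_sum F k \<theta> \<le> pi / 2"
proof -
  note d = dual_angle_bounds[OF assms(1,2)]
  have "angle_sum F k \<theta> \<le> (\<Sum>v\<in>F. arctan (k v * tan (dual_angle F k)))"
    unfolding angle_sum_def
  proof (rule sum_arctan_mono)
    have "0 \<le> min \<theta> (dual_angle F k)" "min \<theta> (dual_angle F k) \<le> dual_angle F k" using assms(3) d(1) by auto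
    then show "0 \<le> tan (min \<theta> (dual_angle F k))"
      "tan (min \<theta> (dual_angle F k)) \<le> tan (dual_angle F k)"
      using d(2) tan_mono_le_0[of 0 "min \<theta> (dual_angle F k)"] tan_mono_le_0[of "min \<theta> (dual_angle F k)" "dual_angle F k"]
      by auto
    show "\<forall>v\<in>F. 0 \<le> k v" using assms(2) by (simp add: less_imp_le)
  qed simp
  also have "\<dots> = pi / 2"
    using angle_sum_saturated[OF assms(1,2) order_refl] by (simp add: angle_sum_def)
  finally show ?thesis .
qed

lemma angle_sum_less:
  assumes "card F = 3" "\<forall>v\<in>F. 0 < k v" "0 \<le> \<theta>" "\<theta> < dual_angle F k"
  shows "angle_sum F k \<theta> < pi / 2"
proof -
  note d = dual_angle_bounds[OF assms(1,2)]
  have fin: "finite F" "F \<noteq> {}" using assms(1) card.infinite by fastforce+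
  have "angle_sum F k \<theta> < (\<Sum>v\<in>F. arctan (k v * tan (dual_angle F k)))"
    unfolding angle_sum_def
  proof (rule sum_strict_mono[OF fin])
    fix v assume v: "v \<in> F"
    have "tan \<theta> < tan (dual_angle F k)" using assms d by (intro tan_monotone) auto
    then show "arctan (k v * tan (min \<theta> (dual_angle F k))) < arctan (k v * tan (dual_angle F k))"
      using bspec[OF assms(2) v] assms(4) by (simp add: arctan_less_iff min_def)
  qed
  also have "\<dots> = pi / 2"
    using angle_sum_saturated[OF assms(1,2) order_refl] by (simp add: angle_sum_def)
  finally show ?thesis .
qed

text \<open>Equality of the integrals would force the continuous nonnegative difference to vanish
  everywhere.\<close>

lemma strict_integral_mono:
  fixes f g :: "real \<Rightarrow> real"
  assumes "a < b" and f: "(f has_integral i) {a..b}" and g: "(g has_integral j) {a..b}"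
    and cont: "continuous_on {a..b} f" "continuous_on {a..b} g"
    and le: "\<And>x. x \<in> {a..b} \<Longrightarrow> f x \<le> g x" and x: "x \<in> {a..b}" "f x < g x"
  shows "i < j"
proof -
  have "i \<le> j" by (rule has_integral_le[OF f g le])
  moreover have "i \<noteq> j"
  proof
    assume "i = j"
    then have "((\<lambda>x. g x - f x) has_integral 0) (cbox a b)"
      using has_integral_diff[OF g f] by simp
    moreover have "continuous_on (cbox a b) (\<lambda>x. g x - f x)" using cont by (auto intro!: continuous_intros)
    ultimately have "g x - f x = 0"
      using \<open>a < b\<close> le x has_integral_0_cbox_imp_0[of a b "\<lambda>x. g x - f x" x]
      by (auto simp: cbox_interval box_real) 
    with x show False by simp
  qed
  ultimately show ?thesis by simp
qed

text \<open>The integrand \<open>angle_sum\<close> is the minimum of \<open>\<pi>/2\<close> and the sum of the \<open>arctan (k v * tan \<theta>)\<close>,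
  both of which are monotone in \<open>k\<close>. At the smaller of the two dual angles the increase is strict.\<close>

lemma face_curv_sum_strict_mono:
  assumes F: "card F = 3" "\<forall>v\<in>F. 0 < k v" "\<forall>v\<in>F. k v \<le> k' v" and u: "u \<in> F" "k u < k' u"
  shows "(\<Sum>v\<in>F. face_curv F k v) < (\<Sum>v\<in>F. face_curv F k' v)"
proof -
  have k': "\<forall>v\<in>F. 0 < k' v" using F(2,3) by force
  note d = dual_angle_bounds[OF F(1,2)] and d' = dual_angle_bounds[OF F(1) k']
  have anti: "dual_angle F k' \<le> dual_angle F k" by (rule dual_angle_antimono[OF F])
  have fin: "finite F" using F(1) card.infinite by fastforce
  have le: "angle_sum F k \<theta> \<le> angle_sum F k' \<theta>" if t: "0 \<le> \<theta>" for \<theta>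
  proof (cases "\<theta> \<le> dual_angle F k'")
    case True
    then have "0 \<le> tan \<theta>" using t d'(2) by (intro tan_pos_pi2_le) auto
    moreover have "\<forall>v\<in>F. 0 \<le> k v" using F(2) by (simp add: less_imp_le)
    ultimately show ?thesis using True anti F(3)
      by (simp add: angle_sum_unsaturated sum_arctan_mono)
  next
    case False
    then show ?thesis using angle_sum_saturated[OF F(1) k', of \<theta>] angle_sum_le[OF F(1,2) t] by simp
  qed
  have lt: "angle_sum F k (dual_angle F k') < angle_sum F k' (dual_angle F k')"
  proof -
    have tp: "tan (dual_angle F k') > 0" using d'(1,2) tan_gt_zero by auto
    have "(\<Sum>v\<in>F. arctan (k v * tan (dual_angle F k'))) < (\<Sum>v\<in>F. arctan (k' v * tan (dual_angle F k')))"
      using F(3) u tp by (intro sum_strict_mono_ex1[OF fin]) (auto simp: arctan_le_iff arctan_less_iff)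
    then show ?thesis using anti by (simp add: angle_sum_unsaturated)
  qed
  show ?thesis
  proof (rule strict_integral_mono[OF _ face_curv_sum_has_integral[OF F(1,2)] face_curv_sum_has_integral[OF F(1) k']])
    show "dual_angle F k' \<in> {0..pi/2}" using d' by auto
    show "2 * sin (dual_angle F k') * angle_sum F k (dual_angle F k') < 2 * sin (dual_angle F k') * angle_sum F k' (dual_angle F k')"
      using lt sin_gt_zero[of "dual_angle F k'"] d'(1,2) by (intro mult_strict_left_mono) auto
    show "2 * sin x * angle_sum F k x \<le> 2 * sin x * angle_sum F k' x" if "x \<in> {0..pi/2}" for x
      using le[of x] that by (intro mult_left_mono) (auto intro!: sin_ge_zero)
  qed (auto intro!: continuous_intros continuous_on_angle_sum F k')
qed

lemma has_integral_sin_quarter: "((\<lambda>\<theta>. 2 * sin \<theta> * (pi / 2)) has_integral pi) {0..pi/2}"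
proof -
  have "((\<lambda>\<theta>. 2 * sin \<theta> * (pi / 2)) has_integral (- pi * cos (pi/2)) - (- pi * cos 0)) {0..pi/2}"
    by (rule fundamental_theorem_of_calculus)
      (auto intro!: derivative_eq_intros simp: has_real_derivative_iff_has_vector_derivative[symmetric])
  then show ?thesis by simp
qed

text \<open>By the Gauss-Bonnet theorem the defect is the area of the interstice between the three curves; here it is
  the gap between \<open>angle_sum\<close> and \<open>\<pi>/2\<close> below the dual angle.\<close>

lemma face_curv_sum_less_pi:
  assumes F: "card F = 3" "\<forall>v\<in>F. 0 < k v"
  shows "(\<Sum>v\<in>F. face_curv F k v) < pi"
proof (rule strict_integral_mono[OF _ face_curv_sum_has_integral[OF F] has_integral_sin_quarter])
  note d = dual_angle_bounds[OF F]
  show "dual_angle F k / 2 \<in> {0..pi/2}" using d by auto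
  have "sin (dual_angle F k / 2) > 0" using d by (intro sin_gt_zero) auto
  then show "2 * sin (dual_angle F k / 2) * angle_sum F k (dual_angle F k / 2) < 2 * sin (dual_angle F k / 2) * (pi / 2)"
    using angle_sum_less[OF F, of "dual_angle F k / 2"] d by (intro mult_strict_left_mono) auto
  show "2 * sin x * angle_sum F k x \<le> 2 * sin x * (pi / 2)" if "x \<in> {0..pi/2}" for x
    using angle_sum_le[OF F, of x] that by (intro mult_left_mono) (auto intro!: sin_ge_zero)
qed (auto intro!: continuous_intros continuous_on_angle_sum F)

lemma arctan_ge_complement:
  fixes x :: real
  assumes "x > 0" shows "pi / 2 - 1 / x \<le> arctan x"
proof -
  have "arctan (1 / x) \<le> 1 / x" using assms by (intro arctan_le_self) auto
  moreover have "arctan (inverse x) = pi / 2 - arctan x" using arctan_inverse[of x] assms by simp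
  ultimately show ?thesis by (simp add: inverse_eq_divide)
qed

text \<open>One large curvature alone already makes \<open>angle_sum\<close> nearly \<open>\<pi>/2\<close> except for small \<open>\<theta>\<close>: by
  \<open>arctan_ge_complement\<close> the loss at \<open>\<theta>\<close> is at most \<open>1 / (k u * tan \<theta>)\<close>.\<close>

lemma face_curv_sum_ge:
  assumes F: "card F = 3" "\<forall>v\<in>F. 0 < k v" and u: "u \<in> F"
  shows "(\<Sum>v\<in>F. face_curv F k v) \<ge> pi - 2 / k u"
proof -
  note d = dual_angle_bounds[OF F]
  have fin: "finite F" using F(1) card.infinite by fastforce
  have ku: "k u > 0" using F u by auto
  (* the integral of the lower bound; the factor sin \<theta> cancels the pole of 1 / tan \<theta> at 0 *)
  have I: "((\<lambda>\<theta>. 2 * sin \<theta> * (pi / 2) - 2 / k u * cos \<theta>) has_integral pi - 2 / k u) {0..pi/2}"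
  proof -
    have "((\<lambda>\<theta>. 2 / k u * cos \<theta>) has_integral 2 / k u * sin (pi/2) - 2 / k u * sin 0) {0..pi/2}"
      using ku by (intro fundamental_theorem_of_calculus)
        (auto intro!: derivative_eq_intros simp: has_real_derivative_iff_has_vector_derivative[symmetric])
    from has_integral_diff[OF has_integral_sin_quarter this] show ?thesis by simp
  qed
  show ?thesis
  proof (rule has_integral_le[OF I face_curv_sum_has_integral[OF F]])
    fix x :: real assume x: "x \<in> {0..pi/2}"
    have s0: "sin x \<ge> 0" using x by (intro sin_ge_zero) auto
    have c0: "cos x \<ge> 0" using x by (intro cos_ge_zero) auto
    consider "x = 0" | "0 < x" "x \<le> dual_angle F k" | "dual_angle F k \<le> x" using x by fastforce
    then show "2 * sin x * (pi / 2) - 2 / k u * cos x \<le> 2 * sin x * angle_sum F k x"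
    proof cases
      case 1 then show ?thesis using ku by simp
    next
      case 2
      have sp: "sin x > 0" using 2 d by (intro sin_gt_zero) auto
      have cp: "cos x > 0" using 2 d by (intro cos_gt_zero_pi) auto
      have tp: "tan x > 0" using sp cp by (simp add: tan_def)
      have "pi / 2 - 1 / (k u * tan x) \<le> arctan (k u * tan x)" using ku tp by (intro arctan_ge_complement) simp
      also have "\<dots> \<le> (\<Sum>v\<in>F. arctan (k v * tan x))"
        using F(2) tp u fin by (intro member_le_sum) auto
      finally have "pi / 2 - 1 / (k u * tan x) \<le> angle_sum F k x" using 2 by (simp add: angle_sum_unsaturated)
      then have "2 * sin x * (pi / 2 - 1 / (k u * tan x)) \<le> 2 * sin x * angle_sum F k x"
        using sp by (intro mult_left_mono) auto
      moreover have "2 * sin x * (pi / 2 - 1 / (k u * tan x)) = 2 * sin x * (pi / 2) - 2 / k u * cos x"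
        using sp cp ku by (simp add: tan_def field_simps)
      ultimately show ?thesis by simp
    next
      case 3
      have "2 / k u * cos x \<ge> 0" using ku c0 by simp
      then show ?thesis unfolding angle_sum_saturated[OF F 3] by linarith
    qed
  qed
qed

lemma face_curv_pos:
  assumes F: "card F = 3" "\<forall>v\<in>F. 0 < k v" and v: "v \<in> F"
  shows "face_curv F k v \<ge> 0"
proof (rule has_integral_nonneg[OF face_curv_has_integral[OF F v]])
  note d = dual_angle_bounds[OF F]
  fix x :: real assume x: "x \<in> {0..pi/2}"
  have "sin x \<ge> 0" using x by (intro sin_ge_zero) auto
  moreover have "tan (min x (dual_angle F k)) \<ge> 0" using x d by (intro tan_pos_pi2_le) auto
  ultimately show "0 \<le> 2 * sin x * arctan (k v * tan (min x (dual_angle F k)))" using F v less_imp_le by auto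
qed

lemma has_integral_sin_const: "((\<lambda>\<theta>. 2 * sin \<theta> * c) has_integral 2 * c) {0..pi/2}"
proof -
  have "((\<lambda>\<theta>. 2 * sin \<theta> * c) has_integral (- 2 * c * cos (pi/2)) - (- 2 * c * cos 0)) {0..pi/2}"
    by (rule fundamental_theorem_of_calculus)
      (auto intro!: derivative_eq_intros simp: has_real_derivative_iff_has_vector_derivative[symmetric])
  then show ?thesis by simp
qed

text \<open>Beside a neighbour of much larger curvature the total curvature is small, since the argument of the
  arctangent never exceeds \<open>k v / sqrt (k v * k u)\<close>.\<close>

lemma face_curv_le_ratio:
  assumes F: "card F = 3" "\<forall>v\<in>F. 0 < k v" and v: "v \<in> F" and u: "u \<in> F" "u \<noteq> v"
  shows "face_curv F k v \<le> 2 * sqrt (k v / k u)"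
proof (rule has_integral_le[OF face_curv_has_integral[OF F v] has_integral_sin_const])
  note d = dual_angle_bounds[OF F]
  have kp: "k v > 0" "k u > 0" using F u v by auto
  fix x :: real assume x: "x \<in> {0..pi/2}"
  have s: "sin x \<ge> 0" using x by (intro sin_ge_zero) auto
  have t0: "tan (min x (dual_angle F k)) \<ge> 0" using x d by (intro tan_pos_pi2_le) auto
  have t1: "tan (min x (dual_angle F k)) \<le> 1 / sqrt (sig2 F k)"
    using x d(1,2) tan_mono_le_0[of "min x (dual_angle F k)" "dual_angle F k"] unfolding d(3)[symmetric] by auto
  have "arctan (k v * tan (min x (dual_angle F k))) \<le> k v * tan (min x (dual_angle F k))"
    using kp t0 by (intro arctan_le_self) auto
  also have "\<dots> \<le> k v * (1 / sqrt (sig2 F k))" using t1 kp by (intro mult_left_mono) auto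
  also have "\<dots> \<le> k v * (1 / sqrt (k v * k u))"
    using sig2_bound[OF F(1) _ v u(1)] F(2) u(2) kp sig2_pos[OF F]
    by (intro mult_left_mono divide_left_mono) (auto simp: mult.commute intro!: less_imp_le)
  also have "\<dots> = sqrt (k v / k u)"
    using kp by (simp add: real_sqrt_mult real_sqrt_divide field_simps)
  finally show "2 * sin x * arctan (k v * tan (min x (dual_angle F k))) \<le> 2 * sin x * sqrt (k v / k u)"
    using s by (intro mult_left_mono) auto
qed

lemma arctan_le_2_sqrt:
  fixes y :: real assumes "y \<ge> 0" shows "arctan y \<le> 2 * sqrt y"
proof (cases "y \<le> 1")
  case True
  have "arctan y \<le> y" using assms by (rule arctan_le_self)
  also have "y = sqrt y * sqrt y" using assms by simp
  also have "\<dots> \<le> 1 * sqrt y" using True assms by (intro mult_right_mono) auto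
  also have "1 * sqrt y \<le> 2 * sqrt y" using assms by (intro mult_right_mono) auto
  finally show ?thesis .
next
  case False
  then have "sqrt y \<ge> 1" by simp
  moreover have "arctan y \<le> 2" using arctan_ubound[of y] pi_less_4 by linarith
  ultimately show ?thesis by linarith
qed

text \<open>The bound \<open>arctan y \<le> y\<close> would give the integral of \<open>sin \<theta> tan \<theta>\<close>, which diverges at
  \<open>\<pi>/2\<close>; with \<open>arctan y \<le> 2 sqrt y\<close> the singularity at \<open>\<pi>/2\<close> becomes integrable.\<close>

lemma face_curv_le_sqrt:
  assumes F: "card F = 3" "\<forall>v\<in>F. 0 < k v" and v: "v \<in> F"
  shows "face_curv F k v \<le> 8 * sqrt (k v)"
proof -
  note d = dual_angle_bounds[OF F]
  have kp: "k v > 0" using F v by auto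
  have I: "((\<lambda>\<theta>. 4 * sqrt (k v) * (sin \<theta> / sqrt (cos \<theta>))) has_integral
     (- 8 * sqrt (k v) * sqrt (cos (pi/2))) - (- 8 * sqrt (k v) * sqrt (cos 0))) {0..pi/2}"
  proof (rule fundamental_theorem_of_calculus_interior)
    show "continuous_on {0..pi / 2} (\<lambda>a. - 8 * sqrt (k v) * sqrt (cos a))" by (intro continuous_intros)
    fix x :: real assume x: "x \<in> {0<..<pi/2}"
    have "cos x > 0" using x by (intro cos_gt_zero_pi) auto
    then have "((\<lambda>a. - 8 * sqrt (k v) * sqrt (cos a)) has_real_derivative 4 * sqrt (k v) * (sin x / sqrt (cos x))) (at x)"
      by (auto intro!: derivative_eq_intros simp: field_simps)
    then show "((\<lambda>a. - 8 * sqrt (k v) * sqrt (cos a)) has_vector_derivative 4 * sqrt (k v) * (sin x / sqrt (cos x))) (at x)"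
      by (simp add: has_real_derivative_iff_has_vector_derivative)
  qed simp
  have "face_curv F k v \<le> (- 8 * sqrt (k v) * sqrt (cos (pi/2))) - (- 8 * sqrt (k v) * sqrt (cos 0))"
  (* at \<pi>/2 the bound is 0 by the convention x / 0 = 0, so both integrands are changed there *)
  proof (rule has_integral_le[OF has_integral_spike_interior has_integral_spike_interior])
    show "((\<lambda>\<theta>. 2 * sin \<theta> * arctan (k v * tan (min \<theta> (dual_angle F k)))) has_integral face_curv F k v) (cbox 0 (pi/2))"
      using face_curv_has_integral[OF F v] by simp
    show "((\<lambda>\<theta>. 4 * sqrt (k v) * (sin \<theta> / sqrt (cos \<theta>))) has_integral
     (- 8 * sqrt (k v) * sqrt (cos (pi/2))) - (- 8 * sqrt (k v) * sqrt (cos 0))) (cbox 0 (pi/2))" using I by simp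
    show "(if x = pi / 2 then 0 else 2 * sin x * arctan (k v * tan (min x (dual_angle F k)))) = 2 * sin x * arctan (k v * tan (min x (dual_angle F k)))"
      if "x \<in> box 0 (pi/2)" for x using that by (auto simp: box_real)
    show "(if x = pi / 2 then 0 else 4 * sqrt (k v) * (sin x / sqrt (cos x))) = 4 * sqrt (k v) * (sin x / sqrt (cos x))"
      if "x \<in> box 0 (pi/2)" for x using that by (auto simp: box_real)
    fix x :: real assume x: "x \<in> cbox 0 (pi/2)"
    show "(if x = pi / 2 then 0 else 2 * sin x * arctan (k v * tan (min x (dual_angle F k)))) \<le> (if x = pi / 2 then 0 else 4 * sqrt (k v) * (sin x / sqrt (cos x)))"
    proof (cases "x = pi / 2")
      case False
      have x: "0 \<le> x" "x < pi / 2" using x False by auto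
      have s: "sin x \<ge> 0" using x by (intro sin_ge_zero) auto
      have c: "cos x > 0" using x by (intro cos_gt_zero_pi) auto
      have t0: "tan (min x (dual_angle F k)) \<ge> 0" using x d by (intro tan_pos_pi2_le) auto
      have "tan (min x (dual_angle F k)) \<le> tan x"
        using x d(1,2) by (intro tan_mono_le_0) auto
      also have "\<dots> \<le> 1 / cos x" using c by (simp add: tan_def divide_right_mono)
      finally have t1: "tan (min x (dual_angle F k)) \<le> 1 / cos x" .
      have "arctan (k v * tan (min x (dual_angle F k))) \<le> 2 * sqrt (k v * tan (min x (dual_angle F k)))"
        using kp t0 by (intro arctan_le_2_sqrt) auto
      also have "\<dots> \<le> 2 * sqrt (k v * (1 / cos x))"
        using t1 kp by (intro mult_left_mono real_sqrt_le_mono) auto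
      also have "\<dots> = 2 * sqrt (k v) / sqrt (cos x)" by (simp add: real_sqrt_divide)
      finally have "2 * sin x * arctan (k v * tan (min x (dual_angle F k))) \<le> 2 * sin x * (2 * sqrt (k v) / sqrt (cos x))"
        using s by (intro mult_left_mono) auto
      then show ?thesis using False by (simp add: algebra_simps)
    qed simp
  qed
  then show ?thesis by simp
qed

lemma abs_arctan_diff:
  fixes a b :: real
  shows "\<bar>arctan a - arctan b\<bar> \<le> \<bar>a - b\<bar>"
proof -
  have "norm (arctan a - arctan b) \<le> 1 * norm (a - b)"
  proof (rule field_differentiable_bound[where S = UNIV and f' = "\<lambda>x. inverse (1 + x\<^sup>2)"])
    fix z :: real
    show "(arctan has_field_derivative inverse (1 + z\<^sup>2)) (at z within UNIV)" by (rule DERIV_arctan)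
    have "1 \<le> 1 + z\<^sup>2" by simp
    then have "inverse (1 + z\<^sup>2) \<le> 1" by (rule inverse_le_1_iff[THEN iffD2, OF disjI2])
    then show "norm (inverse (1 + z\<^sup>2)) \<le> 1" using \<open>1 \<le> 1 + z\<^sup>2\<close> by simp
  qed auto
  then show ?thesis by simp
qed

text \<open>The integrands differ by at most a constant multiple of \<open>sin \<theta>\<close>, because the arctangent is
  1-Lipschitz and cutting \<open>tan\<close> off at two different angles changes it by at most the difference of the two
  cut-off values.\<close>

lemma face_curv_tendsto:
  assumes F: "card F = 3" and kn: "\<And>n. \<forall>v\<in>F. 0 < kn n v" and k: "\<forall>v\<in>F. 0 < k v"
    and lim: "\<And>v. v \<in> F \<Longrightarrow> (\<lambda>n. kn n v) \<longlonglongrightarrow> k v" and v: "v \<in> F"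
  shows "(\<lambda>n. face_curv F (kn n) v) \<longlonglongrightarrow> face_curv F k v"
proof -
  define e where "e n = 1 / sqrt (sig2 F (kn n))" for n
  define e0 where "e0 = 1 / sqrt (sig2 F k)"
  have "(\<lambda>n. sig2 F (kn n)) \<longlonglongrightarrow> sig2 F k" unfolding sig2_def by (intro tendsto_intros lim) auto
  then have e: "e \<longlonglongrightarrow> e0" unfolding e_def e0_def using sig2_pos[OF F k] by (intro tendsto_intros) auto
  define B where "B n = 2 * (\<bar>kn n v - k v\<bar> * e0 + kn n v * \<bar>e n - e0\<bar>)" for n
  have "B \<longlonglongrightarrow> 2 * (\<bar>k v - k v\<bar> * e0 + k v * \<bar>e0 - e0\<bar>)"
    unfolding B_def by (intro tendsto_intros lim v e)
  then have B0: "B \<longlonglongrightarrow> 0" by simp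
  have bnd: "\<bar>face_curv F (kn n) v - face_curv F k v\<bar> \<le> B n" for n
  proof -
    note d = dual_angle_bounds[OF F k] and dn = dual_angle_bounds[OF F kn[of n]]
    let ?c = "\<bar>kn n v - k v\<bar> * e0 + kn n v * \<bar>e n - e0\<bar>"
    have pw: "\<bar>2 * sin x * arctan (kn n v * tan (min x (dual_angle F (kn n)))) - 2 * sin x * arctan (k v * tan (min x (dual_angle F k)))\<bar> \<le> 2 * sin x * ?c"
      if x: "x \<in> {0..pi/2}" for x
    proof -
      have s: "sin x \<ge> 0" using x by (intro sin_ge_zero) auto
      let ?t = "tan (min x (dual_angle F k))" and ?tn = "tan (min x (dual_angle F (kn n)))"
      have t: "0 \<le> ?t" "?t \<le> e0"
        using x d(1,2) tan_mono_le_0[of "min x (dual_angle F k)" "dual_angle F k"]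
        unfolding e0_def d(3)[symmetric] by (auto intro!: tan_pos_pi2_le)
      have tt: "\<bar>?tn - ?t\<bar> \<le> \<bar>e n - e0\<bar>"
      proof -
        have A: "\<bar>tan (min x a) - tan (min x b)\<bar> \<le> \<bar>tan a - tan b\<bar>"
          if "0 < a" "a \<le> b" "b < pi/2" for a b
        proof (cases "x \<le> a")
          case False
          then have "tan a \<le> tan (min x b)" "tan (min x b) \<le> tan b" "tan (min x a) = tan a"
            using that x by (auto intro!: tan_mono_le_0 simp: min_def)
          then show ?thesis by linarith
        qed (use that in \<open>auto simp: min_def\<close>)
        show ?thesis unfolding e_def e0_def d(3)[symmetric] dn(3)[symmetric]
          using A[of "dual_angle F (kn n)" "dual_angle F k"] A[of "dual_angle F k" "dual_angle F (kn n)"] d(1,2) dn(1,2)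
          by (cases "dual_angle F (kn n) \<le> dual_angle F k") (auto simp: abs_minus_commute)
      qed
      have "\<bar>arctan (kn n v * ?tn) - arctan (k v * ?t)\<bar> \<le> \<bar>kn n v * ?tn - k v * ?t\<bar>"
        by (rule abs_arctan_diff)
      also have "kn n v * ?tn - k v * ?t = (kn n v - k v) * ?t + kn n v * (?tn - ?t)" by (simp add: algebra_simps)
      also have "\<bar>\<dots>\<bar> \<le> \<bar>kn n v - k v\<bar> * ?t + kn n v * \<bar>?tn - ?t\<bar>"
        using t kn[of n] v less_imp_le by (intro order_trans[OF abs_triangle_ineq]) (auto simp: abs_mult)
      also have "\<dots> \<le> ?c" using t tt kn[of n] v by (intro add_mono mult_left_mono) (auto simp: less_imp_le)
      finally have "2 * sin x * \<bar>arctan (kn n v * ?tn) - arctan (k v * ?t)\<bar> \<le> 2 * sin x * ?c"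
        using s by (intro mult_left_mono) auto
      then show ?thesis using s by (simp add: abs_mult flip: right_diff_distrib)
    qed
    have I: "((\<lambda>x. 2 * sin x * arctan (kn n v * tan (min x (dual_angle F (kn n)))) - 2 * sin x * arctan (k v * tan (min x (dual_angle F k)))) has_integral
      face_curv F (kn n) v - face_curv F k v) {0..pi/2}"
      by (intro has_integral_diff face_curv_has_integral F k kn v)
    have "face_curv F (kn n) v - face_curv F k v \<le> 2 * ?c"
      by (rule has_integral_le[OF I has_integral_sin_const]) (use pw in \<open>auto dest: abs_le_D1\<close>)
    moreover have "- (face_curv F (kn n) v - face_curv F k v) \<le> 2 * ?c"
      by (rule has_integral_le[OF has_integral_neg[OF I] has_integral_sin_const]) (use pw in \<open>fastforce dest: abs_le_D2\<close>)
    ultimately show ?thesis by (simp add: B_def)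
  qed
  have "(\<lambda>n. face_curv F (kn n) v - face_curv F k v) \<longlonglongrightarrow> 0"
    by (rule Lim_null_comparison[OF _ B0]) (use bnd in auto)
  then show ?thesis by (simp add: LIM_zero_iff)
qed

section \<open>Prescribing total curvatures at the vertices\<close>

definition vertex_curv :: "('f \<Rightarrow> 'v set) \<Rightarrow> 'f set \<Rightarrow> ('v \<Rightarrow> real) \<Rightarrow> 'v \<Rightarrow> real" where
  "vertex_curv fv Fs k v = (\<Sum>f | f \<in> Fs \<and> v \<in> fv f. face_curv (fv f) k v)"

definition star_faces :: "('f \<Rightarrow> 'v set) \<Rightarrow> 'f set \<Rightarrow> 'v set \<Rightarrow> 'f set" where
  "star_faces fv Fs I = {f\<in>Fs. \<exists>v\<in>I. v \<in> fv f}"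

lemma sum_vertex_swap:
  fixes g :: "'f \<Rightarrow> 'v \<Rightarrow> real"
  assumes "finite Fs" "finite I"
  shows "(\<Sum>v\<in>I. \<Sum>f | f \<in> Fs \<and> v \<in> fv f. g f v)
       = (\<Sum>f\<in>star_faces fv Fs I. \<Sum>v\<in>fv f \<inter> I. g f v)"
proof -
  have "(\<Sum>v\<in>I. \<Sum>f | f \<in> Fs \<and> v \<in> fv f. g f v) = (\<Sum>f\<in>Fs. \<Sum>v | v \<in> I \<and> v \<in> fv f. g f v)"
    by (rule sum.swap_restrict[OF assms(2,1)])
  also have "\<dots> = (\<Sum>f\<in>star_faces fv Fs I. \<Sum>v | v \<in> I \<and> v \<in> fv f. g f v)"
    by (rule sum.mono_neutral_right[OF assms(1)]) (auto simp: star_faces_def intro!: sum.neutral)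
  also have "\<dots> = (\<Sum>f\<in>star_faces fv Fs I. \<Sum>v\<in>fv f \<inter> I. g f v)"
    by (intro sum.cong) auto
  finally show ?thesis .
qed

context
  fixes fv :: "'f \<Rightarrow> 'v set" and Fs :: "'f set" and Vi :: "'v set"
  assumes fin: "finite Fs" "finite Vi" and card3: "\<And>f. f \<in> Fs \<Longrightarrow> card (fv f) = 3"
    and cover: "\<And>v. v \<in> Vi \<Longrightarrow> \<exists>f\<in>Fs. v \<in> fv f"
begin

lemma fin_fv: "f \<in> Fs \<Longrightarrow> finite (fv f)"
  using card3[of f] card.infinite by fastforce

lemma star_faces_nonempty: "I \<subseteq> Vi \<Longrightarrow> I \<noteq> {} \<Longrightarrow> star_faces fv Fs I \<noteq> {}"
  using cover by (fastforce simp: star_faces_def)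

lemma vertex_curv_sum:
  assumes "I \<subseteq> Vi"
  shows "(\<Sum>v\<in>I. vertex_curv fv Fs k v) = (\<Sum>f\<in>star_faces fv Fs I. \<Sum>v\<in>fv f \<inter> I. face_curv (fv f) k v)"
  unfolding vertex_curv_def by (rule sum_vertex_swap[OF fin(1) finite_subset[OF assms fin(2)]])

text \<open>Each face that meets \<open>I\<close> contributes less than \<open>\<pi>\<close>, and there is at least one such face.\<close>

lemma vertex_curv_sum_less:
  assumes k: "\<And>f v. f \<in> Fs \<Longrightarrow> v \<in> fv f \<Longrightarrow> 0 < k v" and I: "I \<subseteq> Vi" "I \<noteq> {}"
  shows "(\<Sum>v\<in>I. vertex_curv fv Fs k v) < pi * real (card (star_faces fv Fs I))"
proof -
  have "(\<Sum>v\<in>I. vertex_curv fv Fs k v) < (\<Sum>f\<in>star_faces fv Fs I. pi)"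
    unfolding vertex_curv_sum[OF I(1)]
  proof (rule sum_strict_mono)
    show "finite (star_faces fv Fs I)" using fin by (simp add: star_faces_def)
    show "star_faces fv Fs I \<noteq> {}" by (rule star_faces_nonempty[OF I])
    fix f assume "f \<in> star_faces fv Fs I"
    then have f: "f \<in> Fs" by (simp add: star_faces_def)
    have kf: "\<forall>v\<in>fv f. 0 < k v" using k f by blast
    have "(\<Sum>v\<in>fv f \<inter> I. face_curv (fv f) k v) \<le> (\<Sum>v\<in>fv f. face_curv (fv f) k v)"
      using face_curv_pos[OF card3[OF f] kf] fin_fv[OF f] by (intro sum_mono2) auto
    also have "\<dots> < pi" by (rule face_curv_sum_less_pi[OF card3[OF f] kf])
    finally show "(\<Sum>v\<in>fv f \<inter> I. face_curv (fv f) k v) < pi" .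
  qed
  then show ?thesis by (simp add: mult.commute)
qed

text \<open>Pass from \<open>k\<close> to \<open>k'\<close> through the function \<open>m\<close> that agrees with \<open>k'\<close> on \<open>I\<close> and with \<open>k\<close> elsewhere.
  In the first step the full sum increases while the part outside \<open>I\<close> decreases, so the part over \<open>I\<close>
  increases strictly; in the second step only curvatures outside \<open>I\<close> are lowered, which raises every
  summand.\<close>

lemma face_curv_partial_sum_strict_mono:
  assumes f: "f \<in> Fs" and k: "\<forall>v\<in>fv f. 0 < k v" and k': "\<forall>v\<in>fv f. 0 < k' v"
    and up: "\<forall>v\<in>fv f \<inter> I. k v < k' v" and down: "\<forall>v\<in>fv f - I. k' v \<le> k v" and ne: "fv f \<inter> I \<noteq> {}"
  shows "(\<Sum>v\<in>fv f \<inter> I. face_curv (fv f) k v) < (\<Sum>v\<in>fv f \<inter> I. face_curv (fv f) k' v)"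
proof -
  define m where "m v = (if v \<in> I then k' v else k v)" for v
  note c = card3[OF f] and ff = fin_fv[OF f]
  have m: "\<forall>v\<in>fv f. 0 < m v" using k k' by (auto simp: m_def)
  have km: "\<forall>v\<in>fv f. k v \<le> m v" using up less_imp_le by (auto simp: m_def)
  have k'm: "\<forall>v\<in>fv f. k' v \<le> m v" using down by (auto simp: m_def)
  obtain u where u: "u \<in> fv f" "u \<in> I" using ne by blast
  have split: "(\<Sum>v\<in>fv f. h v) = (\<Sum>v\<in>fv f \<inter> I. h v) + (\<Sum>v\<in>fv f - I. h v)" for h :: "'v \<Rightarrow> real"
    using sum.Int_Diff[OF ff] by blast
  have "(\<Sum>v\<in>fv f. face_curv (fv f) k v) < (\<Sum>v\<in>fv f. face_curv (fv f) m v)"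
    by (rule face_curv_sum_strict_mono[OF c k km u(1)]) (use u up in \<open>auto simp: m_def\<close>)
  moreover have "(\<Sum>v\<in>fv f - I. face_curv (fv f) m v) \<le> (\<Sum>v\<in>fv f - I. face_curv (fv f) k v)"
    by (intro sum_mono face_curv_antimono c k km) (auto simp: m_def)
  moreover have "(\<Sum>v\<in>fv f \<inter> I. face_curv (fv f) m v) \<le> (\<Sum>v\<in>fv f \<inter> I. face_curv (fv f) k' v)"
    by (intro sum_mono face_curv_antimono c k' k'm) (auto simp: m_def)
  ultimately show ?thesis unfolding split by linarith
qed

text \<open>Otherwise the sum of the total curvatures over the vertices at which \<open>k < k'\<close> would be strictly larger
  for \<open>k'\<close>, face by face.\<close>

lemma vertex_curv_inj_aux:
  assumes k: "\<And>f v. f \<in> Fs \<Longrightarrow> v \<in> fv f \<Longrightarrow> 0 < k v" and k': "\<And>f v. f \<in> Fs \<Longrightarrow> v \<in> fv f \<Longrightarrow> 0 < k' v"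
    and bd: "\<And>f v. f \<in> Fs \<Longrightarrow> v \<in> fv f \<Longrightarrow> v \<notin> Vi \<Longrightarrow> k v = k' v"
    and eq: "\<And>v. v \<in> Vi \<Longrightarrow> vertex_curv fv Fs k v = vertex_curv fv Fs k' v"
    and v: "v \<in> Vi"
  shows "k' v \<le> k v"
proof (rule ccontr)
  define I where "I = {v\<in>Vi. k v < k' v}"
  assume "\<not> k' v \<le> k v"
  then have I: "I \<subseteq> Vi" "I \<noteq> {}" using v by (auto simp: I_def)
  have "(\<Sum>v\<in>I. vertex_curv fv Fs k v) < (\<Sum>v\<in>I. vertex_curv fv Fs k' v)"
    unfolding vertex_curv_sum[OF I(1)]
  proof (rule sum_strict_mono)
    show "finite (star_faces fv Fs I)" using fin by (simp add: star_faces_def)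
    show "star_faces fv Fs I \<noteq> {}" by (rule star_faces_nonempty[OF I])
    fix f assume "f \<in> star_faces fv Fs I"
    then have f: "f \<in> Fs" and ne: "fv f \<inter> I \<noteq> {}" by (auto simp: star_faces_def)
    show "(\<Sum>v\<in>fv f \<inter> I. face_curv (fv f) k v) < (\<Sum>v\<in>fv f \<inter> I. face_curv (fv f) k' v)"
    proof (rule face_curv_partial_sum_strict_mono[OF f _ _ _ _ ne])
      show "\<forall>v\<in>fv f - I. k' v \<le> k v" using bd[OF f] by (fastforce simp: I_def)
    qed (use k[OF f] k'[OF f] in \<open>auto simp: I_def\<close>)
  qed
  moreover have "(\<Sum>v\<in>I. vertex_curv fv Fs k v) = (\<Sum>v\<in>I. vertex_curv fv Fs k' v)"
    using eq I by (intro sum.cong) auto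
  ultimately show False by simp
qed

lemma vertex_curv_inj:
  assumes "\<And>f v. f \<in> Fs \<Longrightarrow> v \<in> fv f \<Longrightarrow> 0 < k v" "\<And>f v. f \<in> Fs \<Longrightarrow> v \<in> fv f \<Longrightarrow> 0 < k' v"
    and "\<And>f v. f \<in> Fs \<Longrightarrow> v \<in> fv f \<Longrightarrow> v \<notin> Vi \<Longrightarrow> k v = k' v"
    and "\<And>v. v \<in> Vi \<Longrightarrow> vertex_curv fv Fs k v = vertex_curv fv Fs k' v"
    and "v \<in> Vi"
  shows "k v = k' v"
proof (rule antisym)
  show "k' v \<le> k v" by (rule vertex_curv_inj_aux[OF assms])
  show "k v \<le> k' v" by (rule vertex_curv_inj_aux) (use assms in \<open>simp_all\<close>)
qed

lemma vertex_curv_antimono: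
  assumes k: "\<And>f v. f \<in> Fs \<Longrightarrow> v \<in> fv f \<Longrightarrow> 0 < k v"
    and le: "\<And>f v. f \<in> Fs \<Longrightarrow> v \<in> fv f \<Longrightarrow> k v \<le> k' v" and v: "k' v = k v"
  shows "vertex_curv fv Fs k' v \<le> vertex_curv fv Fs k v"
  unfolding vertex_curv_def
  by (intro sum_mono face_curv_antimono) (use card3 k le v in auto)

lemma vertex_curv_tendsto:
  assumes "\<And>n f v. f \<in> Fs \<Longrightarrow> v \<in> fv f \<Longrightarrow> 0 < kn n v" "\<And>f v. f \<in> Fs \<Longrightarrow> v \<in> fv f \<Longrightarrow> 0 < k v"
    and "\<And>f v. f \<in> Fs \<Longrightarrow> v \<in> fv f \<Longrightarrow> (\<lambda>n. kn n v) \<longlonglongrightarrow> k v"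
  shows "(\<lambda>n. vertex_curv fv Fs (kn n) v) \<longlonglongrightarrow> vertex_curv fv Fs k v"
  unfolding vertex_curv_def
  by (intro tendsto_sum face_curv_tendsto) (use assms card3 in auto)

text \<open>The solution is the pointwise supremum \<open>K\<close> of the set \<open>S\<close> of all functions with the given boundary
  values whose total curvatures are at most \<open>\<tau>\<close>, in analogy with Perron's method.\<close>

lemma vertex_curv_exists:
  assumes kb: "\<And>v. v \<notin> Vi \<Longrightarrow> 0 < kb v"
    and tpos: "\<And>v. v \<in> Vi \<Longrightarrow> 0 < \<tau> v"
    and feas: "\<And>I. I \<subseteq> Vi \<Longrightarrow> I \<noteq> {} \<Longrightarrow> (\<Sum>v\<in>I. \<tau> v) < pi * real (card (star_faces fv Fs I))"
  shows "\<exists>k. (\<forall>v. 0 < k v) \<and> (\<forall>v. v \<notin> Vi \<longrightarrow> k v = kb v) \<and> (\<forall>v\<in>Vi. vertex_curv fv Fs k v = \<tau> v)"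
proof -
  define S where "S = {k. (\<forall>v. 0 < k v) \<and> (\<forall>v. v \<notin> Vi \<longrightarrow> k v = kb v) \<and> (\<forall>v\<in>Vi. vertex_curv fv Fs k v \<le> \<tau> v)}"
  have Spos: "\<And>k v. k \<in> S \<Longrightarrow> 0 < k v" and Sb: "\<And>k v. k \<in> S \<Longrightarrow> v \<notin> Vi \<Longrightarrow> k v = kb v"
    and Sle: "\<And>k v. k \<in> S \<Longrightarrow> v \<in> Vi \<Longrightarrow> vertex_curv fv Fs k v \<le> \<tau> v" by (auto simp: S_def)
  (* S is closed under finite maxima: where k attains the maximum m, the other values only grow on passing
     from k to m, and this lowers the total curvature *)
  have Smax: "(\<lambda>v. MAX k\<in>A. k v) \<in> S" if A: "finite A" "A \<noteq> {}" "A \<subseteq> S" for A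
  proof -
    let ?m = "\<lambda>v. MAX k\<in>A. k v"
    have ge: "k v \<le> ?m v" if "k \<in> A" for k v using A that by (intro Max_ge) auto
    have ex: "\<exists>k\<in>A. ?m v = k v" for v
    proof -
      have "?m v \<in> (\<lambda>k. k v) ` A" using A by (intro Max_in) auto
      then show ?thesis by blast
    qed
    show ?thesis unfolding S_def
    proof (intro CollectI conjI allI impI ballI)
      fix v
      obtain k where k: "k \<in> A" "?m v = k v" using ex by blast
      show "0 < ?m v" using k A Spos by auto
      show "?m v = kb v" if "v \<notin> Vi" using k A Sb that by auto
      show "vertex_curv fv Fs ?m v \<le> \<tau> v" if "v \<in> Vi"
      proof -
        have "vertex_curv fv Fs ?m v \<le> vertex_curv fv Fs k v"
          by (rule vertex_curv_antimono) (use k A Spos ge in auto)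
        also have "\<dots> \<le> \<tau> v" using k A Sle that by auto
        finally show ?thesis .
      qed
    qed
  qed
  (* small constants on Vi belong to S, by face_curv_le_sqrt *)
  have Sne: "\<exists>k. k \<in> S"
  proof (cases "Vi = {}")
    case True
    then have "kb \<in> S" using kb by (auto simp: S_def)
    then show ?thesis by blast
  next
    case False
    define c where "c = real (card Fs) + 1"
    define t where "t = Min (\<tau> ` Vi)"
    have t: "0 < t" "\<And>v. v \<in> Vi \<Longrightarrow> t \<le> \<tau> v" using fin False tpos by (auto simp: t_def)
    have c: "c > 0" by (simp add: c_def add_nonneg_pos)
    define \<epsilon> where "\<epsilon> = (t / (8 * c))\<^sup>2"
    have e: "\<epsilon> > 0" "sqrt \<epsilon> = t / (8 * c)" using t c by (auto simp: \<epsilon>_def real_sqrt_abs)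
    define k where "k v = (if v \<in> Vi then \<epsilon> else kb v)" for v
    have kpos: "\<And>v. 0 < k v" using kb e by (auto simp: k_def)
    have "vertex_curv fv Fs k v \<le> \<tau> v" if v: "v \<in> Vi" for v
    proof -
      have "vertex_curv fv Fs k v \<le> (\<Sum>f | f \<in> Fs \<and> v \<in> fv f. 8 * sqrt \<epsilon>)"
        unfolding vertex_curv_def
      proof (rule sum_mono)
        fix f assume f: "f \<in> {f \<in> Fs. v \<in> fv f}"
        then show "face_curv (fv f) k v \<le> 8 * sqrt \<epsilon>"
          using face_curv_le_sqrt[of "fv f" k v] card3 kpos v by (auto simp: k_def)
      qed
      also have "\<dots> = real (card {f \<in> Fs. v \<in> fv f}) * (t / c)" using e by simp
      also have "\<dots> \<le> c * (t / c)"
      proof (rule mult_right_mono)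
        have "card {f \<in> Fs. v \<in> fv f} \<le> card Fs" using fin by (intro card_mono) auto
        then show "real (card {f \<in> Fs. v \<in> fv f}) \<le> c" unfolding c_def by linarith
      qed (use t c in simp)
      also have "\<dots> = t" using c by simp
      finally show ?thesis using t(2)[OF v] by linarith
    qed
    then have "k \<in> S" using kpos by (auto simp: S_def k_def)
    then show ?thesis by blast
  qed
  (* if S were unbounded on I, a member of S could have values above any L on I, and bounded values M
     outside; for large L this contradicts the inequality for I *)
  have bdd: "bdd_above ((\<lambda>k. k v) ` S)" if "v \<in> Vi" for v
  proof (rule ccontr)
    assume nb: "\<not> bdd_above ((\<lambda>k. k v) ` S)"
    define I where "I = {v\<in>Vi. \<not> bdd_above ((\<lambda>k. k v) ` S)}"
    have I: "I \<subseteq> Vi" "I \<noteq> {}" "finite I" using nb that fin by (auto simp: I_def)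
    have fS: "finite (star_faces fv Fs I)" using fin by (simp add: star_faces_def)
    define W where "W = \<Union>(fv ` Fs) - I"
    have fW: "finite W" using fin fin_fv by (auto simp: W_def)
    have "\<exists>B. \<forall>k\<in>S. k w \<le> B" if "w \<in> W" for w
    proof (cases "w \<in> Vi")
      case True
      then have "bdd_above ((\<lambda>k. k w) ` S)" using that by (auto simp: W_def I_def)
      then show ?thesis by (auto simp: bdd_above_def)
    next
      case False
      then have "\<forall>k\<in>S. k w \<le> kb w" by (simp add: Sb)
      then show ?thesis ..
    qed
    then obtain B where B: "\<And>w k. w \<in> W \<Longrightarrow> k \<in> S \<Longrightarrow> k w \<le> B w" by metis
    define M where "M = (\<Sum>w\<in>W. \<bar>B w\<bar>)"
    have M0: "M \<ge> 0" by (auto simp: M_def intro!: sum_nonneg)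
    have M: "k w \<le> M" if "w \<in> W" "k \<in> S" for w k
    proof -
      have "k w \<le> \<bar>B w\<bar>" using B[OF that] by linarith
      also have "\<dots> \<le> M" unfolding M_def using that fW by (intro member_le_sum) auto
      finally show ?thesis .
    qed
    define n where "n = real (card (star_faces fv Fs I))"
    have key: "(\<Sum>v\<in>I. \<tau> v) \<ge> n * (pi - 2 / L - 6 * sqrt (M / L))" if L: "L > 0" for L
    proof -
      have "\<exists>k\<in>S. k v > L" if "v \<in> I" for v
        using that by (force simp: I_def bdd_above_def not_le)
      then obtain a where a: "\<And>v. v \<in> I \<Longrightarrow> a v \<in> S \<and> a v v > L" by metis
      define k where "k v = (MAX k\<in>a ` I. k v)" for v
      have kS: "k \<in> S" using Smax[of "a ` I"] a I unfolding k_def by auto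
      have kL: "k v > L" if "v \<in> I" for v
      proof -
        have "a v v \<le> k v" unfolding k_def using I that by (intro Max_ge) auto
        then show ?thesis using a[OF that] by linarith
      qed
      have fb: "(\<Sum>v\<in>fv f \<inter> I. face_curv (fv f) k v) \<ge> pi - 2 / L - 6 * sqrt (M / L)"
        if f: "f \<in> star_faces fv Fs I" for f
      proof -
        obtain u where u: "f \<in> Fs" "u \<in> fv f" "u \<in> I" using f by (auto simp: star_faces_def)
        have kp: "\<forall>v\<in>fv f. 0 < k v" using Spos[OF kS] by blast
        have uL: "k u > L" using kL u by simp
        have "(\<Sum>v\<in>fv f. face_curv (fv f) k v) \<ge> pi - 2 / k u"
          by (rule face_curv_sum_ge[OF card3[OF u(1)] kp u(2)])
        moreover have "2 / k u \<le> 2 / L" using uL L by (intro divide_left_mono) auto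
        moreover have "(\<Sum>v\<in>fv f. face_curv (fv f) k v) = (\<Sum>v\<in>fv f \<inter> I. face_curv (fv f) k v) + (\<Sum>v\<in>fv f - I. face_curv (fv f) k v)"
          using sum.Int_Diff[OF fin_fv[OF u(1)]] by blast
        moreover have "(\<Sum>v\<in>fv f - I. face_curv (fv f) k v) \<le> 6 * sqrt (M / L)"
        proof -
          have "(\<Sum>v\<in>fv f - I. face_curv (fv f) k v) \<le> (\<Sum>v\<in>fv f - I. 2 * sqrt (M / L))"
          proof (rule sum_mono)
            fix w assume w: "w \<in> fv f - I"
            have "face_curv (fv f) k w \<le> 2 * sqrt (k w / k u)"
              using w u by (intro face_curv_le_ratio card3 kp) auto
            also have "k w / k u \<le> M / L"
              using M[of w k] w u kS uL L M0 Spos[OF kS, of w] by (intro frac_le) (auto simp: W_def)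
            finally show "face_curv (fv f) k w \<le> 2 * sqrt (M / L)" by simp
          qed
          also have "\<dots> = real (card (fv f - I)) * (2 * sqrt (M / L))" by simp
          also have "\<dots> \<le> 3 * (2 * sqrt (M / L))"
          proof (rule mult_right_mono)
            have "card (fv f - I) \<le> card (fv f)" using fin_fv[OF u(1)] by (intro card_mono) auto
            then show "real (card (fv f - I)) \<le> 3" using card3[OF u(1)] by simp
          qed (use M0 L in simp)
          finally show ?thesis by simp
        qed
        ultimately show ?thesis by linarith
      qed
      have "n * (pi - 2 / L - 6 * sqrt (M / L)) \<le> (\<Sum>f\<in>star_faces fv Fs I. \<Sum>v\<in>fv f \<inter> I. face_curv (fv f) k v)"
        unfolding n_def using sum_bounded_below[OF fb] by (simp add: mult.commute)
      also have "\<dots> = (\<Sum>v\<in>I. vertex_curv fv Fs k v)" by (rule vertex_curv_sum[OF I(1), symmetric])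
      also have "\<dots> \<le> (\<Sum>v\<in>I. \<tau> v)" using Sle[OF kS] I by (intro sum_mono) auto
      finally show ?thesis .
    qed
    have "((\<lambda>L. n * (pi - 2 / L - 6 * sqrt (M / L))) \<longlongrightarrow> n * (pi - 0 - 6 * sqrt 0)) at_top"
      by (intro tendsto_intros tendsto_divide_0[OF tendsto_const] filterlim_at_top_imp_at_infinity filterlim_ident)
    moreover have "\<forall>\<^sub>F L in at_top. n * (pi - 2 / L - 6 * sqrt (M / L)) \<le> (\<Sum>v\<in>I. \<tau> v)"
      using eventually_gt_at_top[of 0] by eventually_elim (rule key)
    ultimately have "n * (pi - 0 - 6 * sqrt 0) \<le> (\<Sum>v\<in>I. \<tau> v)"
      by (rule tendsto_upperbound) simp
    with feas[OF I(1,2)] show False by (simp add: n_def mult.commute)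
  qed
  define K where "K v = (if v \<in> Vi then (SUP k\<in>S. k v) else kb v)" for v
  have Sne': "S \<noteq> {}" using Sne by blast
  have leK: "k v \<le> K v" if "k \<in> S" for k v
    using that Sb bdd by (auto simp: K_def intro!: cSUP_upper)
  have Kpos: "0 < K v" for v using leK Sne Spos by (meson order_less_le_trans)
  have approx: "\<exists>k\<in>S. K v - 1 / real (Suc n) < k v" for n v
  proof (cases "v \<in> Vi")
    case True
    have "K v - 1 / real (Suc n) < (SUP k\<in>S. k v)" using True by (simp add: K_def)
    then show ?thesis using less_cSUP_iff[OF Sne' bdd[OF True]] by blast
  next
    case False
    then show ?thesis using Sne Sb by (fastforce simp: K_def)
  qed
  (* finite maxima of members of S converge to K at all vertices at once *)
  have KS: "K \<in> S"
  proof (cases "Vi = {}")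
    case True
    obtain k where k: "k \<in> S" using Sne by blast
    have "K = k" using Sb[OF k] True by (auto simp: K_def)
    then show ?thesis using k by simp
  next
    case False
    define a where "a n v = (SOME k. k \<in> S \<and> K v - 1 / real (Suc n) < k v)" for n v
    have a: "a n v \<in> S \<and> K v - 1 / real (Suc n) < a n v v" for n v
    proof -
      have "\<exists>k. k \<in> S \<and> K v - 1 / real (Suc n) < k v" using approx[of v n] by blast
      from someI_ex[OF this] show ?thesis unfolding a_def .
    qed
    define kn where "kn n v = (MAX k\<in>a n ` Vi. k v)" for n v
    have knS: "kn n \<in> S" for n unfolding kn_def by (rule Smax) (use a fin False in auto)
    have lim: "(\<lambda>n. kn n v) \<longlonglongrightarrow> K v" for v
    proof (cases "v \<in> Vi")
      case True
      have lo: "K v - 1 / real (Suc n) \<le> kn n v" for n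
      proof -
        have "a n v v \<le> kn n v" unfolding kn_def using fin True by (intro Max_ge) auto
        then show ?thesis using a[of n v] by linarith
      qed
      have "(\<lambda>n. K v - 1 / real (Suc n)) \<longlonglongrightarrow> K v - 0"
        by (intro tendsto_intros LIMSEQ_Suc lim_1_over_n)
      then have lo_lim: "(\<lambda>n. K v - 1 / real (Suc n)) \<longlonglongrightarrow> K v" by simp
      show ?thesis
      proof (rule tendsto_sandwich[OF _ _ lo_lim tendsto_const])
        show "\<forall>\<^sub>F n in sequentially. K v - 1 / real (Suc n) \<le> kn n v" using lo by (intro always_eventually allI)
        show "\<forall>\<^sub>F n in sequentially. kn n v \<le> K v" using leK[OF knS] by (intro always_eventually allI)
      qed
    next
      case False
      then show ?thesis using Sb[OF knS] by (simp add: K_def)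
    qed
    have "vertex_curv fv Fs K v \<le> \<tau> v" if "v \<in> Vi" for v
    proof (rule LIMSEQ_le_const2)
      show "(\<lambda>n. vertex_curv fv Fs (kn n) v) \<longlonglongrightarrow> vertex_curv fv Fs K v"
        by (rule vertex_curv_tendsto) (use Spos[OF knS] Kpos lim in auto)
      show "\<exists>N. \<forall>n\<ge>N. vertex_curv fv Fs (kn n) v \<le> \<tau> v" using Sle[OF knS that] by blast
    qed
    then show ?thesis using Kpos by (auto simp: S_def K_def)
  qed
  have "vertex_curv fv Fs K v = \<tau> v" if v: "v \<in> Vi" for v
  proof (rule ccontr)
    assume "vertex_curv fv Fs K v \<noteq> \<tau> v"
    then have lt: "vertex_curv fv Fs K v < \<tau> v" using Sle[OF KS v] by simp
    (* a slightly larger value at v keeps the total curvature at v below its bound and lowers the others *)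
    define kn where "kn n = K(v := K v + 1 / real (Suc n))" for n
    have kp: "0 < kn n w" for n w using Kpos[of w] Kpos[of v] by (auto simp: kn_def add_pos_pos)
    have lim: "(\<lambda>n. kn n w) \<longlonglongrightarrow> K w" for w
    proof (cases "w = v")
      case True
      have "(\<lambda>n. K v + 1 / real (Suc n)) \<longlonglongrightarrow> K v + 0"
        by (intro tendsto_intros LIMSEQ_Suc lim_1_over_n)
      then show ?thesis using True by (simp add: kn_def)
    qed (simp add: kn_def)
    have "(\<lambda>n. vertex_curv fv Fs (kn n) v) \<longlonglongrightarrow> vertex_curv fv Fs K v"
      by (rule vertex_curv_tendsto) (use kp Kpos lim in auto)
    then have "\<forall>\<^sub>F n in sequentially. vertex_curv fv Fs (kn n) v < \<tau> v" using lt by (rule order_tendstoD)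
    then obtain n where n: "vertex_curv fv Fs (kn n) v < \<tau> v" by (auto simp: eventually_sequentially)
    have "vertex_curv fv Fs (kn n) w \<le> \<tau> w" if w: "w \<in> Vi" for w
    proof (cases "w = v")
      case False
      have "vertex_curv fv Fs (kn n) w \<le> vertex_curv fv Fs K w"
        by (rule vertex_curv_antimono) (use Kpos False in \<open>auto simp: kn_def\<close>)
      then show ?thesis using Sle[OF KS w] by linarith
    qed (use n in simp)
    then have "kn n \<in> S" using kp v KS by (auto simp: S_def kn_def)
    then have "kn n v \<le> K v" by (rule leK)
    then show False by (simp add: kn_def)
  qed
  then show ?thesis using Kpos Sb[OF KS] by blast
qed

end

section \<open>Generalized circles as functionals on the hyperboloid\<close>

lemma cmod_sq: "cmod z * cmod z = Re z * Re z + Im z * Im z"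
  using cmod_power2[of z] by (simp add: power2_eq_square)

text \<open>The hyperboloid model in coordinates adapted to the upper half-plane: its points satisfy
  \<open>X\<^sub>1 X\<^sub>3 - X\<^sub>2\<^sup>2 = 1\<close> and \<open>X\<^sub>3 > 0\<close>.\<close>

definition hyp :: "complex \<Rightarrow> real^3" where
  "hyp z = vector [(cmod z)\<^sup>2 / Im z, Re z / Im z, 1 / Im z]"

text \<open>The Lorentzian form on functionals. On the coefficients \<open>(A, B, C)\<close> of a binary quadratic form it is the
  polarized discriminant.\<close>

definition lform :: "real^3 \<Rightarrow> real^3 \<Rightarrow> real" where
  "lform v w = v$2 * w$2 - 2 * v$1 * w$3 - 2 * v$3 * w$1"

lemma inner_hyp: "v \<bullet> hyp z = (v$1 * (cmod z)\<^sup>2 + v$2 * Re z + v$3) / Im z"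
  by (simp add: hyp_def inner_vec_def sum_3 add_divide_distrib)

lemma hdist_cosh_arg:
  assumes "z \<in> H2" "w \<in> H2"
  shows "1 + (cmod (z - w))\<^sup>2 / (2 * Im z * Im w) = ((cmod z)\<^sup>2 + (cmod w)\<^sup>2 - 2 * Re z * Re w) / (2 * Im z * Im w)"
proof -
  have "(cmod (z - w))\<^sup>2 + 2 * Im z * Im w = (cmod z)\<^sup>2 + (cmod w)\<^sup>2 - 2 * Re z * Re w"
    unfolding cmod_power2 by (simp add: power2_eq_square algebra_simps)
  then show ?thesis using assms by (simp add: H2_def field_simps)
qed

lemma cosh_hdist:
  assumes "z \<in> H2" "w \<in> H2"
  shows "cosh (hdist z w) = ((cmod z)\<^sup>2 + (cmod w)\<^sup>2 - 2 * Re z * Re w) / (2 * Im z * Im w)"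
proof -
  have "1 + (cmod (z - w))\<^sup>2 / (2 * Im z * Im w) \<ge> 1" using assms by (simp add: H2_def)
  then have "cosh (hdist z w) = 1 + (cmod (z - w))\<^sup>2 / (2 * Im z * Im w)"
    unfolding hdist_def by (rule cosh_arcosh_real)
  then show ?thesis using hdist_cosh_arg[OF assms] by simp
qed

lemma hdist_nonneg:
  assumes "z \<in> H2" "w \<in> H2" shows "0 \<le> hdist z w"
  using assms by (simp add: H2_def hdist_def)

text \<open>The functional of norm 1 that vanishes on the geodesic; its value at a point is the hyperbolic sine
  of the signed distance.\<close>

fun geo_vec :: "geodesic \<Rightarrow> real^3" where
  "geo_vec (Vertical a) = vector [0, 1, - a]"
| "geo_vec (Semicircle a r) = (1 / (2 * r)) *\<^sub>R vector [1, - 2 * a, a\<^sup>2 - r\<^sup>2]"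

text \<open>The functional \<open>v\<close> with \<open>lform v v = 1 - k\<^sup>2\<close> that takes the value \<open>k\<close> on the curve and smaller values
  on the convex side.\<close>

fun gvec :: "gcircle \<Rightarrow> real^3" where
  "gvec (Circle c r) = (1 / (2 * Im c * sinh r)) *\<^sub>R vector [1, - 2 * Re c, (cmod c)\<^sup>2]"
| "gvec (Horocycle Infty h) = vector [0, 0, exp (- h)]"
| "gvec (Horocycle (Bdry a) h) = exp (- h) *\<^sub>R vector [1, - 2 * a, a\<^sup>2]"
| "gvec (Hypercycle A d) = (sgn d / cosh d) *\<^sub>R geo_vec A"

lemma cmod_minus_real_sq: "(cmod (z - complex_of_real a))\<^sup>2 = (cmod z)\<^sup>2 - 2 * a * Re z + a\<^sup>2"
  unfolding cmod_power2 by (simp add: power2_eq_square algebra_simps)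

lemma geo_vec_level_sgn:
  assumes "geodesic_wf A" "z \<in> H2"
  shows "sgn (geo_vec A \<bullet> hyp z) = sgn (geodesic_side A z)"
proof (cases A)
  case (Vertical a)
  then show ?thesis using assms by (simp add: inner_hyp H2_def sgn_divide)
next
  case (Semicircle a r)
  have r: "r > 0" using assms Semicircle by simp
  have y: "Im z > 0" using assms by (simp add: H2_def)
  define m where "m = cmod (z - complex_of_real a)"
  have m: "m \<ge> 0" by (simp add: m_def)
  have "geo_vec A \<bullet> hyp z = (m\<^sup>2 - r\<^sup>2) / (2 * r * Im z)"
    unfolding m_def cmod_minus_real_sq using r y by (simp add: Semicircle inner_hyp field_simps)
  also have "\<dots> = (m - r) * ((m + r) / (2 * r * Im z))" by (simp add: power2_eq_square algebra_simps)
  finally have "geo_vec A \<bullet> hyp z = (m - r) * ((m + r) / (2 * r * Im z))" .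
  moreover have "sgn ((m + r) / (2 * r * Im z)) = 1" using r y m by (simp add: add_nonneg_pos)
  ultimately have "sgn (geo_vec A \<bullet> hyp z) = sgn (m - r)" by (metis sgn_mult mult.right_neutral)
  then show ?thesis by (simp add: Semicircle m_def)
qed

text \<open>A point of the geodesic at which the lower bound for the hyperbolic cosine of the distance is attained
  turns the infimum into a minimum.\<close>

lemma dist_geodesic_eqI:
  assumes "z \<in> H2" and w: "w \<in> geodesic_points A" "cosh (hdist z w) = sqrt (1 + L\<^sup>2)"
    and le: "\<And>w. w \<in> geodesic_points A \<Longrightarrow> sqrt (1 + L\<^sup>2) \<le> cosh (hdist z w)"
  shows "dist_geodesic A z = arsinh \<bar>L\<bar>"
proof -
  have sub: "w \<in> H2" if "w \<in> geodesic_points A" for w using that by (simp add: geodesic_points_def)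
  have c: "cosh (arsinh \<bar>L\<bar>) = sqrt (1 + L\<^sup>2)" by (simp add: cosh_arsinh_real add.commute)
  have pos: "0 \<le> arsinh \<bar>L\<bar>" using arsinh_real_neg_iff[of "\<bar>L\<bar>"] by linarith
  have ge: "arsinh \<bar>L\<bar> \<le> hdist z w" if "w \<in> geodesic_points A" for w
    using le[OF that] c cosh_real_nonneg_le_iff[OF pos hdist_nonneg[OF assms(1) sub[OF that]]] by simp
  have "hdist z w \<le> arsinh \<bar>L\<bar>"
    using w(2) c cosh_real_nonneg_le_iff[OF hdist_nonneg[OF assms(1) sub[OF w(1)]] pos] by simp
  then have eq: "hdist z w = arsinh \<bar>L\<bar>" using ge[OF w(1)] by simp
  show ?thesis unfolding dist_geodesic_def
    by (rule cInf_eq_minimum) (use w(1) ge in \<open>auto simp: eq[symmetric]\<close>)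
qed

lemma dist_geodesic_eq:
  assumes A: "geodesic_wf A" and z: "z \<in> H2"
  shows "dist_geodesic A z = arsinh \<bar>geo_vec A \<bullet> hyp z\<bar>"
proof (cases A)
  case (Vertical a)
  define x where "x = Re z - a"
  define y where "y = Im z"
  have y: "y > 0" using z by (simp add: H2_def y_def)
  define R where "R = sqrt (x\<^sup>2 + y\<^sup>2)"
  have R: "R > 0" "R\<^sup>2 = x\<^sup>2 + y\<^sup>2" using y by (simp_all add: R_def add_nonneg_pos)
  have L: "geo_vec A \<bullet> hyp z = x / y" by (simp add: Vertical inner_hyp x_def y_def)
  have "1 + (x / y)\<^sup>2 = (R / y)\<^sup>2" using y R by (simp add: field_simps)
  then have S: "sqrt (1 + (x / y)\<^sup>2) = R / y" using R y by simp
  have ch: "cosh (hdist z w) = (R\<^sup>2 + (Im w)\<^sup>2) / (2 * y * Im w)" if "w \<in> geodesic_points A" for w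
  proof -
    have w: "w \<in> H2" "Re w = a" using that by (auto simp: geodesic_points_def Vertical)
    have "(cmod z)\<^sup>2 + (cmod w)\<^sup>2 - 2 * Re z * Re w = R\<^sup>2 + (Im w)\<^sup>2"
      unfolding R(2) x_def y_def using w by (simp add: cmod_sq power2_eq_square algebra_simps)
    then show ?thesis using cosh_hdist[OF z w(1)] by (simp add: y_def)
  qed
  show ?thesis unfolding L
  proof (rule dist_geodesic_eqI[OF z])
    (* the foot of the perpendicular has the same Euclidean distance from the end point a as z *)
    show w: "Complex a R \<in> geodesic_points A" using R by (simp add: geodesic_points_def Vertical H2_def)
    show "cosh (hdist z (Complex a R)) = sqrt (1 + (x / y)\<^sup>2)"
      unfolding ch[OF w] S using R(1) y by (simp add: field_simps power2_eq_square)
    fix w assume w: "w \<in> geodesic_points A"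
    then have v: "Im w > 0" by (simp add: geodesic_points_def H2_def)
    have "0 \<le> (R - Im w)\<^sup>2" by simp
    then have "2 * R * Im w \<le> R\<^sup>2 + (Im w)\<^sup>2" by (simp add: power2_diff)
    then show "sqrt (1 + (x / y)\<^sup>2) \<le> cosh (hdist z w)" unfolding ch[OF w] S using y v
      by (simp add: field_simps)
  qed
next
  case (Semicircle a r)
  have r: "r > 0" using A Semicircle by simp
  define x where "x = Re z - a"
  define y where "y = Im z"
  have y: "y > 0" using z by (simp add: H2_def y_def)
  define P where "P = x\<^sup>2 + y\<^sup>2 + r\<^sup>2"
  define N where "N = sqrt ((x\<^sup>2 + y\<^sup>2 - r\<^sup>2)\<^sup>2 + (2 * r * y)\<^sup>2)"
  have P: "P > 0" using r y by (simp add: P_def add_nonneg_pos)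
  have N2: "N\<^sup>2 = (x\<^sup>2 + y\<^sup>2 - r\<^sup>2)\<^sup>2 + (2 * r * y)\<^sup>2" by (simp add: N_def)
  have N: "N > 0" using r y by (simp add: N_def add_nonneg_pos)
  have N3: "N\<^sup>2 + (2 * x * r)\<^sup>2 = P\<^sup>2" unfolding N2 P_def by (simp add: power2_eq_square algebra_simps)
  define L where "L = (x\<^sup>2 + y\<^sup>2 - r\<^sup>2) / (2 * r * y)"
  have L: "geo_vec A \<bullet> hyp z = L"
    using r y unfolding L_def x_def y_def
    by (simp add: Semicircle inner_hyp cmod_sq field_simps power2_eq_square)
  have "1 + L\<^sup>2 = (N / (2 * r * y))\<^sup>2"
    unfolding L_def power_divide N2 using r y by (simp add: field_simps)
  then have S: "sqrt (1 + L\<^sup>2) = N / (2 * r * y)" using N r y by simp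
  have ch: "cosh (hdist z w) = (P - 2 * x * (Re w - a)) / (2 * y * Im w)" and rr: "(Re w - a)\<^sup>2 + (Im w)\<^sup>2 = r\<^sup>2"
    if "w \<in> geodesic_points A" for w
  proof -
    have w: "w \<in> H2" "cmod (w - complex_of_real a) = r" using that by (auto simp: geodesic_points_def Semicircle)
    have "(cmod (w - complex_of_real a))\<^sup>2 = (Re w - a)\<^sup>2 + (Im w)\<^sup>2" by (simp add: cmod_power2)
    then show rr: "(Re w - a)\<^sup>2 + (Im w)\<^sup>2 = r\<^sup>2" using w by simp
    have "(cmod z)\<^sup>2 + (cmod w)\<^sup>2 - 2 * Re z * Re w = P - 2 * x * (Re w - a)"
      unfolding P_def x_def y_def rr[symmetric] by (simp add: cmod_sq power2_eq_square algebra_simps)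
    then show "cosh (hdist z w) = (P - 2 * x * (Re w - a)) / (2 * y * Im w)"
      using cosh_hdist[OF z w(1)] by (simp add: y_def)
  qed
  show ?thesis unfolding L
  proof (rule dist_geodesic_eqI[OF z])
    (* the foot of the perpendicular is the case of equality in the Cauchy-Schwarz inequality below *)
    let ?w = "Complex (a + 2 * x * r\<^sup>2 / P) (N * r / P)"
    have "(2 * x * r\<^sup>2 / P)\<^sup>2 + (N * r / P)\<^sup>2 = r\<^sup>2 * (N\<^sup>2 + (2 * x * r)\<^sup>2) / P\<^sup>2"
      by (simp add: power_divide power2_eq_square add_divide_distrib algebra_simps)
    also have "\<dots> = r\<^sup>2" unfolding N3 using P by simp
    finally have e: "(2 * x * r\<^sup>2 / P)\<^sup>2 + (N * r / P)\<^sup>2 = r\<^sup>2" .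
    have "cmod (?w - complex_of_real a) = sqrt ((2 * x * r\<^sup>2 / P)\<^sup>2 + (N * r / P)\<^sup>2)"
      by (simp add: cmod_def)
    then show w: "?w \<in> geodesic_points A"
      unfolding e using N r P by (simp add: geodesic_points_def Semicircle H2_def)
    have "P - 2 * x * (2 * x * r\<^sup>2 / P) = (P\<^sup>2 - (2 * x * r)\<^sup>2) / P" using P by (simp add: field_simps power2_eq_square)
    also have "\<dots> = N\<^sup>2 / P" unfolding N3[symmetric] by simp
    finally have "P - 2 * x * (2 * x * r\<^sup>2 / P) = N\<^sup>2 / P" .
    then show "cosh (hdist z ?w) = sqrt (1 + L\<^sup>2)"
      unfolding ch[OF w] S using N r y P by (simp add: field_simps power2_eq_square)
    fix w assume w: "w \<in> geodesic_points A"
    then have v: "Im w > 0" by (simp add: geodesic_points_def H2_def)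
    define p where "p = Re w - a"
    define q where "q = Im w"
    have pq: "p\<^sup>2 + q\<^sup>2 = r\<^sup>2" using rr[OF w] by (simp add: p_def q_def)
    have "(2 * x * r * p + N * q)\<^sup>2 \<le> (2 * x * r * p + N * q)\<^sup>2 + (2 * x * r * q - N * p)\<^sup>2" by simp
    also have "\<dots> = (N\<^sup>2 + (2 * x * r)\<^sup>2) * (p\<^sup>2 + q\<^sup>2)" by (simp add: power2_eq_square algebra_simps)
    also have "\<dots> = (P * r)\<^sup>2" unfolding N3 pq by (simp add: power_mult_distrib)
    finally have "(2 * x * r * p + N * q)\<^sup>2 \<le> (P * r)\<^sup>2" .
    then have "2 * x * r * p + N * q \<le> P * r" by (rule power2_le_imp_le) (use P r in simp)
    then have "N * q \<le> (P - 2 * x * p) * r" by (simp add: algebra_simps)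
    then show "sqrt (1 + L\<^sup>2) \<le> cosh (hdist z w)" unfolding ch[OF w] S using y v r
      by (simp add: p_def q_def field_simps)
  qed
qed

text \<open>The distance to the center as a function of the value of \<open>gvec\<close>: up to an additive constant, it
  depends on the generalized circle only through its curvature. For \<open>k = 1\<close> this is the Busemann function.\<close>

definition center_dist :: "real \<Rightarrow> real \<Rightarrow> real" where
  "center_dist k l = (if k > 1 then arcosh (l / sqrt (k\<^sup>2 - 1)) else if k = 1 then ln l
     else arsinh (\<bar>l\<bar> / sqrt (1 - k\<^sup>2)))"

lemma geod_curvature_pos:
  assumes "gcircle_wf C" shows "geod_curvature C > 0"
proof (cases C)
  case (Circle c r) then show ?thesis using assms by simp
next
  case (Hypercycle A d) then show ?thesis using assms by simp
qed simp

lemma lform_scaleR: "lform (a *\<^sub>R v) (b *\<^sub>R w) = a * b * lform v w"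
  by (simp add: lform_def algebra_simps)

lemma lform_geo_vec:
  assumes "geodesic_wf A" shows "lform (geo_vec A) (geo_vec A) = 1"
proof (cases A)
  case (Vertical a) then show ?thesis by (simp add: lform_def)
next
  case (Semicircle a r)
  have "lform (vector [1, - 2 * a, a\<^sup>2 - r\<^sup>2]) (vector [1, - 2 * a, a\<^sup>2 - r\<^sup>2]) = (2 * r) * (2 * r)"
    by (simp add: lform_def power2_eq_square)
  then show ?thesis using assms unfolding Semicircle geo_vec.simps lform_scaleR by simp
qed

lemma lform_gvec:
  assumes "gcircle_wf C"
  shows "lform (gvec C) (gvec C) = 1 - (geod_curvature C)\<^sup>2"
proof (cases C)
  case (Circle c r)
  have s: "sinh r > 0" "Im c > 0" using assms Circle by (simp_all add: H2_def)
  have "lform (vector [1, - 2 * Re c, (cmod c)\<^sup>2]) (vector [1, - 2 * Re c, (cmod c)\<^sup>2]) = - 4 * (Im c)\<^sup>2"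
    by (simp add: lform_def cmod_sq power2_eq_square)
  then have "lform (gvec C) (gvec C) = - 1 / (sinh r)\<^sup>2"
    using s by (simp add: Circle lform_scaleR field_simps power2_eq_square)
  also have "\<dots> = 1 - (1 / tanh r)\<^sup>2"
    using s cosh_square_eq[of r] by (simp add: tanh_def field_simps)
  finally show ?thesis by (simp add: Circle)
next
  case (Horocycle \<xi> h)
  then show ?thesis by (cases \<xi>) (simp_all add: lform_scaleR, simp_all add: lform_def power2_eq_square)
next
  case (Hypercycle A d)
  have c: "cosh d > 0" by simp
  have "lform (gvec C) (gvec C) = (sgn d)\<^sup>2 / (cosh d)\<^sup>2"
    using assms Hypercycle by (simp add: lform_scaleR lform_geo_vec power2_eq_square)
  also have "(sgn d)\<^sup>2 = 1" using assms Hypercycle by (simp add: sgn_if)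
  also have "1 / (cosh d)\<^sup>2 = 1 - (tanh d)\<^sup>2"
  proof -
    have "1 = ((cosh d)\<^sup>2 - (sinh d)\<^sup>2)" using cosh_square_eq[of d] by simp
    then have "1 / (cosh d)\<^sup>2 = ((cosh d)\<^sup>2 - (sinh d)\<^sup>2) / (cosh d)\<^sup>2" by simp
    also have "\<dots> = 1 - (tanh d)\<^sup>2" using c by (simp add: tanh_def diff_divide_distrib power_divide)
    finally show ?thesis .
  qed
  finally show ?thesis using Hypercycle by (simp add: tanh_real_abs)
qed

lemma cosh_real_nonneg_eq_iff:
  fixes x y :: real assumes "0 \<le> x" "0 \<le> y" shows "cosh x = cosh y \<longleftrightarrow> x = y"
  using cosh_real_nonneg_le_iff[OF assms] cosh_real_nonneg_le_iff[OF assms(2,1)] by (metis antisym order_refl)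

lemma gcircle_level:
  assumes C: "gcircle_wf C"
  shows "curve C = {z\<in>H2. gvec C \<bullet> hyp z = geod_curvature C}" (is ?A)
    and "convex_side C = {z\<in>H2. gvec C \<bullet> hyp z < geod_curvature C}" (is ?B)
    and "\<exists>c. \<forall>z\<in>H2. dist_center C z = center_dist (geod_curvature C) (gvec C \<bullet> hyp z) + c" (is ?C)
proof -
  have "?A \<and> ?B \<and> ?C"
  proof (cases C)
    case (Circle c r)
    have c: "c \<in> H2" "Im c > 0" and r: "r > 0" and s: "sinh r > 0" using C Circle by (simp_all add: H2_def)
    have lev: "gvec C \<bullet> hyp z = cosh (hdist c z) / sinh r" if "z \<in> H2" for z
      using that s c by (simp add: cosh_hdist Circle inner_hyp H2_def field_simps)
    have k: "geod_curvature C = cosh r / sinh r" by (simp add: Circle tanh_def)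
    have A: "hdist c z = r \<longleftrightarrow> gvec C \<bullet> hyp z = geod_curvature C"
      and B: "hdist c z < r \<longleftrightarrow> gvec C \<bullet> hyp z < geod_curvature C" if z: "z \<in> H2" for z
    proof -
      have r0: "0 \<le> r" using r by simp
      note h = hdist_nonneg[OF c(1) z]
      show "hdist c z = r \<longleftrightarrow> gvec C \<bullet> hyp z = geod_curvature C"
        unfolding lev[OF z] k using s cosh_real_nonneg_eq_iff[OF h r0] by simp
      show "hdist c z < r \<longleftrightarrow> gvec C \<bullet> hyp z < geod_curvature C"
        unfolding lev[OF z] k divide_less_cancel using s cosh_real_nonneg_less_iff[OF h r0] by simp
    qed
    have k1: "geod_curvature C > 1" "sqrt ((geod_curvature C)\<^sup>2 - 1) = 1 / sinh r"
    proof -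
      have "(cosh r / sinh r)\<^sup>2 - 1 = (1 / sinh r)\<^sup>2" using s cosh_square_eq[of r] by (simp add: power_divide add_divide_distrib)
      then show "sqrt ((geod_curvature C)\<^sup>2 - 1) = 1 / sinh r" unfolding k using s by simp
      show "geod_curvature C > 1" unfolding k using s sinh_less_cosh_real[of r] by simp
    qed
    have "dist_center C z = center_dist (geod_curvature C) (gvec C \<bullet> hyp z) + 0" if z: "z \<in> H2" for z
    proof -
      have "gvec C \<bullet> hyp z / sqrt ((geod_curvature C)\<^sup>2 - 1) = cosh (hdist c z)"
        unfolding lev[OF z] k1 using s by simp
      then show ?thesis using k1(1) hdist_nonneg[OF c(1) z] by (simp add: center_dist_def Circle arcosh_cosh_real)
    qed
    then have ?C by blast
    moreover have "curve C = {z\<in>H2. hdist c z = r}" "convex_side C = {z\<in>H2. hdist c z < r}" by (simp_all add: Circle)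
    then have ?A ?B using A B by blast+
    ultimately show ?thesis by blast
  next
    case (Horocycle \<xi> h)
    have k: "geod_curvature C = 1" by (simp add: Horocycle)
    have lev: "gvec C \<bullet> hyp z = exp (busemann \<xi> z - h)" if z: "z \<in> H2" for z
    proof (cases \<xi>)
      case Infty
      then show ?thesis using z by (simp add: Horocycle inner_hyp H2_def exp_diff exp_minus divide_simps)
    next
      case (Bdry a)
      have y: "Im z > 0" using z by (simp add: H2_def)
      then have "z \<noteq> complex_of_real a" by auto
      then have m: "(cmod (z - complex_of_real a))\<^sup>2 / Im z > 0" using y by simp
      have "exp (busemann \<xi> z - h) = exp (- h) * ((cmod (z - complex_of_real a))\<^sup>2 / Im z)"
        using m by (simp add: Bdry exp_diff exp_minus divide_simps)
      then show ?thesis using y by (simp add: Horocycle Bdry inner_hyp cmod_minus_real_sq algebra_simps add_divide_distrib diff_divide_distrib)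
    qed
    have "dist_center C z = center_dist (geod_curvature C) (gvec C \<bullet> hyp z) + h" if z: "z \<in> H2" for z
      unfolding lev[OF z] k by (simp add: center_dist_def Horocycle)
    then have ?C by blast
    moreover have "curve C = {z\<in>H2. busemann \<xi> z = h}" "convex_side C = {z\<in>H2. busemann \<xi> z < h}" by (simp_all add: Horocycle)
    then have ?A ?B using lev k by auto
    ultimately show ?thesis by blast
  next
    case (Hypercycle A d)
    have A: "geodesic_wf A" and d: "d \<noteq> 0" using C Hypercycle by simp_all
    have ch: "cosh d > 0" by simp
    have lev: "gvec C \<bullet> hyp z = sgn d * (geo_vec A \<bullet> hyp z) / cosh d" for z by (simp add: Hypercycle)
    have k: "geod_curvature C = sinh \<bar>d\<bar> / cosh d" by (simp add: Hypercycle tanh_def)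
    have ab: "\<bar>L\<bar> = L * sgn L" for L :: real by (rule abs_sgn)
    have main: "(sgn (geodesic_side A z) = sgn d \<and> dist_geodesic A z = \<bar>d\<bar>) \<longleftrightarrow> gvec C \<bullet> hyp z = geod_curvature C"
      "(sgn (geodesic_side A z) = sgn d \<longrightarrow> dist_geodesic A z < \<bar>d\<bar>) \<longleftrightarrow> gvec C \<bullet> hyp z < geod_curvature C"
      if z: "z \<in> H2" for z
    proof -
      define L where "L = geo_vec A \<bullet> hyp z"
      have sg: "sgn (geodesic_side A z) = sgn L" using geo_vec_level_sgn[OF A z] by (simp add: L_def)
      have sd: "sinh \<bar>d\<bar> > 0" using d by simp
      have D1: "dist_geodesic A z = \<bar>d\<bar> \<longleftrightarrow> \<bar>L\<bar> = sinh \<bar>d\<bar>"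
        and D2: "dist_geodesic A z < \<bar>d\<bar> \<longleftrightarrow> \<bar>L\<bar> < sinh \<bar>d\<bar>"
        unfolding dist_geodesic_eq[OF A z] L_def[symmetric]
        by (metis arsinh_sinh_real sinh_arsinh_real) (metis sinh_arsinh_real sinh_real_less_iff)
      have E1: "gvec C \<bullet> hyp z = geod_curvature C \<longleftrightarrow> sgn d * L = sinh \<bar>d\<bar>"
        and E2: "gvec C \<bullet> hyp z < geod_curvature C \<longleftrightarrow> sgn d * L < sinh \<bar>d\<bar>"
        unfolding lev k L_def[symmetric] using ch by (simp_all add: divide_simps)
      have aux: "(sgn L = sgn d \<and> \<bar>L\<bar> = S) \<longleftrightarrow> sgn d * L = S" "(sgn L = sgn d \<longrightarrow> \<bar>L\<bar> < S) \<longleftrightarrow> sgn d * L < S"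
        if "S > 0" for S using d that by (auto simp: sgn_if abs_if split: if_splits)
      show "(sgn (geodesic_side A z) = sgn d \<and> dist_geodesic A z = \<bar>d\<bar>) \<longleftrightarrow> gvec C \<bullet> hyp z = geod_curvature C"
        unfolding sg D1 E1 by (rule aux(1)[OF sd])
      show "(sgn (geodesic_side A z) = sgn d \<longrightarrow> dist_geodesic A z < \<bar>d\<bar>) \<longleftrightarrow> gvec C \<bullet> hyp z < geod_curvature C"
        unfolding sg D2 E2 by (rule aux(2)[OF sd])
    qed
    have k1: "geod_curvature C < 1" "sqrt (1 - (geod_curvature C)\<^sup>2) = 1 / cosh d"
    proof -
      have "1 - (sinh \<bar>d\<bar> / cosh d)\<^sup>2 = ((cosh d)\<^sup>2 - (sinh \<bar>d\<bar>)\<^sup>2) / (cosh d)\<^sup>2"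
        using ch by (simp add: power_divide diff_divide_distrib)
      also have "\<dots> = (1 / cosh d)\<^sup>2" using cosh_square_eq[of "\<bar>d\<bar>"] by (simp add: power_divide)
      finally have "1 - (sinh \<bar>d\<bar> / cosh d)\<^sup>2 = (1 / cosh d)\<^sup>2" .
      then show "sqrt (1 - (geod_curvature C)\<^sup>2) = 1 / cosh d" unfolding k using ch by (simp del: power_divide)
      show "geod_curvature C < 1" unfolding k using sinh_less_cosh_real[of "\<bar>d\<bar>"] by simp
    qed
    have "dist_center C z = center_dist (geod_curvature C) (gvec C \<bullet> hyp z) + 0" if z: "z \<in> H2" for z
    proof -
      have "\<bar>gvec C \<bullet> hyp z\<bar> / sqrt (1 - (geod_curvature C)\<^sup>2) = \<bar>geo_vec A \<bullet> hyp z\<bar>"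
        unfolding k1 lev using d by (simp add: abs_mult abs_sgn_eq)
      then show ?thesis using k1(1) by (simp add: center_dist_def Hypercycle dist_geodesic_eq[OF A z])
    qed
    then have ?C by blast
    moreover have "curve C = {z\<in>H2. sgn (geodesic_side A z) = sgn d \<and> dist_geodesic A z = \<bar>d\<bar>}"
      "convex_side C = {z\<in>H2. sgn (geodesic_side A z) = sgn d \<longrightarrow> dist_geodesic A z < \<bar>d\<bar>}" by (simp_all add: Hypercycle)
    then have ?A ?B using main by blast+
    ultimately show ?thesis by blast
  qed
  then show ?A ?B ?C by blast+
qed

text \<open>The inverse of \<open>gvec\<close>. For \<open>k \<ge> 1\<close> the sign condition singles out the vectors in the future cone; for their
  negatives the level set misses the hyperboloid.\<close>

lemma gcircle_of_vector:
  assumes k: "k > 0" and norm: "lform v v = 1 - k\<^sup>2"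
    and pos: "k \<ge> 1 \<Longrightarrow> 0 \<le> v$1 \<and> 0 \<le> v$3 \<and> 0 < v$1 + v$3"
  shows "\<exists>C. gcircle_wf C \<and> geod_curvature C = k \<and> gvec C = v"
proof -
  have n: "v$2 * v$2 - 4 * v$1 * v$3 = 1 - k\<^sup>2" using norm by (simp add: lform_def)
  have vec: "v = vector [v$1, v$2, v$3]" by (simp add: vec_eq_iff forall_3)
  have scale: "a *\<^sub>R (vector [x, y, z] :: real^3) = vector [a * x, a * y, a * z]" for a x y z
    by (simp add: vec_eq_iff forall_3)
  consider "k > 1" | "k = 1" "v$1 = 0" | "k = 1" "v$1 > 0" | "k < 1" "v$1 = 0" | "k < 1" "v$1 \<noteq> 0"
    using pos by fastforce
  then show ?thesis
  proof cases
    case 1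
    define R where "R = sqrt (k\<^sup>2 - 1)"
    have k2: "k\<^sup>2 > 1" using 1 by simp
    have R: "R > 0" "R\<^sup>2 = k\<^sup>2 - 1" using k2 by (simp_all add: R_def)
    have "v$2 * v$2 + R\<^sup>2 = 4 * v$1 * v$3" using n R by simp
    moreover have "v$2 * v$2 + R\<^sup>2 > 0" by (intro add_nonneg_pos) (use R(1) in simp_all)
    ultimately have "v$1 \<noteq> 0" by auto
    then have v1: "v$1 > 0" using pos 1 by auto
    define r where "r = arsinh (1 / R)"
    have sh: "sinh r = 1 / R" by (simp add: r_def)
    have "1 + (1 / R)\<^sup>2 = (k / R)\<^sup>2" using R by (simp add: power_divide field_simps)
    then have ch: "cosh r = k / R" using R k by (simp add: r_def cosh_arsinh_real add.commute)
    have r: "r > 0" using R by (simp add: r_def)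
    define c where "c = Complex (- v$2 / (2 * v$1)) (R / (2 * v$1))"
    have c: "c \<in> H2" using R v1 by (simp add: c_def H2_def)
    have cf: "1 / (2 * Im c * sinh r) = v$1" using R v1 by (simp add: c_def sh)
    have "(cmod c)\<^sup>2 = (v$2 * v$2 + R\<^sup>2) / (4 * (v$1 * v$1))"
      unfolding cmod_power2 c_def using v1 by (simp add: power_divide field_simps power2_eq_square)
    also have "\<dots> = v$3 / v$1" unfolding R(2) using n v1 by (simp add: field_simps)
    finally have "v$1 * (cmod c)\<^sup>2 = v$3" using v1 by simp
    then have "gvec (Circle c r) = v"
      unfolding gvec.simps cf scale using v1 by (subst vec) (simp add: c_def)
    moreover have "geod_curvature (Circle c r) = k" using R k by (simp add: tanh_def sh ch)
    ultimately show ?thesis using c r by (intro exI[of _ "Circle c r"]) simp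
  next
    case 2
    then have "v$2 = 0" using n by simp
    moreover have "v$3 > 0" using pos 2 by simp
    ultimately have "gvec (Horocycle Infty (- ln (v$3))) = v" using 2 by (subst vec) simp
    then show ?thesis using 2 by (intro exI[of _ "Horocycle Infty (- ln (v$3))"]) simp
  next
    case 3
    define a where "a = - v$2 / (2 * v$1)"
    have "v$1 * a\<^sup>2 = v$2 * v$2 / (4 * v$1)" using 3 by (simp add: a_def power2_eq_square field_simps)
    also have "\<dots> = v$3" using n 3 by (simp add: field_simps)
    finally have "gvec (Horocycle (Bdry a) (- ln (v$1))) = v"
      using 3 unfolding gvec.simps scale by (subst vec) (simp add: a_def)
    then show ?thesis using 3 by (intro exI[of _ "Horocycle (Bdry a) (- ln (v$1))"]) simp
  next
    case 4
    define S where "S = sqrt (1 - k\<^sup>2)"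
    have k2: "k\<^sup>2 < 1" using 4 k by (simp add: abs_square_less_1)
    have S: "S > 0" "S\<^sup>2 = 1 - k\<^sup>2" using k2 by (simp_all add: S_def)
    define d where "d = sgn (v$2) * arsinh (k / S)"
    have "(v$2)\<^sup>2 = S\<^sup>2" using n 4 S by (simp add: power2_eq_square)
    then have ab: "\<bar>v$2\<bar> = S" using S by (metis abs_of_pos power2_eq_iff_nonneg abs_ge_zero power2_abs less_imp_le)
    then have v2: "v$2 \<noteq> 0" "sgn (v$2) * S = v$2" using S by (auto simp: mult_sgn_abs)
    have as: "arsinh (k / S) > 0" using k S by simp
    have d: "\<bar>d\<bar> = arsinh (k / S)" "sgn d = sgn (v$2)" using v2(1) abs_of_pos[OF as] sgn_pos[OF as] by (simp_all add: d_def abs_mult abs_sgn_eq sgn_mult)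
    have "(k / S)\<^sup>2 + 1 = (1 / S)\<^sup>2" using S by (simp add: power_divide field_simps)
    then have "cosh \<bar>d\<bar> = 1 / S" unfolding d using S by (simp add: cosh_arsinh_real)
    then have ch: "cosh d = 1 / S" by simp
    have "tanh \<bar>d\<bar> = k"
      unfolding tanh_def \<open>cosh \<bar>d\<bar> = 1 / S\<close> unfolding d using S by simp
    moreover have "gvec (Hypercycle (Vertical (- v$3 / v$2)) d) = v"
      unfolding gvec.simps geo_vec.simps scale ch d using v2 4 by (subst vec) simp
    moreover have "d \<noteq> 0" using d as by auto
    ultimately show ?thesis by (intro exI[of _ "Hypercycle (Vertical (- v$3 / v$2)) d"]) simp
  next
    case 5
    define S where "S = sqrt (1 - k\<^sup>2)"
    have k2: "k\<^sup>2 < 1" using 5 k by (simp add: abs_square_less_1)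
    have S: "S > 0" "S\<^sup>2 = 1 - k\<^sup>2" using k2 by (simp_all add: S_def)
    define d where "d = sgn (v$1) * arsinh (k / S)"
    have as: "arsinh (k / S) > 0" using k S by simp
    have d: "\<bar>d\<bar> = arsinh (k / S)" "sgn d = sgn (v$1)" using 5(2) abs_of_pos[OF as] sgn_pos[OF as] by (simp_all add: d_def abs_mult abs_sgn_eq sgn_mult)
    have "(k / S)\<^sup>2 + 1 = (1 / S)\<^sup>2" using S by (simp add: power_divide field_simps)
    then have "cosh \<bar>d\<bar> = 1 / S" unfolding d using S by (simp add: cosh_arsinh_real)
    then have ch: "cosh d = 1 / S" by simp
    have th: "tanh \<bar>d\<bar> = k"
      unfolding tanh_def \<open>cosh \<bar>d\<bar> = 1 / S\<close> unfolding d using S by simp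
    define r where "r = S / (2 * \<bar>v$1\<bar>)"
    define a where "a = - v$2 / (2 * v$1)"
    have r: "r > 0" using S 5 by (simp add: r_def)
    have cf: "sgn (v$1) / (1 / S) * (1 / (2 * r)) = v$1" using 5 S by (simp add: r_def mult_sgn_abs)
    have "v$1 * (a\<^sup>2 - r\<^sup>2) = (v$2 * v$2 - S\<^sup>2) / (4 * v$1)"
      using 5 by (simp add: a_def r_def power2_eq_square field_simps)
    also have "\<dots> = v$3" unfolding S(2) using n 5 by (simp add: field_simps)
    finally have "gvec (Hypercycle (Semicircle a r) d) = v"
      unfolding gvec.simps geo_vec.simps scaleR_scaleR ch d cf unfolding scale using 5 by (subst vec) (simp add: a_def)
    moreover have "d \<noteq> 0" using d as by auto
    ultimately show ?thesis using r th by (intro exI[of _ "Hypercycle (Semicircle a r) d"]) simp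
  qed
qed

section \<open>Tangency and perpendicularity as inner products\<close>

text \<open>The Euclidean equation of the curve on which the functional \<open>v\<close> takes the value \<open>k\<close>, that is,
  \<open>Im z * (v \<bullet> hyp z - k)\<close>. With the normalization \<open>lform v v = 1 - k\<^sup>2\<close> its gradient has length 1 along
  the curve.\<close>

definition qf :: "real^3 \<Rightarrow> real \<Rightarrow> complex \<Rightarrow> real" where
  "qf v k z = v$1 * (cmod z)\<^sup>2 + v$2 * Re z + v$3 - k * Im z"

definition qgrad :: "real^3 \<Rightarrow> real \<Rightarrow> complex \<Rightarrow> complex" where
  "qgrad v k z = Complex (2 * v$1 * Re z + v$2) (2 * v$1 * Im z - k)"

lemma level_iff_qf:
  assumes "z \<in> H2"
  shows "v \<bullet> hyp z = k \<longleftrightarrow> qf v k z = 0" "v \<bullet> hyp z < k \<longleftrightarrow> qf v k z < 0"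
  using assms by (auto simp: qf_def inner_hyp H2_def field_simps)

lemma qf_expand: "qf v k (z + w) = qf v k z + qgrad v k z \<bullet> w + v$1 * (cmod w)\<^sup>2"
  unfolding qf_def cmod_power2 by (simp add: qgrad_def inner_complex_def power2_eq_square algebra_simps)

text \<open>At a common point of two curves this computes the angle between them.\<close>

lemma qgrad_inner: "qgrad v k z \<bullet> qgrad w l z = 2 * v$1 * qf w l z + 2 * w$1 * qf v k z + lform v w + k * l"
  unfolding qf_def cmod_power2 by (simp add: qgrad_def inner_complex_def lform_def power2_eq_square algebra_simps)

lemma norm_qgrad:
  assumes "lform v v = 1 - k\<^sup>2" "qf v k z = 0"
  shows "cmod (qgrad v k z) = 1"
proof -
  have "qgrad v k z \<bullet> qgrad v k z = 1" using assms by (simp add: qgrad_inner power2_eq_square)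
  then show ?thesis by (simp add: norm_eq_sqrt_inner)
qed

text \<open>At the point \<open>z + t d\<close> the function is \<open>t\<close> times the negative slope plus a multiple of \<open>t\<close>.\<close>

lemma eventually_qf_neg:
  assumes "qf v k z = 0" "qgrad v k z \<bullet> d < 0"
  shows "\<forall>\<^sub>F t in at_right 0. qf v k (z + complex_of_real t * d) < 0"
proof -
  have "((\<lambda>t::real. qgrad v k z \<bullet> d + t * (v$1 * (cmod d)\<^sup>2)) \<longlongrightarrow> qgrad v k z \<bullet> d + 0 * (v$1 * (cmod d)\<^sup>2)) (at_right 0)"
    by (intro tendsto_intros)
  then have "\<forall>\<^sub>F t in at_right 0. qgrad v k z \<bullet> d + t * (v$1 * (cmod d)\<^sup>2) < 0"
    using assms(2) by (intro order_tendstoD(2)) auto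
  then show ?thesis using eventually_at_right_less[of 0]
  proof eventually_elim
    case (elim t)
    have "qf v k (z + complex_of_real t * d) = t * (qgrad v k z \<bullet> d + t * (v$1 * (cmod d)\<^sup>2))"
      unfolding qf_expand using assms(1)
      by (simp add: norm_mult power_mult_distrib inner_complex_def power2_eq_square algebra_simps)
    then show ?case using elim by (simp add: mult_pos_neg)
  qed
qed

text \<open>Both gradients at \<open>p\<close> are unit vectors. If they were not opposite, moving in the direction of minus
  their sum would lead into both sides at once.\<close>

lemma disjoint_imp_opposite:
  assumes v: "lform v v = 1 - k\<^sup>2" and w: "lform w w = 1 - l\<^sup>2"
    and p: "p \<in> H2" "qf v k p = 0" "qf w l p = 0"
    and disj: "\<And>z. z \<in> H2 \<Longrightarrow> \<not> (qf v k z < 0 \<and> qf w l z < 0)"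
  shows "lform v w + k * l = -1"
proof -
  define g h where "g = qgrad v k p" and "h = qgrad w l p"
  have gg: "g \<bullet> g = 1" "h \<bullet> h = 1" using v w p by (simp_all add: g_def h_def qgrad_inner power2_eq_square)
  have gh: "g \<bullet> h = lform v w + k * l" using p by (simp add: g_def h_def qgrad_inner)
  have "(g + h) \<bullet> (g + h) \<ge> 0" by simp
  then have ge: "g \<bullet> h \<ge> -1" using gg by (simp add: inner_simps inner_commute)
  have "\<not> g \<bullet> h > -1"
  proof
    assume gt: "g \<bullet> h > -1"
    have 1: "qgrad v k p \<bullet> (- (g + h)) < 0" "qgrad w l p \<bullet> (- (g + h)) < 0"
      using gg gt by (simp_all add: g_def[symmetric] h_def[symmetric] inner_simps inner_commute)
    have "((\<lambda>t::real. Im (p + complex_of_real t * (- (g + h)))) \<longlongrightarrow> Im (p + complex_of_real 0 * (- (g + h)))) (at_right 0)"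
      by (intro tendsto_intros)
    then have "\<forall>\<^sub>F t in at_right 0. Im (p + complex_of_real t * (- (g + h))) > 0"
      using p(1) by (intro order_tendstoD(1)) (auto simp: H2_def)
    then have "\<forall>\<^sub>F t::real in at_right 0. False"
      using eventually_qf_neg[OF p(2) 1(1)] eventually_qf_neg[OF p(3) 1(2)]
    proof eventually_elim
      case (elim t)
      then have "p + complex_of_real t * (- (g + h)) \<in> H2" by (simp add: H2_def)
      then show ?case using disj elim by blast
    qed
    then show False by (simp add: trivial_limit_at_right_real)
  qed
  then show ?thesis using ge gh by simp
qed

text \<open>The circle or line \<open>qf v k = 0\<close> is parametrized near \<open>p\<close> by the Moebius map
  \<open>t \<mapsto> p + i g t / (1 - i A t)\<close>, with \<open>g\<close> the gradient at \<open>p\<close> and \<open>A\<close> the leading coefficient of \<open>v\<close>.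
  Where it leaves the half-plane it is replaced by the constant \<open>p\<close>, which does not affect the derivative at
  0.\<close>

lemma tangent_vector_exists:
  assumes C: "C = {z\<in>H2. qf v k z = 0}" and v: "lform v v = 1 - k\<^sup>2" and p: "p \<in> C"
  shows "tangent_vector C p (\<i> * qgrad v k p)"
proof -
  define g where "g = qgrad v k p"
  define A where "A = v$1"
  have pH: "p \<in> H2" "qf v k p = 0" using p C by auto
  have g1: "cmod g = 1" using norm_qgrad[OF v pH(2)] by (simp add: g_def)
  define \<delta> where "\<delta> t = p + g * \<i> * complex_of_real t / (1 - \<i> * complex_of_real (A * t))" for t :: real
  have nz: "1 - \<i> * complex_of_real x \<noteq> 0" for x by (simp add: complex_eq_iff)
  have q0: "qf v k (\<delta> t) = 0" for t
  proof -
    define D where "D = 1 - \<i> * complex_of_real (A * t)"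
    have D: "D \<noteq> 0" unfolding D_def by (rule nz)
    have D2: "(cmod D)\<^sup>2 = 1 + (A * t)\<^sup>2" by (simp add: D_def cmod_power2)
    define w where "w = g * \<i> * complex_of_real t / D"
    have "(cmod w)\<^sup>2 = t\<^sup>2 / (cmod D)\<^sup>2" by (simp add: w_def norm_mult norm_divide g1 power_divide)
    moreover have "g \<bullet> w = - A * t\<^sup>2 / (cmod D)\<^sup>2"
    proof -
      have "g \<bullet> w = Re (cnj g * w)" by (simp add: inner_complex_def)
      also have "cnj g * w = (cnj g * g) * \<i> * complex_of_real t * cnj D / (D * cnj D)"
        using D by (simp add: w_def)
      also have "\<dots> = complex_of_real ((cmod g)\<^sup>2) * \<i> * complex_of_real t * cnj D / complex_of_real ((cmod D)\<^sup>2)"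
        by (simp only: complex_norm_square mult.commute[of "cnj g"])
      also have "Re \<dots> = - A * t\<^sup>2 / (cmod D)\<^sup>2"
        unfolding g1 by (simp add: D_def power2_eq_square)
      finally show ?thesis .
    qed
    ultimately show ?thesis
      unfolding \<delta>_def D_def[symmetric] w_def[symmetric] qf_expand using pH by (simp add: g_def A_def)
  qed
  have d0: "\<delta> 0 = p" by (simp add: \<delta>_def)
  have deriv: "(\<delta> has_vector_derivative \<i> * g) (at 0)"
  proof -
    have "((\<lambda>t. p + g * \<i> * t / (1 - \<i> * (complex_of_real A * t))) has_field_derivative \<i> * g) (at (complex_of_real 0))"
      by (auto intro!: derivative_eq_intros)
    from has_vector_derivative_real_field[OF this] show ?thesis
      by (simp add: \<delta>_def[abs_def] o_def)
  qed
  define \<gamma> where "\<gamma> t = (if \<delta> t \<in> H2 then \<delta> t else p)" for t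
  have "isCont \<delta> 0" using deriv has_vector_derivative_continuous by blast
  then have "((\<lambda>t. Im (\<delta> t)) \<longlongrightarrow> Im (\<delta> 0)) (nhds 0)"
    unfolding isCont_def by (intro tendsto_Im) (simp add: tendsto_nhds_iff)
  then have "\<forall>\<^sub>F t in nhds 0. Im (\<delta> t) > 0"
    using pH(1) d0 by (intro order_tendstoD(1)) (auto simp: H2_def)
  then have ev: "\<forall>\<^sub>F t in nhds 0. \<delta> t = \<gamma> t" by eventually_elim (simp add: \<gamma>_def H2_def)
  have "(\<gamma> has_vector_derivative \<i> * g) (at 0)"
  proof -
    obtain S where S: "open S" "0 \<in> S" "\<And>t. t \<in> S \<Longrightarrow> \<delta> t = \<gamma> t"
      using ev unfolding eventually_nhds by blast
    show ?thesis by (rule has_vector_derivative_transform_within_open[OF deriv S])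
  qed
  moreover have "\<gamma> t \<in> C" for t using q0 pH by (simp add: \<gamma>_def C)
  moreover have "\<gamma> 0 = p" using d0 by (simp add: \<gamma>_def)
  ultimately show ?thesis unfolding tangent_vector_def g_def by blast
qed

lemma tangent_vector_orthogonal:
  assumes C: "C = {z\<in>H2. qf v k z = 0}" and s: "tangent_vector C p s"
  shows "qgrad v k p \<bullet> s = 0"
proof -
  obtain \<gamma> where \<gamma>: "\<And>t::real. \<gamma> t \<in> C" "\<gamma> 0 = p" "(\<gamma> has_vector_derivative s) (at 0)"
    using s unfolding tangent_vector_def by blast
  have R: "((\<lambda>t. Re (\<gamma> t)) has_real_derivative Re s) (at 0)" "((\<lambda>t. Im (\<gamma> t)) has_real_derivative Im s) (at 0)"
    using has_derivative_Re[OF \<gamma>(3)[unfolded has_vector_derivative_def]] has_derivative_Im[OF \<gamma>(3)[unfolded has_vector_derivative_def]]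
    by (simp_all add: has_field_derivative_def mult_commute_abs)
  have "((\<lambda>t. v$1 * ((X t)\<^sup>2 + (Y t)\<^sup>2) + v$2 * X t + v$3 - k * Y t) has_real_derivative
      v$1 * (2 * X 0 * X' + 2 * Y 0 * Y') + v$2 * X' - k * Y') (at 0)"
    if "(X has_real_derivative X') (at 0)" "(Y has_real_derivative Y') (at 0)" for X Y :: "real \<Rightarrow> real" and X' Y'
    using that by (auto intro!: derivative_eq_intros simp: algebra_simps)
  from this[OF R] have "((\<lambda>t. v$1 * ((Re (\<gamma> t))\<^sup>2 + (Im (\<gamma> t))\<^sup>2) + v$2 * Re (\<gamma> t) + v$3 - k * Im (\<gamma> t)) has_real_derivative qgrad v k p \<bullet> s) (at 0)"
    by (simp add: \<gamma>(2) qgrad_def inner_complex_def algebra_simps)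
  moreover have "v$1 * ((Re (\<gamma> t))\<^sup>2 + (Im (\<gamma> t))\<^sup>2) + v$2 * Re (\<gamma> t) + v$3 - k * Im (\<gamma> t) = 0" for t
    using \<gamma>(1)[of t] by (simp add: C qf_def cmod_power2)
  ultimately have "((\<lambda>t::real. 0) has_real_derivative qgrad v k p \<bullet> s) (at 0)" by simp
  then show ?thesis using DERIV_unique DERIV_const by blast
qed

lemma perpendicular_iff:
  assumes C: "C = {z\<in>H2. qf v k z = 0}" "lform v v = 1 - k\<^sup>2"
    and D: "D = {z\<in>H2. qf w l z = 0}" "lform w w = 1 - l\<^sup>2"
  shows "perpendicular C D \<longleftrightarrow> C \<inter> D \<noteq> {} \<and> lform v w + k * l = 0"
proof -
  have inner: "qgrad v k p \<bullet> qgrad w l p = lform v w + k * l" if "p \<in> C \<inter> D" for p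
    using that C D by (simp add: qgrad_inner)
  show ?thesis
  proof
    assume perp: "perpendicular C D"
    then obtain p where p: "p \<in> C \<inter> D" unfolding perpendicular_def by blast
    have "tangent_vector C p (\<i> * qgrad v k p)" "tangent_vector D p (\<i> * qgrad w l p)"
      using tangent_vector_exists[OF C] tangent_vector_exists[OF D] p by auto
    then have "(\<i> * qgrad v k p) \<bullet> (\<i> * qgrad w l p) = 0"
      using perp p unfolding perpendicular_def by blast
    then have "qgrad v k p \<bullet> qgrad w l p = 0" by (simp add: inner_complex_def)
    then show "C \<inter> D \<noteq> {} \<and> lform v w + k * l = 0" using inner[OF p] p by auto
  next
    assume a: "C \<inter> D \<noteq> {} \<and> lform v w + k * l = 0"
    show "perpendicular C D" unfolding perpendicular_def
    proof (intro conjI ballI allI impI)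
      show "C \<inter> D \<noteq> {}" using a by simp
      fix p s t assume p: "p \<in> C \<inter> D" and s: "tangent_vector C p s" and t: "tangent_vector D p t"
      define g h where "g = qgrad v k p" and "h = qgrad w l p"
      have 1: "g \<bullet> s = 0" "h \<bullet> t = 0"
        using tangent_vector_orthogonal[OF C(1) s] tangent_vector_orthogonal[OF D(1) t] by (simp_all add: g_def h_def)
      have gh: "g \<bullet> h = 0" using inner[OF p] a by (simp add: g_def h_def)
      have "qf v k p = 0" "qf w l p = 0" using p C(1) D(1) by auto
      then have "cmod g = 1" "cmod h = 1" using norm_qgrad[OF C(2)] norm_qgrad[OF D(2)] by (simp_all add: g_def h_def)
      then have nz: "g \<noteq> 0" "h \<noteq> 0" by auto
      (* s is proportional to the rotated gradient i g, and t to i h; the identity spells this out *)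
      have id: "(s \<bullet> t) * (Re g * Re g + Im g * Im g) * (Re h * Re h + Im h * Im h) =
        (g \<bullet> s) * ((Re g * Re t + Im g * Im t) * (Re h * Re h + Im h * Im h))
        + (Re g * Im s - Im g * Re s) * ((h \<bullet> t) * (Re g * Im h - Im g * Re h) + (Re h * Im t - Im h * Re t) * (g \<bullet> h))"
        by (simp add: inner_complex_def algebra_simps)
      have "Re g * Re g + Im g * Im g \<noteq> 0" "Re h * Re h + Im h * Im h \<noteq> 0"
        using nz by (simp_all add: complex_eq_iff sum_squares_eq_zero_iff)
      then show "s \<bullet> t = 0" using id 1 gh by auto
    qed
  qed
qed

section \<open>Rigidity and existence of the configuration of a triangle\<close>

text \<open>The inner products that tangency and perpendicularity impose on the vectors \<open>v u\<close> of three generalized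
  circles and the vector \<open>m\<close> of their dual circle of curvature \<open>s\<close>.\<close>

definition is_config :: "'v set \<Rightarrow> ('v \<Rightarrow> real) \<Rightarrow> ('v \<Rightarrow> real^3) \<Rightarrow> real^3 \<Rightarrow> real \<Rightarrow> bool" where
  "is_config F k v m s \<longleftrightarrow>
     (\<forall>u\<in>F. lform (v u) (v u) = 1 - (k u)\<^sup>2) \<and>
     (\<forall>u\<in>F. \<forall>w\<in>F. u \<noteq> w \<longrightarrow> lform (v u) (v w) = - 1 - k u * k w) \<and>
     (\<forall>u\<in>F. lform (v u) m = - k u * s) \<and> lform m m = 1 - s\<^sup>2 \<and> s > 1 \<and> m$1 > 0"

lemma curve_qf:
  assumes "gcircle_wf C"
  shows "curve C = {z\<in>H2. qf (gvec C) (geod_curvature C) z = 0}"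
    "convex_side C = {z\<in>H2. qf (gvec C) (geod_curvature C) z < 0}"
  unfolding gcircle_level[OF assms] using level_iff_qf by auto

lemma lform_commute: "lform v w = lform w v" by (simp add: lform_def)

lemma lform_add_right: "lform v (w + w') = lform v w + lform v w'" by (simp add: lform_def algebra_simps)
lemma lform_scaleR_right: "lform v (a *\<^sub>R w) = a * lform v w" by (simp add: lform_def algebra_simps)
lemma lform_diff_right: "lform v (w - w') = lform v w - lform v w'" by (simp add: lform_def algebra_simps)

lemma triangle_packing_config:
  assumes P: "triangle_packing T P f" and c3: "card (fverts T f) = 3"
  shows "is_config (fverts T f) (curv P) (\<lambda>u. gvec (gcirc P f u)) (gvec (dual_circle P f)) (geod_curvature (dual_circle P f))"
proof -
  let ?C = "gcirc P f" and ?D = "dual_circle P f"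
  have wf: "gcircle_wf (?C u)" "geod_curvature (?C u) = curv P u" if "u \<in> fverts T f" for u
    using P that by (auto simp: triangle_packing_def)
  have wfD: "gcircle_wf ?D" using P by (simp add: triangle_packing_def)
  show ?thesis unfolding is_config_def
  proof (intro conjI ballI impI)
    fix u assume u: "u \<in> fverts T f"
    show "lform (gvec (?C u)) (gvec (?C u)) = 1 - (curv P u)\<^sup>2"
      using lform_gvec[OF wf(1)[OF u]] wf(2)[OF u] by simp
    have "perpendicular (curve (?C u)) (curve ?D)" using P u by (simp add: triangle_packing_def)
    then have "lform (gvec (?C u)) (gvec ?D) + geod_curvature (?C u) * geod_curvature ?D = 0"
      using perpendicular_iff[OF curve_qf(1)[OF wf(1)[OF u]] lform_gvec[OF wf(1)[OF u]] curve_qf(1)[OF wfD] lform_gvec[OF wfD]] by simp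
    then show "lform (gvec (?C u)) (gvec ?D) = - curv P u * geod_curvature ?D" using wf(2)[OF u] by simp
    fix w assume w: "w \<in> fverts T f" "u \<noteq> w"
    have "ext_tangent (?C u) (?C w)" using P u w by (simp add: triangle_packing_def)
    then obtain p where p: "curve (?C u) \<inter> curve (?C w) = {p}" and disj: "convex_side (?C u) \<inter> convex_side (?C w) = {}"
      by (auto simp: ext_tangent_def)
    have pp: "p \<in> curve (?C u)" "p \<in> curve (?C w)" using p by auto
    have "lform (gvec (?C u)) (gvec (?C w)) + geod_curvature (?C u) * geod_curvature (?C w) = -1"
      using pp disj unfolding curve_qf[OF wf(1)[OF u]] curve_qf[OF wf(1)[OF w(1)]]
      by (intro disjoint_imp_opposite[of _ _ _ _ p] lform_gvec wf u w(1)) auto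
    then show "lform (gvec (?C u)) (gvec (?C w)) = - 1 - curv P u * curv P w" using wf(2) u w by simp
  next
    show "lform (gvec ?D) (gvec ?D) = 1 - (geod_curvature ?D)\<^sup>2" by (rule lform_gvec[OF wfD])
    show "geod_curvature ?D > 1" using wfD tanh_real_lt_1[of "dual_radius P f"] by (simp add: dual_circle_def)
    show "gvec ?D $ 1 > 0" using wfD by (simp add: dual_circle_def H2_def)
  qed
qed

definition lmat :: "real^3^3" where
  "lmat = vector [vector [0, 0, -2], vector [0, 1, 0], vector [-2, 0, 0]]"
definition hmat :: "real^3^3" where
  "hmat = vector [vector [0, 0, -1/2], vector [0, 1, 0], vector [-1/2, 0, 0]]"

lemma lmat_hmat: "lmat ** hmat = mat 1" "hmat ** lmat = mat 1"
  by (simp_all add: lmat_def hmat_def vec_eq_iff forall_3 matrix_matrix_mult_def sum_3 mat_def)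

definition hform :: "real^3 \<Rightarrow> real^3 \<Rightarrow> real" where
  "hform X Y = (X$1 * Y$3 + X$3 * Y$1) / 2 - X$2 * Y$2"

lemma lform_lmat: "lform v w = v \<bullet> (lmat *v w)"
  by (simp add: lform_def lmat_def inner_vec_def sum_3 matrix_vector_mult_def algebra_simps)

lemma hform_hmat: "hform X Y = - (X \<bullet> (hmat *v Y))"
  by (simp add: hform_def hmat_def inner_vec_def sum_3 matrix_vector_mult_def algebra_simps)

lemma gram_matrix: "(M ** lmat ** transpose M) $ i $ j = lform (M$i) (M$j)" for M :: "real^3^3"
  by (simp add: lform_def lmat_def matrix_matrix_mult_def sum_3 transpose_def algebra_simps)

lemma cosh_hdist_hform: "z \<in> H2 \<Longrightarrow> w \<in> H2 \<Longrightarrow> cosh (hdist z w) = hform (hyp z) (hyp w)"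
  by (simp add: cosh_hdist hform_def hyp_def H2_def field_simps)

lemma hform_hyp_self: "z \<in> H2 \<Longrightarrow> hform (hyp z) (hyp z) = 1"
  using cosh_hdist_hform[of z z] by (simp add: hdist_def)

lemma inj_on_hyp: "inj_on hyp H2"
proof (rule inj_onI)
  fix z w assume z: "z \<in> H2" "w \<in> H2" and e: "hyp z = hyp w"
  have "1 / Im z = 1 / Im w" "Re z / Im z = Re w / Im w"
    using arg_cong[OF e, of "\<lambda>v. v$3"] arg_cong[OF e, of "\<lambda>v. v$2"] by (simp_all add: hyp_def)
  then show "z = w" using z by (auto simp: H2_def complex_eq_iff)
qed

lemma hyp_surj:
  assumes "hform X X = 1" "X$3 > 0"
  shows "\<exists>z\<in>H2. hyp z = X"
proof
  let ?z = "Complex (X$2 / X$3) (1 / X$3)"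
  show "?z \<in> H2" using assms by (simp add: H2_def)
  have n: "X$1 * X$3 = 1 + X$2 * X$2" using assms(1) by (simp add: hform_def)
  have "(cmod ?z)\<^sup>2 = (1 + X$2 * X$2) / (X$3 * X$3)"
    unfolding cmod_power2 by (simp add: power2_eq_square add_divide_distrib)
  also have "\<dots> = X$1 / X$3" unfolding n[symmetric] using assms(2) by simp
  finally show "hyp ?z = X" using assms(2) by (simp add: hyp_def vec_eq_iff forall_3)
qed

text \<open>A functional of negative norm corresponds to a circle, and it is positive on the hyperboloid if its
  leading coefficient is: the quadratic form \<open>m$1 |z|\<^sup>2 + m$2 Re z + m$3\<close> is definite.\<close>

lemma timelike_pos:
  assumes m: "lform m m < 0" "m$1 > 0" and z: "z \<in> H2"
  shows "m \<bullet> hyp z > 0"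
proof -
  have y: "Im z > 0" using z by (simp add: H2_def)
  have d: "4 * m$1 * m$3 - m$2 * m$2 > 0" using m by (simp add: lform_def)
  have "4 * m$1 * (m$1 * (cmod z)\<^sup>2 + m$2 * Re z + m$3) = (2 * m$1 * Re z + m$2)\<^sup>2 + (2 * m$1 * Im z)\<^sup>2 + (4 * m$1 * m$3 - m$2 * m$2)"
    unfolding cmod_power2 by (simp add: power2_eq_square algebra_simps)
  also have "\<dots> > 0" using d by (simp add: add_nonneg_pos)
  finally have "m$1 * (cmod z)\<^sup>2 + m$2 * Re z + m$3 > 0" using m(2) by (simp add: zero_less_mult_iff)
  then show ?thesis using y by (simp add: inner_hyp)
qed

context
  fixes F :: "'v set" and k :: "'v \<Rightarrow> real" and a b c :: 'v
  assumes F: "F = {a, b, c}" "a \<noteq> b" "b \<noteq> c" "a \<noteq> c" and kpos: "\<forall>u\<in>F. 0 < k u"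
begin

text \<open>The Gram matrix is a function of the curvatures with determinant \<open>-4 (1 + \<sigma>)\<close>, which is not zero.\<close>

lemma config_rows:
  assumes "is_config F k v m s"
  defines "M \<equiv> vector [v a, v b, v c] :: real^3^3"
  shows "M ** lmat ** transpose M = vector [vector [1 - (k a)\<^sup>2, - 1 - k a * k b, - 1 - k a * k c],
      vector [- 1 - k a * k b, 1 - (k b)\<^sup>2, - 1 - k b * k c], vector [- 1 - k a * k c, - 1 - k b * k c, 1 - (k c)\<^sup>2]]"
    and "invertible M"
proof -
  have cf: "lform (v a) (v a) = 1 - (k a)\<^sup>2" "lform (v b) (v b) = 1 - (k b)\<^sup>2" "lform (v c) (v c) = 1 - (k c)\<^sup>2"
    "lform (v a) (v b) = - 1 - k a * k b" "lform (v b) (v a) = - 1 - k a * k b"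
    "lform (v a) (v c) = - 1 - k a * k c" "lform (v c) (v a) = - 1 - k a * k c"
    "lform (v b) (v c) = - 1 - k b * k c" "lform (v c) (v b) = - 1 - k b * k c"
    using assms(1) F by (auto simp: is_config_def mult.commute)
  show g: "M ** lmat ** transpose M = vector [vector [1 - (k a)\<^sup>2, - 1 - k a * k b, - 1 - k a * k c],
      vector [- 1 - k a * k b, 1 - (k b)\<^sup>2, - 1 - k b * k c], vector [- 1 - k a * k c, - 1 - k b * k c, 1 - (k c)\<^sup>2]]"
    unfolding vec_eq_iff forall_3 gram_matrix by (simp add: M_def cf)
  have "det M * det lmat * det M = det (M ** lmat ** transpose M)" by (simp add: det_mul)
  also have "\<dots> = - 4 * (1 + (k a * k b + k b * k c + k c * k a))"
    unfolding g det_3 by (simp add: power2_eq_square algebra_simps)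
  finally have "det M * det lmat * det M = - 4 * (1 + (k a * k b + k b * k c + k c * k a))" .
  moreover have "k a * k b + k b * k c + k c * k a > 0" using kpos F by (auto intro!: add_pos_pos)
  ultimately have "det M \<noteq> 0" by auto
  then show "invertible M" by (simp add: invertible_det_nz)
qed

text \<open>The three vectors form a basis, so \<open>m\<close> is determined by its products with them, which are
  \<open>- s * k u\<close>; the combination on the right has products \<open>- (1 + \<sigma>) * k u\<close>. Substituting the result into
  the norm of \<open>m\<close> gives the equation for \<open>s\<close>.\<close>

lemma config_dual_vector:
  assumes cf: "is_config F k v m s"
  shows "m = (s / (1 + sig2 F k)) *\<^sub>R (((k b + k c) / 2) *\<^sub>R v a + ((k a + k c) / 2) *\<^sub>R v b + ((k a + k b) / 2) *\<^sub>R v c)"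
      (is "m = ?l *\<^sub>R ?n")
    and "s\<^sup>2 = 1 + sig2 F k"
proof -
  define M where "M = (vector [v a, v b, v c] :: real^3^3)"
  have sg: "sig2 F k = k a * k b + k b * k c + k c * k a" unfolding F(1) by (rule sig2_triple[OF F(2-4)])
  have "k a * k b + k b * k c + k c * k a > 0" using kpos F by (auto intro!: add_pos_pos)
  then have sp: "sig2 F k > 0" using sg by simp
  have l: "lform (v a) (v a) = 1 - (k a)\<^sup>2" "lform (v b) (v b) = 1 - (k b)\<^sup>2" "lform (v c) (v c) = 1 - (k c)\<^sup>2"
    "lform (v a) (v b) = - 1 - k a * k b" "lform (v b) (v a) = - 1 - k a * k b"
    "lform (v a) (v c) = - 1 - k a * k c" "lform (v c) (v a) = - 1 - k a * k c"
    "lform (v b) (v c) = - 1 - k b * k c" "lform (v c) (v b) = - 1 - k b * k c"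
    and lm: "lform (v a) m = - k a * s" "lform (v b) m = - k b * s" "lform (v c) m = - k c * s"
    and mm: "lform m m = 1 - s\<^sup>2" "s > 1"
    using cf F by (auto simp: is_config_def mult.commute)
  have n: "lform (v a) ?n = - k a * (1 + sig2 F k)" "lform (v b) ?n = - k b * (1 + sig2 F k)" "lform (v c) ?n = - k c * (1 + sig2 F k)"
    unfolding sg lform_add_right lform_scaleR_right l by (simp_all add: field_simps power2_eq_square)
  define R where "R = lmat *v (m - ?l *\<^sub>R ?n)"
  have "lform (v a) (m - ?l *\<^sub>R ?n) = 0" "lform (v b) (m - ?l *\<^sub>R ?n) = 0" "lform (v c) (m - ?l *\<^sub>R ?n) = 0"
    unfolding lform_diff_right lform_scaleR_right n lm using sp by simp_all
  then have "v a \<bullet> R = 0" "v b \<bullet> R = 0" "v c \<bullet> R = 0" by (simp_all add: lform_lmat R_def)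
  then have "M *v R = 0"
    by (simp add: vec_eq_iff forall_3 matrix_vector_mul_component M_def)
  obtain M' where "M' ** M = mat 1" using config_rows(2)[OF cf] unfolding M_def invertible_def by blast
  from \<open>M *v R = 0\<close> have "(M' ** M) *v R = 0" by (simp only: matrix_vector_mul_assoc[symmetric] matrix_vector_mult_0_right)
  then have "R = 0" unfolding \<open>M' ** M = mat 1\<close> matrix_vector_mul_lid .
  moreover have "m - ?l *\<^sub>R ?n = hmat *v R" unfolding R_def
    by (simp only: matrix_vector_mul_assoc lmat_hmat matrix_vector_mul_lid)
  ultimately have "m - ?l *\<^sub>R ?n = 0" by simp
  then show m: "m = ?l *\<^sub>R ?n" by simp
  have mn: "lform m ?n = - s * sig2 F k"
    unfolding lform_add_right lform_scaleR_right lform_commute[of m] lm sg by (simp add: field_simps)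
  have "lform m m = lform m (?l *\<^sub>R ?n)" using m by simp
  also have "\<dots> = ?l * (- s * sig2 F k)" unfolding lform_scaleR_right mn ..
  finally have "1 - s\<^sup>2 = - s\<^sup>2 * sig2 F k / (1 + sig2 F k)" unfolding mm by (simp add: power2_eq_square)
  then show "s\<^sup>2 = 1 + sig2 F k" using sp by (simp add: field_simps)
qed

text \<open>The linear map \<open>N\<close> that carries the one triple of functionals to the other preserves the Lorentzian form,
  because the Gram matrices agree. It also preserves the sheet of the hyperboloid: it carries \<open>m\<close> to \<open>m'\<close>,
  and both are positive exactly on the upper sheet.\<close>

lemma config_isometry_aux:
  assumes cf: "is_config F k v m s" and cf': "is_config F k v' m' s'"
  shows "\<exists>\<psi>. \<forall>z\<in>H2. \<psi> z \<in> H2 \<and> (\<forall>u\<in>F. v' u \<bullet> hyp (\<psi> z) = v u \<bullet> hyp z) \<and> m' \<bullet> hyp (\<psi> z) = m \<bullet> hyp z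
      \<and> (\<forall>w\<in>H2. hdist (\<psi> z) (\<psi> w) = hdist z w)"
proof -
  define M where "M = (vector [v a, v b, v c] :: real^3^3)"
  define M' where "M' = (vector [v' a, v' b, v' c] :: real^3^3)"
  obtain L where L: "M' ** L = mat 1" "L ** M' = mat 1"
    using config_rows(2)[OF cf'] unfolding M'_def invertible_def by blast
  have gram: "M ** lmat ** transpose M = M' ** lmat ** transpose M'"
    using config_rows(1)[OF cf] config_rows(1)[OF cf'] by (simp add: M_def M'_def)
  define N where "N = L ** M"
  have M'N: "M' ** N = M" by (simp add: N_def matrix_mul_assoc L)
  have "N ** lmat ** transpose N = L ** (M ** lmat ** transpose M) ** transpose L"
    by (simp add: N_def matrix_transpose_mul matrix_mul_assoc)
  also have "\<dots> = (L ** M') ** lmat ** transpose (L ** M')"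
    by (simp add: gram matrix_transpose_mul matrix_mul_assoc)
  finally have N1: "N ** lmat ** transpose N = lmat" by (simp add: L transpose_mat)
  have "N ** (lmat ** transpose N ** hmat) = mat 1" using N1 lmat_hmat(1) by (metis matrix_mul_assoc)
  then have "(lmat ** transpose N ** hmat) ** N = mat 1" by (simp add: matrix_left_right_inverse)
  then have "hmat ** (lmat ** transpose N ** hmat ** N) = hmat" by simp
  then have N2: "transpose N ** hmat ** N = hmat" by (simp add: matrix_mul_assoc lmat_hmat)
  have hN: "hform (N *v X) (N *v Y) = hform X Y" for X Y
  proof -
    have "(N *v X) \<bullet> (hmat *v (N *v Y)) = (X v* transpose N) \<bullet> (hmat *v (N *v Y))"
      by (simp only: vector_transpose_matrix)
    also have "\<dots> = X \<bullet> ((transpose N ** hmat ** N) *v Y)"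
      by (simp only: dot_lmul_matrix matrix_vector_mul_assoc matrix_mul_assoc)
    finally have "(N *v X) \<bullet> (hmat *v (N *v Y)) = X \<bullet> ((transpose N ** hmat ** N) *v Y)" .
    then show ?thesis by (simp add: hform_hmat N2)
  qed
  have vN: "v' u \<bullet> (N *v X) = v u \<bullet> X" if "u \<in> F" for u X
  proof -
    have "M' *v (N *v X) = M *v X" by (simp add: matrix_vector_mul_assoc M'N)
    then show ?thesis using that unfolding F(1) vec_eq_iff forall_3 matrix_vector_mul_component
      by (auto simp: M_def M'_def)
  qed
  have "s > 1" "s' > 1" using cf cf' by (simp_all add: is_config_def)
  then have s: "s = s'"
    using config_dual_vector(2)[OF cf] config_dual_vector(2)[OF cf'] power2_eq_iff_nonneg[of s s'] by simp
  have mN: "m' \<bullet> (N *v X) = m \<bullet> X" for X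
  proof -
    have "v' a \<bullet> (N *v X) = v a \<bullet> X" "v' b \<bullet> (N *v X) = v b \<bullet> X" "v' c \<bullet> (N *v X) = v c \<bullet> X"
      using vN F(1) by auto
    then show ?thesis
      by (subst config_dual_vector(1)[OF cf], subst config_dual_vector(1)[OF cf']) (simp add: inner_add_left s)
  qed
  have tl: "lform m m < 0" "m$1 > 0" "lform m' m' < 0" "m'$1 > 0"
    using cf cf' by (auto simp: is_config_def)
  have ex: "\<exists>w\<in>H2. hyp w = N *v hyp z" if z: "z \<in> H2" for z
  proof (rule hyp_surj)
    let ?X = "N *v hyp z"
    show h1: "hform ?X ?X = 1" using hN hform_hyp_self[OF z] by simp
    show "?X $ 3 > 0"
    proof (rule ccontr)
      assume "\<not> ?X $ 3 > 0"
      moreover have "?X $ 3 \<noteq> 0"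
      proof
        assume "?X $ 3 = 0"
        then have "- (?X$2 * ?X$2) = 1" using h1 by (simp add: hform_def)
        moreover have "?X$2 * ?X$2 \<ge> 0" by simp
        ultimately show False by linarith
      qed
      ultimately have "(- ?X) $ 3 > 0" by simp
      moreover have "hform (- ?X) (- ?X) = 1" using h1 by (simp add: hform_def)
      ultimately obtain w where w: "w \<in> H2" "hyp w = - ?X" using hyp_surj by blast
      have "m' \<bullet> hyp w > 0" by (rule timelike_pos[OF tl(3,4) w(1)])
      moreover have "m' \<bullet> ?X > 0" unfolding mN by (rule timelike_pos[OF tl(1,2) z])
      ultimately show False by (simp add: w(2))
    qed
  qed
  then obtain \<psi> where \<psi>: "\<And>z. z \<in> H2 \<Longrightarrow> \<psi> z \<in> H2 \<and> hyp (\<psi> z) = N *v hyp z" by metis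
  have "hdist (\<psi> z) (\<psi> w) = hdist z w" if z: "z \<in> H2" and w: "w \<in> H2" for z w
  proof -
    have "cosh (hdist (\<psi> z) (\<psi> w)) = cosh (hdist z w)"
      using \<psi>[OF z] \<psi>[OF w] z w by (simp add: cosh_hdist_hform hN)
    then show ?thesis using cosh_real_nonneg_eq_iff hdist_nonneg \<psi> z w by auto
  qed
  then show ?thesis using \<psi> vN mN by (intro exI[of _ \<psi>]) auto
qed

text \<open>The maps obtained in both directions are mutually inverse, since three independent functionals separate
  points.\<close>

lemma config_isometry:
  assumes cf: "is_config F k v m s" and cf': "is_config F k v' m' s'"
  shows "\<exists>\<psi>. h_isometry \<psi> \<and> (\<forall>z\<in>H2. (\<forall>u\<in>F. v' u \<bullet> hyp (\<psi> z) = v u \<bullet> hyp z) \<and> m' \<bullet> hyp (\<psi> z) = m \<bullet> hyp z)"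
proof -
  obtain \<psi> where \<psi>: "\<forall>z\<in>H2. \<psi> z \<in> H2 \<and> (\<forall>u\<in>F. v' u \<bullet> hyp (\<psi> z) = v u \<bullet> hyp z) \<and> m' \<bullet> hyp (\<psi> z) = m \<bullet> hyp z
      \<and> (\<forall>w\<in>H2. hdist (\<psi> z) (\<psi> w) = hdist z w)" using config_isometry_aux[OF assms] by blast
  obtain \<phi> where \<phi>: "\<forall>z\<in>H2. \<phi> z \<in> H2 \<and> (\<forall>u\<in>F. v u \<bullet> hyp (\<phi> z) = v' u \<bullet> hyp z) \<and> m \<bullet> hyp (\<phi> z) = m' \<bullet> hyp z
      \<and> (\<forall>w\<in>H2. hdist (\<phi> z) (\<phi> w) = hdist z w)" using config_isometry_aux[OF cf' cf] by blast
  have det: "z = w" if z: "z \<in> H2" "w \<in> H2" and e: "\<And>u. u \<in> F \<Longrightarrow> x u \<bullet> hyp z = x u \<bullet> hyp w" and x: "is_config F k x n t"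
    for z w and x :: "'v \<Rightarrow> real^3" and n t
  proof -
    let ?M = "vector [x a, x b, x c] :: real^3^3"
    have "?M *v hyp z = ?M *v hyp w"
      unfolding vec_eq_iff forall_3 matrix_vector_mul_component using e F(1) by simp
    then have "M' *v (?M *v hyp z) = M' *v (?M *v hyp w)" for M' :: "real^3^3" by (rule arg_cong)
    then have "(M' ** ?M) *v hyp z = (M' ** ?M) *v hyp w" for M' :: "real^3^3" by (simp only: matrix_vector_mul_assoc)
    moreover obtain M' where "M' ** ?M = mat 1" using config_rows(2)[OF x] unfolding invertible_def by blast
    ultimately have "mat 1 *v hyp z = mat 1 *v hyp w" by metis
    then have "hyp z = hyp w" unfolding matrix_vector_mul_lid .
    then show ?thesis using inj_on_hyp z by (auto dest: inj_onD)
  qed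
  have "bij_betw \<psi> H2 H2"
  proof (rule bij_betw_byWitness[where f' = \<phi>])
    show "\<forall>z\<in>H2. \<phi> (\<psi> z) = z"
    proof
      fix z assume z: "z \<in> H2"
      then have p: "\<psi> z \<in> H2" "\<phi> (\<psi> z) \<in> H2" using \<psi> \<phi> by blast+
      show "\<phi> (\<psi> z) = z" by (rule det[OF p(2) z _ cf]) (use \<psi> \<phi> z p in auto)
    qed
    show "\<forall>z\<in>H2. \<psi> (\<phi> z) = z"
    proof
      fix z assume z: "z \<in> H2"
      then have p: "\<phi> z \<in> H2" "\<psi> (\<phi> z) \<in> H2" using \<psi> \<phi> by blast+
      show "\<psi> (\<phi> z) = z" by (rule det[OF p(2) z _ cf']) (use \<psi> \<phi> z p in auto)
    qed
  qed (use \<psi> \<phi> in auto)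
  then have "h_isometry \<psi>" using \<psi> by (simp add: h_isometry_def)
  then show ?thesis using \<psi> by blast
qed

end

text \<open>The sum \<open>v + w\<close> together with \<open>k + l\<close> is a null vector, so the sum of the two equations is a positive
  multiple of the squared Euclidean distance from a single point \<open>p\<close>. This gives both the unique common
  point and the disjointness. A curve perpendicular to both passes through \<open>p\<close>, since its inner product with
  the null vector vanishes.\<close>

lemma tangent_point:
  assumes v: "lform v v = 1 - k\<^sup>2" and w: "lform w w = 1 - l\<^sup>2" and vw: "lform v w = - 1 - k * l"
    and kl: "k > 0" "l > 0" and pos: "v$1 + v$3 + (w$1 + w$3) > 0"
    and m: "lform v m = - k * s" "lform w m = - l * s"
  obtains p where "p \<in> H2" "qf m s p = 0" "{z\<in>H2. qf v k z = 0} \<inter> {z\<in>H2. qf w l z = 0} = {p}"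
    and "\<And>z. qf v k z + qf w l z \<ge> 0"
proof -
  define A B C where "A = v$1 + w$1" and "B = v$2 + w$2" and "C = v$3 + w$3"
  (* the vector v + w is null *)
  have n: "B * B + (k + l)\<^sup>2 = 4 * A * C"
    using v w vw by (simp add: lform_def A_def B_def C_def power2_eq_square algebra_simps)
  have "B * B + (k + l)\<^sup>2 > 0" by (rule add_nonneg_pos) (use kl in simp_all)
  then have "A * C > 0" using n by simp
  then have A: "A > 0" using pos by (auto simp: A_def C_def zero_less_mult_iff)
  define p where "p = Complex (- B / (2 * A)) ((k + l) / (2 * A))"
  have p: "p \<in> H2" using A kl by (simp add: p_def H2_def)
  have pp: "A * (cmod p)\<^sup>2 = C"
  proof -
    have "(cmod p)\<^sup>2 = (B * B + (k + l)\<^sup>2) / (4 * (A * A))"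
      unfolding cmod_power2 p_def by (simp add: power_divide power_mult_distrib power2_eq_square flip: add_divide_distrib)
    then show ?thesis unfolding n using A by simp
  qed
  have sum: "qf v k z + qf w l z = A * (cmod (z - p))\<^sup>2" for z
  proof -
    have "A * (cmod (z - p))\<^sup>2 = A * (cmod z)\<^sup>2 - 2 * A * Re p * Re z - 2 * A * Im p * Im z + A * (cmod p)\<^sup>2"
      unfolding cmod_power2 by (simp add: power2_eq_square algebra_simps)
    also have "\<dots> = A * (cmod z)\<^sup>2 + B * Re z - (k + l) * Im z + C"
      unfolding pp using A by (simp add: p_def)
    finally show ?thesis by (simp add: qf_def A_def B_def C_def algebra_simps)
  qed
  have val: "A * qf u j p = - (lform v u + lform w u + j * (k + l)) / 2" for u j
  proof -
    have "A * qf u j p = u$1 * (A * (cmod p)\<^sup>2) + u$2 * (A * Re p) + u$3 * A - j * (A * Im p)"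
      by (simp add: qf_def algebra_simps)
    also have "A * Re p = - B / 2" using A by (simp add: p_def)
    also have "A * Im p = (k + l) / 2" using A by (simp add: p_def)
    also have "u$1 * (A * (cmod p)\<^sup>2) + u$2 * (- B / 2) + u$3 * A - j * ((k + l) / 2) = - (lform v u + lform w u + j * (k + l)) / 2"
      unfolding pp by (simp add: lform_def A_def B_def C_def field_simps)
    finally show ?thesis .
  qed
  have "A * qf m s p = 0" unfolding val m by (simp add: algebra_simps)
  then have q: "qf m s p = 0" using A by simp
  have "A * qf v k p = 0" unfolding val v lform_commute[of w v] vw by (simp add: algebra_simps power2_eq_square)
  moreover have "A * qf w l p = 0" unfolding val w vw by (simp add: algebra_simps power2_eq_square)
  ultimately have q2: "qf v k p = 0" "qf w l p = 0" using A by simp_all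
  have "{z\<in>H2. qf v k z = 0} \<inter> {z\<in>H2. qf w l z = 0} = {p}"
  proof (intro equalityI subsetI)
    fix z assume "z \<in> {z\<in>H2. qf v k z = 0} \<inter> {z\<in>H2. qf w l z = 0}"
    then have "A * (cmod (z - p))\<^sup>2 = 0" using sum[of z] by simp
    then show "z \<in> {p}" using A by simp
  qed (use p q2 in auto)
  moreover have "qf v k z + qf w l z \<ge> 0" for z unfolding sum using A by simp
  ultimately show thesis using that p q by blast
qed

text \<open>Put the center of the dual circle at \<open>i\<close>, so that \<open>m\<close> is a multiple of \<open>(1, 0, 1)\<close>. Perpendicularity
  then fixes \<open>v u $ 1 + v u $ 3\<close>, and the remaining coordinates \<open>(B u, X u)\<close> have to be three vectors of the
  Euclidean plane with prescribed inner products \<open>k u * k w / t\<^sup>2 \<plusminus> 1\<close>. Placing the first on an axis determines the others.\<close>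

lemma config_exists:
  assumes F: "F = {a, b, c}" "a \<noteq> b" "b \<noteq> c" "a \<noteq> c" and kpos: "\<forall>u\<in>F. 0 < k u"
  shows "\<exists>v m s. is_config F k v m s \<and> m$2 = 0 \<and> m$1 = m$3 \<and> (\<forall>u\<in>F. v u $ 1 + v u $ 3 > 0)"
proof -
  define t where "t = sqrt (sig2 F k)"
  define s where "s = sqrt (1 + sig2 F k)"
  have sg: "sig2 F k = k a * k b + k b * k c + k c * k a" unfolding F(1) by (rule sig2_triple[OF F(2-4)])
  have kp: "k a > 0" "k b > 0" "k c > 0" using kpos F by auto
  have "k a * k b + k b * k c + k c * k a > 0" using kp by (auto intro!: add_pos_pos)
  then have sp: "sig2 F k > 0" using sg by simp
  have t: "t > 0" "t\<^sup>2 = k a * k b + k b * k c + k c * k a" using sp sg by (simp_all add: t_def)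
  have s: "s > 1" "s\<^sup>2 = 1 + t\<^sup>2" using sp by (simp_all add: s_def t_def)
  define x where "x = sqrt (k a + k b)"
  define y where "y = sqrt (k a + k c)"
  have xy: "x > 0" "y > 0" "x\<^sup>2 = k a + k b" "y\<^sup>2 = k a + k c" using kp by (simp_all add: x_def y_def)
  define B where "B u = (if u = a then x * y / t else if u = b then - k c * x / (t * y) else - k b * y / (t * x))" for u
  define X where "X u = (if u = a then 0 else if u = b then x / y else - y / x)" for u
  define \<kappa> where "\<kappa> u = s * k u / t" for u
  define v where "v u = (vector [(\<kappa> u + X u) / 2, B u, (\<kappa> u - X u) / 2] :: real^3)" for u
  define m where "m = (vector [t / 2, 0, t / 2] :: real^3)"
  have lv: "lform (v u) (v w) = B u * B w + X u * X w - k u * k w / t\<^sup>2 - k u * k w" for u w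
  proof -
    have "lform (v u) (v w) = B u * B w + X u * X w - \<kappa> u * \<kappa> w"
      by (simp add: lform_def v_def field_simps)
    also have "\<kappa> u * \<kappa> w = s\<^sup>2 * (k u * k w) / t\<^sup>2" by (simp add: \<kappa>_def power2_eq_square)
    also have "s\<^sup>2 * (k u * k w) / t\<^sup>2 = k u * k w / t\<^sup>2 + k u * k w"
      unfolding s(2) using t(1) by (simp add: field_simps)
    finally show ?thesis by simp
  qed
  have g: "B u * B w + X u * X w - k u * k w / t\<^sup>2 = (if u = w then 1 else -1)" if "u \<in> F" "w \<in> F" for u w
  proof -
    have tx: "t \<noteq> 0" "x \<noteq> 0" "y \<noteq> 0" using t xy by auto
    have aa: "B a * B a + X a * X a - k a * k a / t\<^sup>2 = 1"
    proof -
      have "B a * B a + X a * X a - k a * k a / t\<^sup>2 = (x\<^sup>2 * y\<^sup>2 - k a * k a) / t\<^sup>2"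
        using tx by (simp add: B_def X_def power2_eq_square field_simps)
      also have "x\<^sup>2 * y\<^sup>2 - k a * k a = t\<^sup>2" unfolding xy t by (simp add: algebra_simps)
      finally show ?thesis using tx by simp
    qed
    have bb: "B b * B b + X b * X b - k b * k b / t\<^sup>2 = 1"
    proof -
      have "B b * B b + X b * X b - k b * k b / t\<^sup>2 = (k c * k c * x\<^sup>2 + x\<^sup>2 * t\<^sup>2 - k b * k b * y\<^sup>2) / (t\<^sup>2 * y\<^sup>2)"
        using F tx by (simp add: B_def X_def power2_eq_square field_simps)
      also have "k c * k c * x\<^sup>2 + x\<^sup>2 * t\<^sup>2 - k b * k b * y\<^sup>2 = t\<^sup>2 * y\<^sup>2" unfolding xy t by (simp add: algebra_simps)
      finally show ?thesis using tx by simp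
    qed
    have cc: "B c * B c + X c * X c - k c * k c / t\<^sup>2 = 1"
    proof -
      have "B c * B c + X c * X c - k c * k c / t\<^sup>2 = (k b * k b * y\<^sup>2 + y\<^sup>2 * t\<^sup>2 - k c * k c * x\<^sup>2) / (t\<^sup>2 * x\<^sup>2)"
        using F tx by (simp add: B_def X_def power2_eq_square field_simps)
      also have "k b * k b * y\<^sup>2 + y\<^sup>2 * t\<^sup>2 - k c * k c * x\<^sup>2 = t\<^sup>2 * x\<^sup>2" unfolding xy t by (simp add: algebra_simps)
      finally show ?thesis using tx by simp
    qed
    have ab: "B a * B b + X a * X b - k a * k b / t\<^sup>2 = -1"
    proof -
      have "B a * B b + X a * X b - k a * k b / t\<^sup>2 = (- (k c * x\<^sup>2) - k a * k b) / t\<^sup>2"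
        using F tx by (simp add: B_def X_def power2_eq_square field_simps)
      also have "- (k c * x\<^sup>2) - k a * k b = - t\<^sup>2" unfolding xy t by (simp add: algebra_simps)
      finally show ?thesis using tx by simp
    qed
    have ac: "B a * B c + X a * X c - k a * k c / t\<^sup>2 = -1"
    proof -
      have "B a * B c + X a * X c - k a * k c / t\<^sup>2 = (- (k b * y\<^sup>2) - k a * k c) / t\<^sup>2"
        using F tx by (simp add: B_def X_def power2_eq_square field_simps)
      also have "- (k b * y\<^sup>2) - k a * k c = - t\<^sup>2" unfolding xy t by (simp add: algebra_simps)
      finally show ?thesis using tx by simp
    qed
    have bc: "B b * B c + X b * X c - k b * k c / t\<^sup>2 = -1"
      using F tx by (simp add: B_def X_def power2_eq_square field_simps)
    show ?thesis using that unfolding F(1) using aa bb cc ab ac bc F(2-4) by (auto simp: mult.commute)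
  qed
  have "is_config F k v m s" unfolding is_config_def
  proof (intro conjI ballI impI)
    fix u assume u: "u \<in> F"
    show "lform (v u) (v u) = 1 - (k u)\<^sup>2" unfolding lv using g[OF u u] by (simp add: power2_eq_square)
    have "lform (v u) m = - (\<kappa> u * t)" by (simp add: lform_def v_def m_def field_simps)
    then show "lform (v u) m = - k u * s" using t(1) by (simp add: \<kappa>_def)
    show "lform (v u) (v w) = - 1 - k u * k w" if "w \<in> F" "u \<noteq> w" for w
      unfolding lv using g[OF u that(1)] that(2) by simp
  next
    show "lform m m = 1 - s\<^sup>2" unfolding s by (simp add: lform_def m_def power2_eq_square)
    show "s > 1" by (rule s)
    show "m$1 > 0" using t by (simp add: m_def)
  qed
  moreover have "v u $ 1 + v u $ 3 > 0" if "u \<in> F" for u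
  proof -
    have "v u $ 1 + v u $ 3 = s * k u / t" by (simp add: v_def \<kappa>_def[symmetric] field_simps)
    also have "\<dots> > 0" using s t kpos that by simp
    finally show ?thesis .
  qed
  moreover have "m$2 = 0" "m$1 = m$3" by (simp_all add: m_def)
  ultimately show ?thesis by blast
qed

lemma face_packing_exists:
  fixes k :: "'v \<Rightarrow> real"
  assumes c3: "card F = 3" and kpos: "\<forall>u\<in>F. 0 < k u"
  shows "\<exists>G c r. (\<forall>v\<in>F. gcircle_wf (G v) \<and> geod_curvature (G v) = k v) \<and>
     (\<forall>u\<in>F. \<forall>v\<in>F. u \<noteq> v \<longrightarrow> ext_tangent (G u) (G v)) \<and> gcircle_wf (Circle c r) \<and>
     (\<forall>v\<in>F. perpendicular (curve (G v)) (curve (Circle c r))) \<and>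
     (\<forall>u\<in>F. \<forall>v\<in>F. u \<noteq> v \<longrightarrow> curve (G u) \<inter> curve (G v) \<subseteq> curve (Circle c r))"
proof -
  obtain a b c where F: "F = {a, b, c}" "a \<noteq> b" "b \<noteq> c" "a \<noteq> c"
    using c3 unfolding card_3_iff by auto
  obtain v m s where cf: "is_config F k v m s" and m: "m$2 = 0" "m$1 = m$3" and pos: "\<forall>u\<in>F. v u $ 1 + v u $ 3 > 0"
    using config_exists[OF F kpos] by blast
  have l: "\<And>u. u \<in> F \<Longrightarrow> lform (v u) (v u) = 1 - (k u)\<^sup>2" "\<And>u w. u \<in> F \<Longrightarrow> w \<in> F \<Longrightarrow> u \<noteq> w \<Longrightarrow> lform (v u) (v w) = - 1 - k u * k w"
    "\<And>u. u \<in> F \<Longrightarrow> lform (v u) m = - k u * s" "lform m m = 1 - s\<^sup>2" "s > 1" "m$1 > 0"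
    using cf by (auto simp: is_config_def)
  have "\<exists>C. gcircle_wf C \<and> geod_curvature C = k u \<and> gvec C = v u" if u: "u \<in> F" for u
  proof (rule gcircle_of_vector)
    show "k u > 0" using kpos u by blast
    show "lform (v u) (v u) = 1 - (k u)\<^sup>2" by (rule l(1)[OF u])
    assume k1: "1 \<le> k u"
    have p: "v u $ 1 + v u $ 3 > 0" using pos u by blast
    have "(k u)\<^sup>2 \<ge> 1" using k1 by simp
    moreover have "4 * (v u $ 1 * v u $ 3) = (v u $ 2)\<^sup>2 + ((k u)\<^sup>2 - 1)"
      using l(1)[OF u] unfolding lform_def power2_eq_square by simp
    moreover have "(v u $ 2)\<^sup>2 \<ge> 0" by (rule zero_le_power2)
    ultimately have "v u $ 1 * v u $ 3 \<ge> 0" by linarith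
    then show "0 \<le> v u $ 1 \<and> 0 \<le> v u $ 3 \<and> 0 < v u $ 1 + v u $ 3"
      using p by (auto simp: zero_le_mult_iff)
  qed
  then obtain G where G: "\<And>u. u \<in> F \<Longrightarrow> gcircle_wf (G u) \<and> geod_curvature (G u) = k u \<and> gvec (G u) = v u" by metis
  obtain D where D: "gcircle_wf D" "geod_curvature D = s" "gvec D = m"
    using gcircle_of_vector[of s m] l m by auto
  obtain q r where Do: "D = Circle q r"
  proof (cases D)
    case (Hypercycle A d)
    then show ?thesis using D(2) l(5) tanh_real_lt_1[of "\<bar>d\<bar>"] by simp
  qed (use D(2) l(5) in auto)
  have cG: "curve (G u) = {z\<in>H2. qf (v u) (k u) z = 0}" "convex_side (G u) = {z\<in>H2. qf (v u) (k u) z < 0}" if "u \<in> F" for u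
    using curve_qf[of "G u"] G[OF that] by auto
  have cD: "curve D = {z\<in>H2. qf m s z = 0}" using curve_qf(1)[OF D(1)] D by simp
  have tan: "\<exists>p. p \<in> curve D \<and> curve (G u) \<inter> curve (G w) = {p} \<and> convex_side (G u) \<inter> convex_side (G w) = {}"
    if u: "u \<in> F" and w: "w \<in> F" "u \<noteq> w" for u w
  proof -
    have ku: "k u > 0" "k w > 0" using kpos u w by auto
    have "v u $ 1 + v u $ 3 > 0" "v w $ 1 + v w $ 3 > 0" using pos u w by auto
    then have vpos: "v u $ 1 + v u $ 3 + (v w $ 1 + v w $ 3) > 0" by linarith
    obtain p where p: "p \<in> H2" "qf m s p = 0" "{z\<in>H2. qf (v u) (k u) z = 0} \<inter> {z\<in>H2. qf (v w) (k w) z = 0} = {p}"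
      and nn: "\<And>z. qf (v u) (k u) z + qf (v w) (k w) z \<ge> 0"
      using tangent_point[OF l(1)[OF u] l(1)[OF w(1)] l(2)[OF u w] ku vpos l(3)[OF u] l(3)[OF w(1)]] by blast
    have "convex_side (G u) \<inter> convex_side (G w) = {}"
      unfolding cG[OF u] cG[OF w(1)] using nn by (metis (no_types, lifting) Int_emptyI add_neg_neg linorder_not_le mem_Collect_eq)
    moreover have "p \<in> curve D" unfolding cD using p by simp
    moreover have "curve (G u) \<inter> curve (G w) = {p}" unfolding cG[OF u] cG[OF w(1)] by (rule p(3))
    ultimately show ?thesis by blast
  qed
  have perp: "perpendicular (curve (G u)) (curve D)" if u: "u \<in> F" for u
  proof -
    obtain w where "w \<in> F" "u \<noteq> w" using F u by auto
    then have "curve (G u) \<inter> curve D \<noteq> {}" using tan[OF u] by blast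
    then show ?thesis
      using perpendicular_iff[OF cG(1)[OF u] l(1)[OF u] cD l(4)] l(3)[OF u] by simp
  qed
  show ?thesis
  proof (intro exI conjI ballI impI)
    fix u assume u: "u \<in> F"
    show "gcircle_wf (G u)" "geod_curvature (G u) = k u" using G[OF u] by auto
    show "perpendicular (curve (G u)) (curve (Circle q r))" using perp[OF u] Do by simp
    fix w assume w: "w \<in> F" "u \<noteq> w"
    obtain p where p: "p \<in> curve D" "curve (G u) \<inter> curve (G w) = {p}" "convex_side (G u) \<inter> convex_side (G w) = {}"
      using tan[OF u w] by blast
    show "ext_tangent (G u) (G w)" unfolding ext_tangent_def using p by metis
    show "curve (G u) \<inter> curve (G w) \<subseteq> curve (Circle q r)" unfolding Do[symmetric] p(2) using p(1) by simp
  next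
    show "gcircle_wf (Circle q r)" using D Do by simp
  qed
qed

section \<open>The length of an arc inside a perpendicular circle\<close>

text \<open>Two perpendicular curves that meet in \<open>p\<close>; the second one is a circle since \<open>s > 1\<close>.\<close>

locale perpendicular_arc =
  fixes v m :: "real^3" and k s :: real and p :: complex
  assumes k: "k > 0" and s: "s > 1" and v: "lform v v = 1 - k\<^sup>2" and m: "lform m m = 1 - s\<^sup>2"
    and vm: "lform v m = - k * s" and p: "p \<in> H2" "qf v k p = 0" "qf m s p = 0"
begin

definition grad :: complex where "grad = qgrad v k p"
definition ht :: real where "ht = Im p"
definition twist :: complex where "twist = grad + \<i> * complex_of_real k"
text \<open>The points of the first curve, in homogeneous coordinates. The velocity of the parametrization at \<open>p\<close>
  is a multiple of \<open>\<i> * grad\<close>, tangent to the curve, and the denominator is chosen so that the hyperbolic arc length is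
  \<open>2 du / (1 + (k\<^sup>2 - 1) u\<^sup>2)\<close> for \<open>u = a / b\<close>: the parameter \<open>u\<close> is the tangent of half the arc length,
  with the trigonometric functions of a curve of curvature \<open>k\<close>.\<close>

definition arc_hom :: "real \<Rightarrow> real \<Rightarrow> complex" where
  "arc_hom a b = p + 2 * \<i> * complex_of_real ht * grad * complex_of_real a / (complex_of_real b - twist * complex_of_real a)"

lemma ht_pos: "ht > 0" using p by (simp add: ht_def H2_def)

lemma grad_norm: "(Re grad)\<^sup>2 + (Im grad)\<^sup>2 = 1"
  using norm_qgrad[OF v p(2)] cmod_power2[of grad] by (simp add: grad_def)

lemma grad_nz: "grad \<noteq> 0" using grad_norm by auto

lemma curvature_at_p: "2 * v$1 * ht = Im grad + k" by (simp add: grad_def qgrad_def ht_def)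

text \<open>The gradient of the second curve at \<open>p\<close> is \<open>\<plusminus> \<i> * grad\<close>; this is the sign.\<close>

definition side_sgn :: real where "side_sgn = Re (qgrad m s p * cnj (\<i> * grad))"

lemma dual_grad: "qgrad m s p = complex_of_real side_sgn * (\<i> * grad)" and side_sgn_sq: "side_sgn * side_sgn = 1"
proof -
  define q where "q = qgrad m s p"
  have gq: "Re grad * Re q + Im grad * Im q = 0"
    using p vm qgrad_inner[of v k p m s] by (simp add: grad_def q_def inner_complex_def)
  have qn: "(Re q)\<^sup>2 + (Im q)\<^sup>2 = 1" using norm_qgrad[OF m p(3)] cmod_power2[of q] by (simp add: q_def)
  have e: "side_sgn = Im q * Re grad - Re q * Im grad" by (simp add: side_sgn_def q_def)
  have "side_sgn * (- Im grad) = Re q * ((Re grad)\<^sup>2 + (Im grad)\<^sup>2) - Re grad * (Re grad * Re q + Im grad * Im q)"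
    unfolding e by (simp add: power2_eq_square algebra_simps)
  moreover have "side_sgn * Re grad = Im q * ((Re grad)\<^sup>2 + (Im grad)\<^sup>2) - Im grad * (Re grad * Re q + Im grad * Im q)"
    unfolding e by (simp add: power2_eq_square algebra_simps)
  ultimately have q: "Re q = side_sgn * (- Im grad)" "Im q = side_sgn * Re grad" unfolding gq grad_norm by simp_all
  then show "qgrad m s p = complex_of_real side_sgn * (\<i> * grad)" unfolding q_def[symmetric] by (simp add: complex_eq_iff)
  have "side_sgn * side_sgn * ((Re grad)\<^sup>2 + (Im grad)\<^sup>2) = 1" using qn unfolding q by (simp add: power_mult_distrib algebra_simps power2_eq_square)
  then show "side_sgn * side_sgn = 1" using grad_norm by simp
qed

lemma dual_at_p: "2 * m$1 * ht = side_sgn * Re grad + s"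
  using arg_cong[OF dual_grad, of Im] by (simp add: qgrad_def ht_def)

text \<open>Everything follows from expanding the quadratic functions at \<open>p\<close>, where the leading coefficients are
  given by \<open>curvature_at_p\<close> and \<open>dual_at_p\<close>.\<close>

lemma arc_hom_facts:
  assumes E: "complex_of_real b - twist * complex_of_real a \<noteq> 0"
  defines "N \<equiv> (cmod (complex_of_real b - twist * complex_of_real a))\<^sup>2"
  shows "qf v k (arc_hom a b) = 0"
    and "qf m s (arc_hom a b) = 2 * ht * a * (side_sgn * b + s * a) / N"
    and "Im (arc_hom a b) = ht * (b\<^sup>2 + (k\<^sup>2 - 1) * a\<^sup>2) / N"
    and "N > 0"
proof -
  define D where "D = complex_of_real b - twist * complex_of_real a"
  show Np: "N > 0" using E by (simp add: N_def)
  have N: "N = (cmod D)\<^sup>2" by (simp add: N_def D_def)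
  have D: "D \<noteq> 0" using E by (simp add: D_def)
  have ReD: "Re D = b - Re grad * a" and ImD: "Im D = - (Im grad + k) * a" by (simp_all add: D_def twist_def algebra_simps)
  have Nexp: "N = (b - Re grad * a)\<^sup>2 + ((Im grad + k) * a)\<^sup>2" unfolding N cmod_power2 ReD ImD by (simp only: mult_minus_left power2_minus)
  define w where "w = 2 * \<i> * complex_of_real ht * grad * complex_of_real a / D"
  have arc_hom: "arc_hom a b = p + w" by (simp add: arc_hom_def w_def D_def)
  define t where "t = 2 * ht * a / N"
  have tN: "t * N = 2 * ht * a" using Np by (simp add: t_def)
  have w: "w = complex_of_real t * (\<i> * grad * cnj D)"
  proof -
    have "w = 2 * \<i> * complex_of_real ht * grad * complex_of_real a * cnj D / (D * cnj D)"
      using D by (simp add: w_def)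
    also have "D * cnj D = complex_of_real N" unfolding N by (rule complex_norm_square[symmetric])
    finally show ?thesis unfolding t_def by (simp only: of_real_mult of_real_divide of_real_inverse of_real_numeral divide_inverse mult_ac)
  qed
  have Rew: "Re w = t * (- (Im grad) * Re D + Re grad * Im D)"
    and Imw: "Im w = t * (Re grad * Re D + Im grad * Im D)"
    unfolding w by (simp_all add: algebra_simps)
  have gw: "grad \<bullet> w = t * Im D"
  proof -
    have "grad \<bullet> w = t * (Im D * ((Re grad)\<^sup>2 + (Im grad)\<^sup>2))"
      unfolding inner_complex_def Rew Imw by (simp add: power2_eq_square algebra_simps)
    then show ?thesis by (simp add: grad_norm)
  qed
  have mw: "qgrad m s p \<bullet> w = t * (side_sgn * Re D)"
  proof -
    have "qgrad m s p \<bullet> w = t * (side_sgn * Re D * ((Re grad)\<^sup>2 + (Im grad)\<^sup>2))"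
    proof -
      have "qgrad m s p \<bullet> w = - (side_sgn * Im grad) * Re w + side_sgn * Re grad * Im w" unfolding dual_grad inner_complex_def by simp
      then show ?thesis unfolding Rew Imw by (simp add: power2_eq_square algebra_simps)
    qed
    then show ?thesis by (simp add: grad_norm)
  qed
  have ww: "(cmod w)\<^sup>2 = t * (2 * ht * a)"
  proof -
    have "cmod grad = 1" using grad_norm by (simp add: cmod_def)
    then have "(cmod w)\<^sup>2 = t\<^sup>2 * N"
      unfolding w norm_mult power_mult_distrib N by simp
    also have "\<dots> = t * (t * N)" by (simp add: power2_eq_square)
    finally show ?thesis unfolding tN .
  qed
  have "qf v k (arc_hom a b) = t * (Im D + (2 * v$1 * ht) * a)"
    unfolding arc_hom qf_expand ww using p gw by (simp add: grad_def algebra_simps)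
  then show "qf v k (arc_hom a b) = 0" unfolding curvature_at_p ImD by (simp add: algebra_simps)
  have "qf m s (arc_hom a b) = t * (side_sgn * Re D + (2 * m$1 * ht) * a)"
    unfolding arc_hom qf_expand ww mw using p by (simp add: algebra_simps)
  also have "\<dots> = t * (side_sgn * b + s * a)" unfolding dual_at_p ReD by (simp add: algebra_simps)
  finally show "qf m s (arc_hom a b) = 2 * ht * a * (side_sgn * b + s * a) / N" by (simp add: t_def)
  have "Im (arc_hom a b) * N = ht * N + t * N * (Re grad * Re D + Im grad * Im D)"
    unfolding arc_hom by (simp add: ht_def[symmetric] Imw algebra_simps)
  also have "\<dots> = ht * N + 2 * ht * a * (Re grad * Re D + Im grad * Im D)" unfolding tN ..
  also have "\<dots> = ht * (b\<^sup>2 + k\<^sup>2 * a\<^sup>2 - a\<^sup>2 * ((Re grad)\<^sup>2 + (Im grad)\<^sup>2))"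
    unfolding Nexp ReD ImD by (simp add: power2_eq_square algebra_simps)
  also have "\<dots> = ht * (b\<^sup>2 + (k\<^sup>2 - 1) * a\<^sup>2)" unfolding grad_norm by (simp add: algebra_simps)
  finally show "Im (arc_hom a b) = ht * (b\<^sup>2 + (k\<^sup>2 - 1) * a\<^sup>2) / N" using Np by (simp add: field_simps)
qed

text \<open>The direction in which the first curve enters the disk bounded by the second.\<close>

definition dir_sgn :: real where "dir_sgn = - side_sgn"

lemma dir_sgn_sq: "dir_sgn * dir_sgn = 1" "\<bar>dir_sgn\<bar> = 1" "side_sgn = - dir_sgn"
proof -
  show d: "dir_sgn * dir_sgn = 1" using side_sgn_sq by (simp add: dir_sgn_def)
  then show "\<bar>dir_sgn\<bar> = 1" by (metis abs_mult_self_eq abs_ge_zero abs_one power2_eq_square power2_eq_1_iff abs_minus_cancel)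
  show "side_sgn = - dir_sgn" by (simp add: dir_sgn_def)
qed

definition arc_den :: "real \<Rightarrow> complex" where "arc_den u = 1 - twist * complex_of_real (dir_sgn * u)"

lemma arc_den_nz:
  assumes "\<bar>u\<bar> < 1" shows "arc_den u \<noteq> 0"
proof
  assume "arc_den u = 0"
  then have e: "Re grad * (dir_sgn * u) = 1" "(Im grad + k) * (dir_sgn * u) = 0" by (auto simp: arc_den_def twist_def complex_eq_iff)
  have au: "\<bar>dir_sgn * u\<bar> < 1" using assms by (simp add: abs_mult dir_sgn_sq)
  have "\<bar>Re grad\<bar> \<le> 1"
  proof -
    have "(Re grad)\<^sup>2 \<le> 1" using grad_norm zero_le_power2[of "Im grad"] by linarith
    then show ?thesis by (simp add: abs_square_le_1)
  qed
  then have "\<bar>Re grad * (dir_sgn * u)\<bar> \<le> \<bar>dir_sgn * u\<bar>" unfolding abs_mult[of "Re grad"] by (simp add: mult_left_le_one_le)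
  then show False using e(1) au by simp
qed

definition arc_at :: "real \<Rightarrow> complex" where "arc_at u = arc_hom (dir_sgn * u) 1"

lemma arc_at_alt: "arc_at u = p + 2 * \<i> * complex_of_real ht * grad * complex_of_real (dir_sgn * u) / arc_den u"
  by (simp add: arc_at_def arc_hom_def arc_den_def)

lemma arc_at_facts:
  assumes u: "\<bar>u\<bar> < 1"
  shows "qf v k (arc_at u) = 0" "qf m s (arc_at u) = 2 * ht * u * (s * u - 1) / (cmod (arc_den u))\<^sup>2"
    "Im (arc_at u) = ht * (1 + (k\<^sup>2 - 1) * u\<^sup>2) / (cmod (arc_den u))\<^sup>2" "arc_at u \<in> H2" "(cmod (arc_den u))\<^sup>2 > 0"
proof -
  have nz: "complex_of_real 1 - twist * complex_of_real (dir_sgn * u) \<noteq> 0" using arc_den_nz[OF u] by (simp add: arc_den_def)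
  note f = arc_hom_facts[OF nz]
  have d: "complex_of_real 1 - twist * complex_of_real (dir_sgn * u) = arc_den u" by (simp add: arc_den_def)
  show "qf v k (arc_at u) = 0" using f(1) by (simp add: arc_at_def)
  have "2 * ht * (dir_sgn * u) * (side_sgn * 1 + s * (dir_sgn * u)) = 2 * ht * ((dir_sgn * dir_sgn) * u) * (s * u - 1)"
    unfolding dir_sgn_sq(3) by (simp add: algebra_simps)
  then show "qf m s (arc_at u) = 2 * ht * u * (s * u - 1) / (cmod (arc_den u))\<^sup>2"
    using f(2) unfolding d arc_at_def dir_sgn_sq(1) by simp
  have "(dir_sgn * u)\<^sup>2 = u\<^sup>2" using dir_sgn_sq(1) by (simp add: power2_eq_square algebra_simps)
  then show i: "Im (arc_at u) = ht * (1 + (k\<^sup>2 - 1) * u\<^sup>2) / (cmod (arc_den u))\<^sup>2"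
    using f(3) unfolding d arc_at_def by simp
  show n: "(cmod (arc_den u))\<^sup>2 > 0" using f(4) unfolding d .
  show "arc_at u \<in> H2" unfolding H2_def mem_Collect_eq i
    using ht_pos n arc_curv_denominator_pos[OF k u] by simp
qed

definition arc_set :: "complex set" where
  "arc_set = {z\<in>H2. qf v k z = 0 \<and> qf m s z \<le> 0}"

text \<open>The inverse of the parametrization. It is a differentiable function on the plane near the arc, so that the
  parameter of any other parametrization is differentiable too.\<close>

definition coord :: "complex \<Rightarrow> real" where
  "coord z = Re (complex_of_real dir_sgn * (z - p) / (2 * \<i> * complex_of_real ht * grad + twist * (z - p)))"

lemma coord_den:
  assumes u: "\<bar>u\<bar> < 1"
  shows "2 * \<i> * complex_of_real ht * grad + twist * (arc_at u - p) = 2 * \<i> * complex_of_real ht * grad / arc_den u"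
proof -
  define c where "c = 2 * \<i> * complex_of_real ht * grad"
  have "c + twist * (c * complex_of_real (dir_sgn * u) / arc_den u) = c * (arc_den u + twist * complex_of_real (dir_sgn * u)) / arc_den u"
    using arc_den_nz[OF u] by (simp add: field_simps)
  also have "arc_den u + twist * complex_of_real (dir_sgn * u) = 1" by (simp add: arc_den_def)
  finally show ?thesis by (simp add: arc_at_alt c_def)
qed

lemma coord_arc_at:
  assumes u: "\<bar>u\<bar> < 1"
  shows "coord (arc_at u) = u" "2 * \<i> * complex_of_real ht * grad + twist * (arc_at u - p) \<noteq> 0"
proof -
  have c: "2 * \<i> * complex_of_real ht * grad \<noteq> 0" using ht_pos grad_nz by simp
  show "2 * \<i> * complex_of_real ht * grad + twist * (arc_at u - p) \<noteq> 0"
    unfolding coord_den[OF u] using c arc_den_nz[OF u] by simp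
  have "arc_at u - p = 2 * \<i> * complex_of_real ht * grad / arc_den u * complex_of_real (dir_sgn * u)" by (simp add: arc_at_alt)
  then have "(arc_at u - p) / (2 * \<i> * complex_of_real ht * grad / arc_den u) = complex_of_real (dir_sgn * u)"
    using c arc_den_nz[OF u] by simp
  then have "coord (arc_at u) = Re (complex_of_real dir_sgn * complex_of_real (dir_sgn * u))"
    unfolding coord_def coord_den[OF u] times_divide_eq_right[symmetric] by simp
  also have "\<dots> = dir_sgn * dir_sgn * u" by simp
  finally show "coord (arc_at u) = u" by (simp add: dir_sgn_sq)
qed

lemma inv_s: "0 < 1 / s" "1 / s < 1" using s by auto

text \<open>On the arc the second equation is \<open>2 ht u (s u - 1)\<close> up to a positive factor, so that exactly the
  parameters between 0 and \<open>1 / s\<close> lie inside. Conversely, a point of the curve other than \<open>p\<close> has homogeneous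
  parameters \<open>(1, \<nu>)\<close> with \<open>\<nu>\<close> real, where \<open>\<nu> = 0\<close> stands for the point at infinite parameter.\<close>

lemma arc_set_eq: "arc_set = arc_at ` {0..1/s}"
proof (intro equalityI subsetI)
  fix z assume "z \<in> arc_at ` {0..1/s}"
  then obtain u where u: "0 \<le> u" "u \<le> 1 / s" "z = arc_at u" by auto
  then have au: "\<bar>u\<bar> < 1" using inv_s by linarith
  note f = arc_at_facts[OF au]
  have "s * u \<le> 1" using u s by (simp add: field_simps)
  then have "2 * ht * u * (s * u - 1) \<le> 0" using u ht_pos by (intro mult_nonneg_nonpos) auto
  then have "qf m s (arc_at u) \<le> 0" unfolding f(2) using f(5) by (intro divide_nonpos_pos) auto
  then show "z \<in> arc_set" using f u by (simp add: arc_set_def)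
next
  fix z assume z: "z \<in> arc_set"
  show "z \<in> arc_at ` {0..1/s}"
  proof (cases "z = p")
    case True
    then have "z = arc_at 0" by (simp add: arc_at_alt)
    then show ?thesis using inv_s by (intro image_eqI[of _ _ 0]) auto
  next
    case False
    define w where "w = z - p"
    have w: "w \<noteq> 0" "z = p + w" using False by (simp_all add: w_def)
    define c where "c = 2 * \<i> * complex_of_real ht * grad"
    have c: "c \<noteq> 0" using ht_pos grad_nz by (simp add: c_def)
    define \<nu> where "\<nu> = Re (c / w + twist)"
    have gw: "grad \<bullet> w = - v$1 * (cmod w)\<^sup>2" using z w p qf_expand[of v k p w] by (simp add: arc_set_def grad_def)
    have "Im (c / w) = - 2 * (v$1 * ht)"
    proof -
      have "c / w = c * cnj w / complex_of_real ((cmod w)\<^sup>2)"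
        using w complex_norm_square[of w] by simp
      then have "Im (c / w) = Im (c * cnj w) / (cmod w)\<^sup>2" by (simp only: Im_divide_of_real)
      also have "Im (c * cnj w) = 2 * ht * (grad \<bullet> w)" by (simp add: c_def inner_complex_def algebra_simps)
      finally show ?thesis unfolding gw using w by simp
    qed
    then have "Im (c / w + twist) = 0" using curvature_at_p by (simp add: twist_def algebra_simps)
    then have nu: "c / w + twist = complex_of_real \<nu>" by (simp add: \<nu>_def complex_eq_iff)
    then have E: "complex_of_real \<nu> - twist = c / w" by (simp add: algebra_simps)
    have Enz: "complex_of_real \<nu> - twist * complex_of_real 1 \<noteq> 0" using E c w by simp
    have zp: "z = arc_hom 1 \<nu>" unfolding arc_hom_def c_def[symmetric] using E c w by simp
    have "2 * ht * 1 * (side_sgn * \<nu> + s * 1) / (cmod (complex_of_real \<nu> - twist * complex_of_real 1))\<^sup>2 \<le> 0"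
      using z arc_hom_facts(2)[OF Enz] zp by (simp add: arc_set_def)
    then have "2 * ht * 1 * (side_sgn * \<nu> + s * 1) \<le> 0" using arc_hom_facts(4)[OF Enz] by (simp add: divide_le_0_iff)
    then have "side_sgn * \<nu> + s \<le> 0" using ht_pos by (simp add: mult_le_0_iff)
    then have ds: "dir_sgn * \<nu> \<ge> s" by (simp add: dir_sgn_def)
    define u where "u = 1 / (dir_sgn * \<nu>)"
    have u: "0 < u" "u \<le> 1 / s" using ds s by (auto simp: u_def intro!: divide_left_mono)
    have nz: "\<nu> \<noteq> 0" using ds s by auto
    have du: "dir_sgn * u = 1 / \<nu>" using nz dir_sgn_sq(2) by (auto simp: u_def)
    have "arc_at u = arc_hom 1 \<nu>"
    proof -
      have "arc_den u = (complex_of_real \<nu> - twist) / complex_of_real \<nu>" using nz unfolding arc_den_def du by (simp add: field_simps)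
      then show ?thesis unfolding arc_at_alt arc_hom_def du using nz by simp
    qed
    then show ?thesis using u zp by (intro image_eqI[of _ _ u]) auto
  qed
qed

definition arc_vel :: "real \<Rightarrow> complex" where
  "arc_vel u = 2 * \<i> * complex_of_real (ht * dir_sgn) * grad / (arc_den u)\<^sup>2"

lemma arc_at_deriv:
  assumes u: "\<bar>u\<bar> < 1"
  shows "(arc_at has_vector_derivative arc_vel u) (at u within S)"
proof -
  define c where "c = 2 * \<i> * complex_of_real ht * grad"
  have nz: "1 - twist * (complex_of_real dir_sgn * complex_of_real u) \<noteq> 0" using arc_den_nz[OF u] by (simp add: arc_den_def)
  have "((\<lambda>t. p + c * (complex_of_real dir_sgn * t) / (1 - twist * (complex_of_real dir_sgn * t))) has_field_derivative
      c * complex_of_real dir_sgn / (arc_den u)\<^sup>2) (at (complex_of_real u))"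
    using nz by (auto intro!: derivative_eq_intros simp: arc_den_def power2_eq_square) (simp add: field_simps)
  from has_vector_derivative_real_field[OF this]
  have "((\<lambda>t. p + c * (complex_of_real dir_sgn * complex_of_real t) / (1 - twist * (complex_of_real dir_sgn * complex_of_real t))) has_vector_derivative
      c * complex_of_real dir_sgn / (arc_den u)\<^sup>2) (at u within S)" by (simp add: o_def)
  then show ?thesis unfolding arc_at_alt[abs_def] arc_den_def[abs_def] arc_vel_def c_def by (simp add: mult_ac)
qed

lemma arc_at_speed:
  assumes u: "\<bar>u\<bar> < 1"
  shows "cmod (arc_vel u) / Im (arc_at u) = 2 / (1 + (k\<^sup>2 - 1) * u\<^sup>2)"
proof -
  have "cmod grad = 1" using grad_norm by (simp add: cmod_def)
  then have "cmod (arc_vel u) = 2 * ht / (cmod (arc_den u))\<^sup>2"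
    using ht_pos dir_sgn_sq(2) by (simp add: arc_vel_def norm_mult norm_divide norm_power)
  then show ?thesis unfolding arc_at_facts(3)[OF u] using arc_at_facts(5)[OF u] ht_pos by simp
qed

text \<open>The length does not depend on the parametrization. The parameter \<open>H\<close> of a piecewise smooth injective
  parametrization \<open>\<eta>\<close> is continuous and injective, hence monotone, and the speed of \<open>\<eta>\<close> is the derivative of
  \<open>arc_curv k (H t) / k\<close> up to a sign that is constant.\<close>

lemma arc_length_unique:
  assumes \<eta>: "arc \<eta>" "valid_path \<eta>" "path_image \<eta> = arc_set"
  shows "integral {0..1} (\<lambda>t. cmod (vector_derivative \<eta> (at t)) / Im (\<eta> t)) = arc_curv k (1 / s) / k"
proof -
  define x where "x = 1 / s"
  have x: "0 < x" "x < 1" using inv_s by (simp_all add: x_def)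
  define H where "H t = coord (\<eta> t)" for t
  have on: "\<exists>u\<in>{0..x}. \<eta> t = arc_at u" if "t \<in> {0..1}" for t
    using that \<eta>(3) arc_set_eq by (auto simp: path_image_def x_def)
  have H: "H t \<in> {0..x}" "\<eta> t = arc_at (H t)" if t: "t \<in> {0..1}" for t
  proof -
    obtain u where u: "u \<in> {0..x}" "\<eta> t = arc_at u" using on[OF t] by blast
    then have "H t = u" using x coord_arc_at(1)[of u] by (simp add: H_def)
    then show "H t \<in> {0..x}" "\<eta> t = arc_at (H t)" using u by auto
  qed
  have nzd: "2 * \<i> * complex_of_real ht * grad + twist * (\<eta> t - p) \<noteq> 0" if "t \<in> {0..1}" for t
    using H[OF that] x coord_arc_at(2)[of "H t"] by auto
  have cont\<eta>: "continuous_on {0..1} \<eta>" using \<eta>(1) by (simp add: arc_def path_def)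
  have contH: "continuous_on {0..1} H" unfolding H_def coord_def
    by (intro continuous_intros cont\<eta>) (use nzd in auto)
  have injH: "inj_on H {0..1}"
  proof (rule inj_onI)
    fix a b assume ab: "a \<in> {0..1}" "b \<in> {0..1}" "H a = H b"
    then have "\<eta> a = \<eta> b" using H(2) by metis
    then show "a = b" using \<eta>(1) ab by (auto simp: arc_def dest: inj_onD)
  qed
  have onto: "\<exists>t\<in>{0..1}. H t = u" if u: "u \<in> {0..x}" for u
  proof -
    have "arc_at u \<in> path_image \<eta>" using u \<eta>(3) arc_set_eq by (auto simp: x_def)
    then obtain t where t: "t \<in> {0..1}" "\<eta> t = arc_at u" by (auto simp: path_image_def)
    then have "H t = u" using u x coord_arc_at(1)[of u] by (simp add: H_def)
    then show ?thesis using t by blast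
  qed
  obtain S where S: "finite S" "\<eta> C1_differentiable_on {0..1} - S"
    using \<eta>(2) by (auto simp: valid_path_def piecewise_C1_differentiable_on_def)
  define b where "b = (1 + x) / 2"
  have b: "x < b" "b < 1" using x by (simp_all add: b_def)
  have Phi_deriv: "(arc_curv k has_real_derivative 2 * k / (1 + (k\<^sup>2 - 1) * u\<^sup>2)) (at u)" if "0 < u" "u < x" for u
    using arc_curv_has_derivative[OF k b(2), of u] at_within_Icc_at[of 0 u b] that b by simp
  have Phi_cont: "continuous_on {0..x} (arc_curv k)"
    by (rule continuous_on_subset[OF DERIV_continuous_on[OF arc_curv_has_derivative[OF k b(2)]]]) (use b in auto)
  (* H increases or decreases according to \<sigma>, so \<sigma> H' is its absolute derivative *)
  have core: "integral {0..1} (\<lambda>t. cmod (vector_derivative \<eta> (at t)) / Im (\<eta> t)) = \<sigma> * (arc_curv k (H 1) / k - arc_curv k (H 0) / k)"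
    if \<sigma>: "\<bar>\<sigma>\<bar> = 1" and mono: "strict_mono_on {0..1} (\<lambda>t. \<sigma> * H t)" for \<sigma> :: real
  proof (rule integral_unique)
    let ?f = "\<lambda>t. \<sigma> * (arc_curv k (H t) / k)"
    have "((\<lambda>t. cmod (vector_derivative \<eta> (at t)) / Im (\<eta> t)) has_integral ?f 1 - ?f 0) {0..1}"
    proof (rule fundamental_theorem_of_calculus_interior_strong[OF S(1)])
      show "continuous_on {0..1} ?f"
        by (intro continuous_intros continuous_on_compose2[OF Phi_cont contH]) (use H k in auto)
      fix t assume t: "t \<in> {0<..<1} - S"
      then have t01: "t \<in> {0..1}" "0 < t" "t < 1" by auto
      obtain \<eta>' where \<eta>': "(\<eta> has_vector_derivative \<eta>') (at t)"
      proof -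
        obtain D where "\<forall>x\<in>{0..1} - S. (\<eta> has_vector_derivative D x) (at x)"
          using S(2) unfolding C1_differentiable_on_def by blast
        then show thesis using that[of "D t"] t by simp
      qed
      have vd: "vector_derivative \<eta> (at t) = \<eta>'" using \<eta>' by (rule vector_derivative_at)
      have Ht: "0 < H t" "H t < x"
      proof -
        have m: "\<sigma> * H 0 < \<sigma> * H t" "\<sigma> * H t < \<sigma> * H 1"
          using mono t01 by (auto simp: strict_mono_on_def)
        have "\<sigma> = 1 \<or> \<sigma> = -1" using \<sigma> by linarith
        then show "0 < H t" "H t < x" using m H(1)[of 0] H(1)[of 1] by auto
      qed
      have uH: "\<bar>H t\<bar> < 1" using Ht x by simp
      obtain H' where H': "(H has_real_derivative H') (at t)"
      proof -
        have d\<eta>: "\<eta> differentiable (at t)" using \<eta>' by (rule differentiableI_vector)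
        have "(\<lambda>t. complex_of_real dir_sgn * (\<eta> t - p) / (2 * \<i> * complex_of_real ht * grad + twist * (\<eta> t - p))) differentiable (at t)"
          by (intro derivative_intros d\<eta> nzd t01)
        then obtain z where "((\<lambda>t. complex_of_real dir_sgn * (\<eta> t - p) / (2 * \<i> * complex_of_real ht * grad + twist * (\<eta> t - p))) has_vector_derivative z) (at t)"
          using vector_derivative_works by blast
        then have "(H has_real_derivative Re z) (at t)"
          unfolding H_def[abs_def] coord_def by (simp add: has_vector_derivative_complex_iff)
        then show thesis by (rule that)
      qed
      have "((arc_at \<circ> H) has_vector_derivative H' *\<^sub>R arc_vel (H t)) (at t)"
        using vector_diff_chain_at[OF H'[unfolded has_real_derivative_iff_has_vector_derivative] arc_at_deriv[OF uH]] .
      moreover have "(\<eta> has_vector_derivative \<eta>') (at t) = ((arc_at \<circ> H) has_vector_derivative \<eta>') (at t)"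
      proof (rule has_vector_derivative_cong_ev)
        have "\<forall>\<^sub>F t in nhds t. t \<in> {0<..<1}" using t01 by (intro eventually_nhds_in_open) auto
        then show "\<forall>\<^sub>F t in nhds t. t \<in> UNIV \<longrightarrow> \<eta> t = (arc_at \<circ> H) t"
          by eventually_elim (use H(2) in auto)
        show "\<eta> t = (arc_at \<circ> H) t" using H(2)[OF t01(1)] by simp
      qed
      ultimately have eq: "\<eta>' = H' *\<^sub>R arc_vel (H t)" using \<eta>' by (metis vector_derivative_at)
      have nn: "\<sigma> * H' \<ge> 0"
      proof (rule mono_on_imp_deriv_nonneg)
        show "mono_on {0..1} (\<lambda>t. \<sigma> * H t)" using mono by (rule strict_mono_on_imp_mono_on)
        show "((\<lambda>t. \<sigma> * H t) has_real_derivative \<sigma> * H') (at t)" using H' by (rule DERIV_cmult)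
        show "t \<in> interior {0..1}" using t01 by simp
      qed
      then have "\<bar>H'\<bar> = \<sigma> * H'" using \<sigma> by (metis abs_mult abs_of_nonneg mult_1)
      then have spd: "cmod (vector_derivative \<eta> (at t)) / Im (\<eta> t) = \<sigma> * H' * (2 / (1 + (k\<^sup>2 - 1) * (H t)\<^sup>2))"
        unfolding vd eq H(2)[OF t01(1)] using arc_at_speed[OF uH] by (simp add: times_divide_eq_right[symmetric] del: times_divide_eq_right)
      have "((\<lambda>t. arc_curv k (H t)) has_real_derivative (2 * k / (1 + (k\<^sup>2 - 1) * (H t)\<^sup>2)) * H') (at t)"
        by (rule DERIV_chain2[OF Phi_deriv[OF Ht] H'])
      then have "(?f has_real_derivative \<sigma> * ((2 * k / (1 + (k\<^sup>2 - 1) * (H t)\<^sup>2)) * H' / k)) (at t)"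
        by (intro DERIV_cmult DERIV_cdivide)
      also have "\<sigma> * ((2 * k / (1 + (k\<^sup>2 - 1) * (H t)\<^sup>2)) * H' / k) = cmod (vector_derivative \<eta> (at t)) / Im (\<eta> t)"
        unfolding spd using k by simp
      finally show "(?f has_vector_derivative cmod (vector_derivative \<eta> (at t)) / Im (\<eta> t)) (at t)"
        by (simp add: has_real_derivative_iff_has_vector_derivative)
    qed simp
    then show "((\<lambda>t. cmod (vector_derivative \<eta> (at t)) / Im (\<eta> t)) has_integral \<sigma> * (arc_curv k (H 1) / k - arc_curv k (H 0) / k)) {0..1}"
      by (simp add: algebra_simps)
  qed
  obtain t0 t1 where t0: "t0 \<in> {0..1}" "H t0 = 0" and t1: "t1 \<in> {0..1}" "H t1 = x"
    using onto[of 0] onto[of x] x by auto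
  have "strict_mono_on {0..1} H \<or> strict_antimono_on {0..1} H"
    using injective_eq_monotone_map[OF _ contH] injH by (simp add: is_interval_cc)
  then show ?thesis
  proof
    assume mono: "strict_mono_on {0..1} H"
    have "H 0 \<le> H t0" "H t1 \<le> H 1"
      using strict_mono_on_leD[OF mono, of 0 t0] strict_mono_on_leD[OF mono, of t1 1] t0(1) t1(1) by auto
    then have "H 0 = 0" "H 1 = x" using t0 t1 H(1)[of 0] H(1)[of 1] by auto
    then show ?thesis using core[of 1] mono by (simp add: arc_curv_0 x_def)
  next
    assume mono: "strict_antimono_on {0..1} H"
    then have mono': "strict_mono_on {0..1} (\<lambda>t. -1 * H t)" by (auto simp: monotone_on_def)
    have "-1 * H 0 \<le> -1 * H t1" "-1 * H t0 \<le> -1 * H 1"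
      using strict_mono_on_leD[OF mono', of 0 t1] strict_mono_on_leD[OF mono', of t0 1] t0(1) t1(1) by auto
    then have "H 0 = x" "H 1 = 0" using t0 t1 H(1)[of 0] H(1)[of 1] by auto
    then show ?thesis using core[of "-1"] mono' by (simp add: arc_curv_0 x_def)
  qed
qed

lemma arc_exists: "\<exists>\<eta>. arc \<eta> \<and> valid_path \<eta> \<and> path_image \<eta> = arc_set"
proof -
  define x where "x = 1 / s"
  have x: "0 < x" "x < 1" using inv_s by (simp_all add: x_def)
  define \<eta> where "\<eta> t = arc_at (x * t)" for t
  have ab: "\<bar>x * t\<bar> < 1" if "t \<in> {0..1}" for t
  proof -
    have "\<bar>x * t\<bar> = x * t" using x that by simp
    also have "\<dots> \<le> x * 1" using x that by (intro mult_left_mono) auto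
    finally show ?thesis using x by simp
  qed
  have deriv: "(\<eta> has_vector_derivative x *\<^sub>R arc_vel (x * t)) (at t)" if "t \<in> {0..1}" for t
  proof -
    have "((\<lambda>t. x * t) has_vector_derivative x) (at t)" by (auto intro!: derivative_eq_intros)
    from vector_diff_chain_at[OF this arc_at_deriv[OF ab[OF that]]]
    show ?thesis by (simp add: \<eta>_def[abs_def] o_def)
  qed
  have "continuous_on {0..1} (\<lambda>t. x *\<^sub>R arc_vel (x * t))"
    unfolding arc_vel_def arc_den_def
    by (intro continuous_intros ballI) (use arc_den_nz[OF ab] in \<open>auto simp: arc_den_def\<close>)
  moreover have "\<forall>t\<in>{0..1}. (\<eta> has_vector_derivative x *\<^sub>R arc_vel (x * t)) (at t)" using deriv by simp
  ultimately have "\<eta> C1_differentiable_on {0..1}"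
    unfolding C1_differentiable_on_def by (intro exI[of _ "\<lambda>t. x *\<^sub>R arc_vel (x * t)"] conjI)
  then have vp: "valid_path \<eta>" unfolding valid_path_def by (rule C1_differentiable_imp_piecewise)
  have inj: "inj_on \<eta> {0..1}"
  proof (rule inj_onI)
    fix a b assume ab': "a \<in> {0..1}" "b \<in> {0..1}" "\<eta> a = \<eta> b"
    then have "coord (arc_at (x * a)) = coord (arc_at (x * b))" by (simp add: \<eta>_def)
    then have "x * a = x * b" using coord_arc_at(1)[OF ab] ab' by simp
    then show "a = b" using x by simp
  qed
  have "path_image \<eta> = arc_at ` ((\<lambda>t. x * t) ` {0..1})" by (simp add: path_image_def \<eta>_def image_image)
  also have "(\<lambda>t. x * t) ` {0..1} = {0..x}" using x by (simp add: image_mult_atLeastAtMost)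
  finally have "path_image \<eta> = arc_set" unfolding arc_set_eq x_def .
  then show ?thesis using vp inj valid_path_imp_path[OF vp] by (auto simp: arc_def)
qed

lemma hlength_arc_set: "hlength arc_set = arc_curv k (1 / s) / k"
  unfolding hlength_def
proof (rule the_equality)
  obtain \<eta> where "arc \<eta>" "valid_path \<eta>" "path_image \<eta> = arc_set" using arc_exists by blast
  then show "\<exists>\<gamma>. arc \<gamma> \<and> valid_path \<gamma> \<and> path_image \<gamma> = arc_set \<and>
      arc_curv k (1 / s) / k = integral {0..1} (\<lambda>t. cmod (vector_derivative \<gamma> (at t)) / Im (\<gamma> t))"
    using arc_length_unique by metis
  show "l = arc_curv k (1 / s) / k" if "\<exists>\<gamma>. arc \<gamma> \<and> valid_path \<gamma> \<and> path_image \<gamma> = arc_set \<and>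
      l = integral {0..1} (\<lambda>t. cmod (vector_derivative \<gamma> (at t)) / Im (\<gamma> t))" for l
    using that arc_length_unique by metis
qed

end

lemma triangle_packing_dual_curvature:
  assumes P: "triangle_packing T P f" and c3: "card (fverts T f) = 3"
  shows "geod_curvature (dual_circle P f) = sqrt (1 + sig2 (fverts T f) (curv P))"
proof -
  obtain a b c where F: "fverts T f = {a, b, c}" "a \<noteq> b" "b \<noteq> c" "a \<noteq> c"
    using c3 unfolding card_3_iff by auto
  have kpos: "\<forall>u\<in>fverts T f. 0 < curv P u"
    using P geod_curvature_pos by (fastforce simp: triangle_packing_def)
  note cf = triangle_packing_config[OF P c3]
  have "(geod_curvature (dual_circle P f))\<^sup>2 = 1 + sig2 (fverts T f) (curv P)"
    by (rule config_dual_vector(2)[OF F kpos cf])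
  moreover have "geod_curvature (dual_circle P f) > 1" using cf by (simp add: is_config_def)
  ultimately show ?thesis by (metis abs_of_pos less_trans real_sqrt_abs zero_less_one)
qed

text \<open>The sub-arc is the part of a curve inside a perpendicular circle, with curvature given by
  \<open>triangle_packing_dual_curvature\<close>.\<close>

lemma face_total_curv_eq:
  assumes P: "triangle_packing T P f" and c3: "card (fverts T f) = 3" and v: "v \<in> fverts T f"
  shows "face_total_curv P f v = face_curv (fverts T f) (curv P) v"
proof -
  let ?C = "gcirc P f v" and ?D = "dual_circle P f"
  have C: "gcircle_wf ?C" "geod_curvature ?C = curv P v" and D: "gcircle_wf ?D"
    and perp: "perpendicular (curve ?C) (curve ?D)"
    using P v by (auto simp: triangle_packing_def)
  note cf = triangle_packing_config[OF P c3]
  define s where "s = geod_curvature ?D"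
  have cC: "curve ?C = {z\<in>H2. qf (gvec ?C) (curv P v) z = 0}" using curve_qf(1)[OF C(1)] C(2) by simp
  have cD: "curve ?D = {z\<in>H2. qf (gvec ?D) s z = 0}" "convex_side ?D = {z\<in>H2. qf (gvec ?D) s z < 0}"
    using curve_qf[OF D] by (simp_all add: s_def)
  obtain p where "p \<in> curve ?C" "p \<in> curve ?D" using perp by (auto simp: perpendicular_def)
  then have p: "p \<in> H2" "qf (gvec ?C) (curv P v) p = 0" "qf (gvec ?D) s p = 0" unfolding cC cD by auto
  interpret perpendicular_arc "gvec ?C" "gvec ?D" "curv P v" s p
  proof
    show "curv P v > 0" using geod_curvature_pos[OF C(1)] C(2) by simp
    show "s > 1" "lform (gvec ?D) (gvec ?D) = 1 - s\<^sup>2" using cf by (simp_all add: is_config_def s_def)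
    show "lform (gvec ?C) (gvec ?C) = 1 - (curv P v)\<^sup>2" "lform (gvec ?C) (gvec ?D) = - curv P v * s"
      using cf v by (simp_all add: is_config_def s_def)
  qed (rule p)+
  have "{z\<in>H2. hdist (dual_center P f) z \<le> dual_radius P f} = curve ?D \<union> convex_side ?D"
    by (auto simp: dual_circle_def)
  also have "\<dots> = {z\<in>H2. qf (gvec ?D) s z \<le> 0}" unfolding cD by auto
  finally have le: "\<And>z. z \<in> H2 \<Longrightarrow> hdist (dual_center P f) z \<le> dual_radius P f \<longleftrightarrow> qf (gvec ?D) s z \<le> 0" by auto
  have "sub_arc P f v = arc_set" unfolding sub_arc_def arc_set_def cC using le by auto
  then have "face_total_curv P f v = arc_curv (curv P v) (1 / s)"
    using k by (simp add: face_total_curv_def hlength_arc_set)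
  then show ?thesis
    unfolding s_def triangle_packing_dual_curvature[OF P c3] face_curv_def .
qed

section \<open>Isometries between triangles with equal curvatures\<close>

lemma h_isometryD:
  assumes "h_isometry \<psi>"
  shows "bij_betw \<psi> H2 H2" "inj_on \<psi> H2" "\<psi> ` H2 = H2" "\<And>z. z \<in> H2 \<Longrightarrow> \<psi> z \<in> H2"
    "\<And>z w. z \<in> H2 \<Longrightarrow> w \<in> H2 \<Longrightarrow> hdist (\<psi> z) (\<psi> w) = hdist z w"
  using assms by (auto simp: h_isometry_def bij_betw_def)

lemma h_isometry_inv:
  assumes \<psi>: "h_isometry \<psi>"
  shows "h_isometry (inv_into H2 \<psi>)"
  unfolding h_isometry_def
proof (intro conjI ballI)
  note D = h_isometryD[OF \<psi>]
  show b: "bij_betw (inv_into H2 \<psi>) H2 H2" by (rule bij_betw_inv_into[OF D(1)])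
  fix z w assume z: "z \<in> H2" "w \<in> H2"
  then have "inv_into H2 \<psi> z \<in> H2" "inv_into H2 \<psi> w \<in> H2" using b by (auto simp: bij_betw_def)
  moreover have "\<psi> (inv_into H2 \<psi> z) = z" "\<psi> (inv_into H2 \<psi> w) = w"
    using z D(3) by (simp_all add: f_inv_into_f)
  ultimately show "hdist (inv_into H2 \<psi> z) (inv_into H2 \<psi> w) = hdist z w"
    using D(5) by metis
qed

lemma h_isometry_comp: "h_isometry \<psi> \<Longrightarrow> h_isometry \<phi> \<Longrightarrow> h_isometry (\<psi> \<circ> \<phi>)"
  using bij_betw_trans h_isometryD(4) by (fastforce simp: h_isometry_def)

lemma hsegment_image:
  assumes \<psi>: "h_isometry \<psi>" and "x \<in> H2" "y \<in> H2" "z \<in> H2"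
  shows "\<psi> z \<in> hsegment (\<psi> x) (\<psi> y) \<longleftrightarrow> z \<in> hsegment x y"
  using assms h_isometryD[OF \<psi>] by (simp add: hsegment_def)

lemma hconvex_H2: "hconvex H2" by (auto simp: hconvex_def hsegment_def)

lemma hconvex_image:
  assumes \<psi>: "h_isometry \<psi>" and S: "hconvex S"
  shows "hconvex (\<psi> ` S)"
  unfolding hconvex_def
proof (intro conjI ballI subsetI)
  note D = h_isometryD[OF \<psi>]
  have SH: "S \<subseteq> H2" using S by (simp add: hconvex_def)
  fix z assume "z \<in> \<psi> ` S" then show "z \<in> H2" using SH D(4) by auto
next
  note D = h_isometryD[OF \<psi>]
  have SH: "S \<subseteq> H2" using S by (simp add: hconvex_def)
  fix x y z assume x: "x \<in> \<psi> ` S" and y: "y \<in> \<psi> ` S" and z: "z \<in> hsegment x y"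
  obtain x' y' where x': "x' \<in> S" "x = \<psi> x'" and y': "y' \<in> S" "y = \<psi> y'" using x y by auto
  have "z \<in> \<psi> ` H2" using z D(3) by (simp add: hsegment_def)
  then obtain z' where z': "z' \<in> H2" "z = \<psi> z'" by auto
  have "z' \<in> hsegment x' y'" using z hsegment_image[OF \<psi>] x' y' z' SH by blast
  then have "z' \<in> S" using S x' y' by (auto simp: hconvex_def)
  then show "z \<in> \<psi> ` S" using z' by blast
qed

text \<open>Intersections of hyperbolically convex sets are convex only for nonempty families, because convex sets are
  contained in the half-plane; the bound \<open>S \<subseteq> H2\<close> guarantees that the family is nonempty.\<close>

lemma hconvex_hull:
  assumes "S \<subseteq> H2"
  shows "hconvex (hconvex hull S)" "hconvex hull S \<subseteq> H2"
proof -
  show sub: "hconvex hull S \<subseteq> H2" by (rule hull_minimal[where S = hconvex, OF assms hconvex_H2])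
  show "hconvex (hconvex hull S)" unfolding hconvex_def[of "hconvex hull S"]
  proof (intro conjI ballI sub)
    fix x y assume xy: "x \<in> hconvex hull S" "y \<in> hconvex hull S"
    show "hsegment x y \<subseteq> hconvex hull S"
    proof
      fix z assume z: "z \<in> hsegment x y"
      show "z \<in> hconvex hull S" unfolding hull_def
      proof (intro InterI)
        fix t assume "t \<in> {t. hconvex t \<and> S \<subseteq> t}"
        then have t: "hconvex t" "S \<subseteq> t" by auto
        then have "x \<in> t" "y \<in> t" using xy hull_minimal[where S = hconvex, OF t(2,1)] by auto
        then show "z \<in> t" using t(1) z by (auto simp: hconvex_def)
      qed
    qed
  qed
qed

lemma image_subset_hull:
  assumes \<psi>: "h_isometry \<psi>" and S: "S \<subseteq> H2"
  shows "hconvex hull (\<psi> ` S) \<subseteq> \<psi> ` (hconvex hull S)"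
  by (rule hull_minimal) (use hconvex_image[OF \<psi> hconvex_hull(1)[OF S]] hull_subset[of S hconvex] in auto)

lemma inv_image_cancel:
  assumes \<psi>: "h_isometry \<psi>" and S: "S \<subseteq> H2"
  shows "inv_into H2 \<psi> ` (\<psi> ` S) = S" "\<psi> ` (inv_into H2 \<psi> ` S) = S"
  using inv_into_image_cancel[OF h_isometryD(2)[OF \<psi>] S] image_inv_into_cancel[OF h_isometryD(3)[OF \<psi>] S] by auto

lemma hconvex_hull_image:
  assumes \<psi>: "h_isometry \<psi>" and S: "S \<subseteq> H2"
  shows "\<psi> ` (hconvex hull S) = hconvex hull (\<psi> ` S)"
proof
  show "hconvex hull (\<psi> ` S) \<subseteq> \<psi> ` (hconvex hull S)" by (rule image_subset_hull[OF assms])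
  have S': "\<psi> ` S \<subseteq> H2" using S h_isometryD(4)[OF \<psi>] by auto
  have "hconvex hull S \<subseteq> inv_into H2 \<psi> ` (hconvex hull (\<psi> ` S))"
    using image_subset_hull[OF h_isometry_inv[OF \<psi>] S'] unfolding inv_image_cancel(1)[OF \<psi> S] .
  then have "\<psi> ` (hconvex hull S) \<subseteq> \<psi> ` (inv_into H2 \<psi> ` (hconvex hull (\<psi> ` S)))" by (rule image_mono)
  then show "\<psi> ` (hconvex hull S) \<subseteq> hconvex hull (\<psi> ` S)"
    unfolding inv_image_cancel(2)[OF \<psi> hconvex_hull(2)[OF S']] .
qed

lemma curve_subset_H2: "curve C \<subseteq> H2" by (cases C) auto

lemma tri_side_subset_H2: "tri_side T P f e \<subseteq> H2" by (auto simp: tri_side_def center_geodesic_def)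

lemma gen_triangle_subset_H2: "gen_triangle T P f \<subseteq> H2"
  unfolding gen_triangle_def by (rule hconvex_hull(2)) (intro UN_least tri_side_subset_H2)

lemma image_level_set:
  assumes "h_isometry \<psi>" "\<And>z. z \<in> H2 \<Longrightarrow> p z \<longleftrightarrow> q (\<psi> z)"
  shows "\<psi> ` {z\<in>H2. p z} = {z\<in>H2. q z}"
proof (intro equalityI subsetI)
  fix w assume "w \<in> {z\<in>H2. q z}"
  moreover then obtain z where "z \<in> H2" "w = \<psi> z" using h_isometryD(3)[OF assms(1)] by auto
  ultimately show "w \<in> \<psi> ` {z\<in>H2. p z}" using assms(2) by auto
qed (use h_isometryD(4)[OF assms(1)] assms(2) in auto)

text \<open>The isometry carries every part of the first triangle that enters the definition of the glued surface and of
  its isometries to the corresponding part of the second.\<close>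

definition face_match ::
    "('v, 'e, 'f) triangulation \<Rightarrow> ('v, 'f) packing \<Rightarrow> ('v, 'f) packing \<Rightarrow> 'f \<Rightarrow> (complex \<Rightarrow> complex) \<Rightarrow> bool" where
  "face_match T P Q f \<psi> \<longleftrightarrow> h_isometry \<psi> \<and>
     (\<forall>v\<in>fverts T f. \<psi> ` curve (gcirc P f v) = curve (gcirc Q f v)) \<and>
     (\<forall>v\<in>fverts T f. \<psi> ` sub_arc P f v = sub_arc Q f v) \<and>
     \<psi> ` curve (dual_circle P f) = curve (dual_circle Q f) \<and>
     (\<forall>e\<in>fedges T f. \<psi> ` tri_side T P f e = tri_side T Q f e) \<and>
     \<psi> ` gen_triangle T P f = gen_triangle T Q f"

lemma sub_arc_subset_H2: "sub_arc P f v \<subseteq> H2" using curve_subset_H2 by (auto simp: sub_arc_def)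

lemma face_match_inv:
  assumes M: "face_match T P Q f \<psi>"
  shows "face_match T Q P f (inv_into H2 \<psi>)"
proof -
  have \<psi>: "h_isometry \<psi>" using M by (simp add: face_match_def)
  have inv: "inv_into H2 \<psi> ` B = A" if "\<psi> ` A = B" "A \<subseteq> H2" for A B
    using inv_image_cancel(1)[OF \<psi> that(2)] that(1) by simp
  show ?thesis unfolding face_match_def
    by (intro conjI ballI h_isometry_inv \<psi> inv curve_subset_H2 sub_arc_subset_H2 tri_side_subset_H2 gen_triangle_subset_H2)
      (use M in \<open>auto simp: face_match_def\<close>)
qed

text \<open>An isometry that respects the functionals respects the curves, which are their level sets, and the
  distances to the centers up to additive constants. Constants do not change where a sum of two such
  distances is smallest, and so the sides and their convex hull are respected as well.\<close>

lemma face_match_exists: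
  fixes T :: "('v, 'e, 'f) triangulation" and P Q :: "('v, 'f) packing"
  assumes P: "triangle_packing T P f" and Q: "triangle_packing T Q f" and c3: "card (fverts T f) = 3"
    and k: "\<forall>v\<in>fverts T f. curv P v = curv Q v"
    and ends: "\<And>e. e \<in> fedges T f \<Longrightarrow> ends T e \<subseteq> fverts T f"
  shows "\<exists>\<psi>. face_match T P Q f \<psi>"
proof -
  obtain a b c where F: "fverts T f = {a, b, c}" "a \<noteq> b" "b \<noteq> c" "a \<noteq> c"
    using c3 unfolding card_3_iff by auto
  have wf: "gcircle_wf (gcirc P f v)" "geod_curvature (gcirc P f v) = curv P v"
     "gcircle_wf (gcirc Q f v)" "geod_curvature (gcirc Q f v) = curv P v" if "v \<in> fverts T f" for v
    using P Q k that by (auto simp: triangle_packing_def)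
  have wfD: "gcircle_wf (dual_circle P f)" "gcircle_wf (dual_circle Q f)" using P Q by (auto simp: triangle_packing_def)
  have kpos: "\<forall>u\<in>fverts T f. 0 < curv P u" using wf geod_curvature_pos by metis
  have cfP: "is_config (fverts T f) (curv P) (\<lambda>u. gvec (gcirc P f u)) (gvec (dual_circle P f)) (geod_curvature (dual_circle P f))"
    by (rule triangle_packing_config[OF P c3])
  have cfQ: "is_config (fverts T f) (curv P) (\<lambda>u. gvec (gcirc Q f u)) (gvec (dual_circle Q f)) (geod_curvature (dual_circle Q f))"
    using triangle_packing_config[OF Q c3] k by (simp add: is_config_def)
  have "sig2 (fverts T f) (curv P) = sig2 (fverts T f) (curv Q)" using k by (simp add: sig2_def)
  then have sD: "geod_curvature (dual_circle Q f) = geod_curvature (dual_circle P f)"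
    by (simp add: triangle_packing_dual_curvature[OF P c3] triangle_packing_dual_curvature[OF Q c3])
  obtain \<psi> where \<psi>: "h_isometry \<psi>"
    and lev: "\<And>u z. u \<in> fverts T f \<Longrightarrow> z \<in> H2 \<Longrightarrow> gvec (gcirc Q f u) \<bullet> hyp (\<psi> z) = gvec (gcirc P f u) \<bullet> hyp z"
    and levD: "\<And>z. z \<in> H2 \<Longrightarrow> gvec (dual_circle Q f) \<bullet> hyp (\<psi> z) = gvec (dual_circle P f) \<bullet> hyp z"
    using config_isometry[OF F kpos cfP cfQ] by blast
  have cur: "\<psi> ` curve (gcirc P f v) = curve (gcirc Q f v)" if v: "v \<in> fverts T f" for v
    unfolding gcircle_level(1)[OF wf(1)[OF v]] gcircle_level(1)[OF wf(3)[OF v]] wf(2)[OF v] wf(4)[OF v]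
    by (rule image_level_set[OF \<psi>]) (simp add: lev v)
  have disk: "z \<in> H2 \<Longrightarrow> hdist (dual_center R f) z \<le> dual_radius R f \<longleftrightarrow> gvec (dual_circle R f) \<bullet> hyp z \<le> geod_curvature (dual_circle R f)"
    if R: "gcircle_wf (dual_circle R f)" for R :: "('v, 'f) packing" and z
    using gcircle_level(1,2)[OF R] by (auto simp: dual_circle_def le_less)
  have dual: "\<psi> ` curve (dual_circle P f) = curve (dual_circle Q f)"
    unfolding gcircle_level(1)[OF wfD(1)] gcircle_level(1)[OF wfD(2)] sD
    by (rule image_level_set[OF \<psi>]) (simp add: levD)
  have sub: "\<psi> ` sub_arc P f v = sub_arc Q f v" if v: "v \<in> fverts T f" for v
  proof -
    have e: "sub_arc R f v = {z\<in>H2. gvec (gcirc R f v) \<bullet> hyp z = curv P v \<and> gvec (dual_circle R f) \<bullet> hyp z \<le> geod_curvature (dual_circle R f)}"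
      if "gcircle_wf (gcirc R f v)" "geod_curvature (gcirc R f v) = curv P v" "gcircle_wf (dual_circle R f)" for R :: "('v, 'f) packing"
      using gcircle_level(1)[OF that(1)] that(2) disk[OF that(3)] by (auto simp: sub_arc_def)
    show ?thesis unfolding e[OF wf(1,2)[OF v] wfD(1)] e[OF wf(3,4)[OF v] wfD(2)] sD
      by (rule image_level_set[OF \<psi>]) (simp add: lev[OF v] levD)
  qed
  have "\<exists>d. \<forall>z\<in>H2. dist_center (gcirc Q f v) (\<psi> z) = dist_center (gcirc P f v) z + d" if v: "v \<in> fverts T f" for v
  proof -
    obtain c c' where "\<forall>z\<in>H2. dist_center (gcirc P f v) z = center_dist (curv P v) (gvec (gcirc P f v) \<bullet> hyp z) + c"
      "\<forall>z\<in>H2. dist_center (gcirc Q f v) z = center_dist (curv P v) (gvec (gcirc Q f v) \<bullet> hyp z) + c'"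
      using gcircle_level(3)[OF wf(1)[OF v]] gcircle_level(3)[OF wf(3)[OF v]] wf(2)[OF v] wf(4)[OF v] by auto
    then have "\<forall>z\<in>H2. dist_center (gcirc Q f v) (\<psi> z) = dist_center (gcirc P f v) z + (c' - c)"
      using h_isometryD(4)[OF \<psi>] lev[OF v] by simp
    then show ?thesis ..
  qed
  then obtain d where d: "\<And>v z. v \<in> fverts T f \<Longrightarrow> z \<in> H2 \<Longrightarrow> dist_center (gcirc Q f v) (\<psi> z) = dist_center (gcirc P f v) z + d v" by metis
  have cg: "\<psi> ` center_geodesic (gcirc P f u) (gcirc P f v) = center_geodesic (gcirc Q f u) (gcirc Q f v)"
    if u: "u \<in> fverts T f" and v: "v \<in> fverts T f" for u v
    unfolding center_geodesic_def
  proof (rule image_level_set[OF \<psi>])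
    fix z assume z: "z \<in> H2"
    have "(\<forall>y\<in>H2. dist_center (gcirc Q f u) (\<psi> z) + dist_center (gcirc Q f v) (\<psi> z) \<le> dist_center (gcirc Q f u) y + dist_center (gcirc Q f v) y)
      \<longleftrightarrow> (\<forall>y\<in>\<psi> ` H2. dist_center (gcirc Q f u) (\<psi> z) + dist_center (gcirc Q f v) (\<psi> z) \<le> dist_center (gcirc Q f u) y + dist_center (gcirc Q f v) y)"
      unfolding h_isometryD(3)[OF \<psi>] ..
    also have "\<dots> \<longleftrightarrow> (\<forall>y\<in>H2. dist_center (gcirc P f u) z + dist_center (gcirc P f v) z \<le> dist_center (gcirc P f u) y + dist_center (gcirc P f v) y)"
      using d[OF u] d[OF v] z by simp
    finally show "(\<forall>y\<in>H2. dist_center (gcirc P f u) z + dist_center (gcirc P f v) z \<le> dist_center (gcirc P f u) y + dist_center (gcirc P f v) y)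
      \<longleftrightarrow> (\<forall>y\<in>H2. dist_center (gcirc Q f u) (\<psi> z) + dist_center (gcirc Q f v) (\<psi> z) \<le> dist_center (gcirc Q f u) y + dist_center (gcirc Q f v) y)"
      by simp
  qed
  have side: "\<psi> ` tri_side T P f e = tri_side T Q f e" if e: "e \<in> fedges T f" for e
  proof -
    have s: "tri_side T R f e = (\<Union>(u, v)\<in>{(u, v). ends T e = {u, v} \<and> u \<noteq> v}. center_geodesic (gcirc R f u) (gcirc R f v))" for R :: "('v, 'f) packing"
      by (auto simp: tri_side_def)
    show ?thesis unfolding s image_UN
    proof (rule SUP_cong[OF refl])
      fix uv assume uv: "uv \<in> {(u, v). ends T e = {u, v} \<and> u \<noteq> v}"
      obtain u v where uv': "uv = (u, v)" by (cases uv)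
      then have "u \<in> fverts T f" "v \<in> fverts T f" using uv ends[OF e] by auto
      then show "\<psi> ` (case uv of (u, v) \<Rightarrow> center_geodesic (gcirc P f u) (gcirc P f v)) =
          (case uv of (u, v) \<Rightarrow> center_geodesic (gcirc Q f u) (gcirc Q f v))"
        unfolding uv' prod.case by (rule cg)
    qed
  qed
  have "\<psi> ` gen_triangle T P f = hconvex hull (\<psi> ` (\<Union>e\<in>fedges T f. tri_side T P f e))"
    unfolding gen_triangle_def by (rule hconvex_hull_image[OF \<psi>]) (intro UN_least tri_side_subset_H2)
  also have "\<psi> ` (\<Union>e\<in>fedges T f. tri_side T P f e) = (\<Union>e\<in>fedges T f. tri_side T Q f e)"
    unfolding image_UN using side by simp
  finally have "\<psi> ` gen_triangle T P f = gen_triangle T Q f" unfolding gen_triangle_def .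
  then have "face_match T P Q f \<psi>" using \<psi> cur sub dual side by (simp add: face_match_def)
  then show ?thesis by blast
qed

section \<open>The induced isometry of the glued surfaces\<close>

lemma glue_relE:
  assumes "((f, x), (f', x')) \<in> glue_rel T P"
  obtains e \<phi> where "f \<in> Faces T" "f' \<in> Faces T" "e \<in> fedges T f" "e \<in> fedges T f'"
    "x \<in> tri_side T P f e" "x' \<in> tri_side T P f' e" "h_isometry \<phi>"
    "\<forall>v\<in>ends T e. \<phi> ` curve (gcirc P f v) = curve (gcirc P f' v)" "\<phi> x = x'"
proof -
  have "\<exists>e\<in>fedges T f \<inter> fedges T f'. x \<in> tri_side T P f e \<and> x' \<in> tri_side T P f' e \<and>
       (\<exists>\<phi>. h_isometry \<phi> \<and> (\<forall>v\<in>ends T e. \<phi> ` curve (gcirc P f v) = curve (gcirc P f' v)) \<and> \<phi> x = x')"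
    and f: "f \<in> Faces T" "f' \<in> Faces T"
    using assms by (simp_all add: glue_rel_def)
  then obtain e \<phi> where e: "e \<in> fedges T f" "e \<in> fedges T f'" "x \<in> tri_side T P f e" "x' \<in> tri_side T P f' e"
    "h_isometry \<phi>" "\<forall>v\<in>ends T e. \<phi> ` curve (gcirc P f v) = curve (gcirc P f' v)" "\<phi> x = x'"
    by blast
  show thesis by (rule that[OF f e])
qed

definition face_map :: "('f \<Rightarrow> complex \<Rightarrow> complex) \<Rightarrow> 'f \<times> complex \<Rightarrow> 'f \<times> complex" where
  "face_map \<psi> = (\<lambda>(f, x). (f, \<psi> f x))"

locale matching =
  fixes T :: "('v, 'e, 'f) triangulation" and P Q :: "('v, 'f) packing" and \<psi> :: "'f \<Rightarrow> complex \<Rightarrow> complex"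
  assumes match: "\<And>f. f \<in> Faces T \<Longrightarrow> face_match T P Q f (\<psi> f)"
    and ends: "\<And>f e. f \<in> Faces T \<Longrightarrow> e \<in> fedges T f \<Longrightarrow> ends T e \<subseteq> fverts T f"
begin

lemma iso: "f \<in> Faces T \<Longrightarrow> h_isometry (\<psi> f)" using match by (auto simp: face_match_def)

lemma tri_points_map:
  assumes "p \<in> tri_points T P" shows "face_map \<psi> p \<in> tri_points T Q"
proof -
  obtain f x where p: "p = (f, x)" "f \<in> Faces T" "x \<in> gen_triangle T P f" using assms by (auto simp: tri_points_def)
  then have "\<psi> f ` gen_triangle T P f = gen_triangle T Q f" using match by (simp add: face_match_def)
  then show ?thesis using p by (auto simp: tri_points_def face_map_def)
qed

text \<open>Conjugating the isometry that glues two sides by the isometries of the two triangles gives one that glues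
  the images.\<close>

lemma glue_map:
  assumes "(p, q) \<in> glue_rel T P" shows "(face_map \<psi> p, face_map \<psi> q) \<in> glue_rel T Q"
proof -
  obtain f x f' x' where pq: "p = (f, x)" "q = (f', x')" by (cases p, cases q)
  obtain e \<phi> where f: "f \<in> Faces T" "f' \<in> Faces T" and e: "e \<in> fedges T f" "e \<in> fedges T f'"
    and x: "x \<in> tri_side T P f e" "x' \<in> tri_side T P f' e" and \<phi>: "h_isometry \<phi>"
    "\<forall>v\<in>ends T e. \<phi> ` curve (gcirc P f v) = curve (gcirc P f' v)" "\<phi> x = x'"
    using assms unfolding pq by (rule glue_relE)
  note m = match[OF f(1), unfolded face_match_def] match[OF f(2), unfolded face_match_def]
  have xH: "x \<in> H2" by (rule subsetD[OF tri_side_subset_H2 x(1)])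
  define \<rho> where "\<rho> = \<psi> f' \<circ> (\<phi> \<circ> inv_into H2 (\<psi> f))"
  have r1: "h_isometry \<rho>" unfolding \<rho>_def
    by (intro h_isometry_comp h_isometry_inv iso f \<phi>)
  have r2: "\<rho> ` curve (gcirc Q f v) = curve (gcirc Q f' v)" if v: "v \<in> ends T e" for v
  proof -
    have vf: "v \<in> fverts T f" "v \<in> fverts T f'" using subsetD[OF ends v] f e by simp_all
    have "curve (gcirc Q f v) = \<psi> f ` curve (gcirc P f v)" using m(1) vf by simp
    then have "\<rho> ` curve (gcirc Q f v) = \<psi> f' ` \<phi> ` inv_into H2 (\<psi> f) ` \<psi> f ` curve (gcirc P f v)"
      by (simp only: \<rho>_def image_comp[symmetric])
    also have "\<dots> = \<psi> f' ` curve (gcirc P f' v)"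
      unfolding inv_image_cancel(1)[OF iso[OF f(1)] curve_subset_H2] bspec[OF \<phi>(2) v] ..
    also have "\<dots> = curve (gcirc Q f' v)" using m(2) vf by simp
    finally show ?thesis .
  qed
  have r3: "\<rho> (\<psi> f x) = \<psi> f' x'"
    using \<phi>(3) xH inv_into_f_f[OF h_isometryD(2)[OF iso[OF f(1)]] xH] by (simp add: \<rho>_def)
  have "\<psi> f ` tri_side T P f e = tri_side T Q f e" "\<psi> f' ` tri_side T P f' e = tri_side T Q f' e"
    using m e by simp_all
  then have s: "\<psi> f x \<in> tri_side T Q f e" "\<psi> f' x' \<in> tri_side T Q f' e" using x by blast+
  show ?thesis unfolding pq face_map_def glue_rel_def mem_Collect_eq prod.case
    by (intro conjI f bexI[of _ e] IntI e s exI[of _ \<rho>] r1 r3 ballI r2)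
qed

lemma glue_rtrancl_map:
  assumes "(p, q) \<in> (glue_rel T P)\<^sup>*" shows "(face_map \<psi> p, face_map \<psi> q) \<in> (glue_rel T Q)\<^sup>*"
  using assms
proof (induction rule: rtrancl_induct)
  case (step q r)
  show ?case by (rule rtrancl_into_rtrancl[OF step.IH glue_map[OF step.hyps(2)]])
qed simp

lemma glue_tri_points:
  assumes "(p, q) \<in> glue_rel T P" shows "q \<in> tri_points T P"
proof -
  obtain f x f' x' where pq: "p = (f, x)" "q = (f', x')" by (cases p, cases q)
  obtain e \<phi> where "f \<in> Faces T" and f: "f' \<in> Faces T" and "e \<in> fedges T f" and e: "e \<in> fedges T f'"
    and "x \<in> tri_side T P f e" and x: "x' \<in> tri_side T P f' e" and "h_isometry \<phi>"
    "\<forall>v\<in>ends T e. \<phi> ` curve (gcirc P f v) = curve (gcirc P f' v)" "\<phi> x = x'"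
    using assms unfolding pq by (rule glue_relE)
  have "x' \<in> (\<Union>e\<in>fedges T f'. tri_side T P f' e)" using e x by (rule UN_I)
  then have "x' \<in> gen_triangle T P f'" unfolding gen_triangle_def by (rule hull_inc)
  then show ?thesis using f by (simp add: pq tri_points_def)
qed

lemma glue_rtrancl_tri_points:
  assumes "(p, q) \<in> (glue_rel T P)\<^sup>*" "p \<in> tri_points T P" shows "q \<in> tri_points T P"
  using assms by (induction rule: rtrancl_induct) (simp_all add: glue_tri_points)

text \<open>Each step of a chain lies in one triangle, on which the map is an isometry.\<close>

lemma chain_map:
  assumes "chain T P p q l"
  shows "q \<in> tri_points T P \<and> chain T Q (face_map \<psi> p) (face_map \<psi> q) l"
  using assms
proof (induction rule: chain.induct)
  case (chain_refl p)
  show ?case by (intro conjI chain_refl chain.chain_refl tri_points_map)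
next
  case (chain_move p f x l y)
  have f: "f \<in> Faces T" and x: "x \<in> gen_triangle T P f" using chain_move.IH by (auto simp: tri_points_def)
  have H: "x \<in> H2" "y \<in> H2" by (rule subsetD[OF gen_triangle_subset_H2], fact x) (rule subsetD[OF gen_triangle_subset_H2], fact chain_move.hyps)
  have "\<psi> f ` gen_triangle T P f = gen_triangle T Q f" using match[OF f] by (simp add: face_match_def)
  then have y: "\<psi> f y \<in> gen_triangle T Q f" using chain_move.hyps(2) by blast
  have "chain T Q (face_map \<psi> p) (f, \<psi> f x) l" using chain_move.IH by (simp add: face_map_def)
  then have "chain T Q (face_map \<psi> p) (f, \<psi> f y) (l + hdist (\<psi> f x) (\<psi> f y))" using y by (rule chain.chain_move)
  then show ?case
    using h_isometryD(5)[OF iso[OF f] H] f chain_move.hyps by (simp add: face_map_def tri_points_def)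
next
  case (chain_glue p q l q')
  show ?case
    by (rule conjI[OF glue_tri_points[OF chain_glue.hyps(2)]
          chain.chain_glue[OF conjunct2[OF chain_glue.IH] glue_map[OF chain_glue.hyps(2)]]])
qed

lemma inverse_matching: "matching T Q P (\<lambda>f. inv_into H2 (\<psi> f))"
  by unfold_locales (simp_all add: face_match_inv match ends)

lemma inverse_map:
  assumes "p \<in> tri_points T P"
  shows "face_map (\<lambda>f. inv_into H2 (\<psi> f)) (face_map \<psi> p) = p"
proof -
  obtain f x where p: "p = (f, x)" by (cases p)
  then have f: "f \<in> Faces T" and x: "x \<in> H2" using assms subsetD[OF gen_triangle_subset_H2] by (auto simp: tri_points_def)
  show ?thesis using inv_into_f_f[OF h_isometryD(2)[OF iso[OF f]] x] by (simp add: p face_map_def)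
qed

lemma map_inverse:
  assumes "p \<in> tri_points T Q"
  shows "face_map \<psi> (face_map (\<lambda>f. inv_into H2 (\<psi> f)) p) = p"
proof -
  obtain f x where p: "p = (f, x)" by (cases p)
  then have f: "f \<in> Faces T" and x: "x \<in> H2" using assms subsetD[OF gen_triangle_subset_H2] by (auto simp: tri_points_def)
  have "x \<in> \<psi> f ` H2" using x h_isometryD(3)[OF iso[OF f]] by simp
  then show ?thesis by (simp add: p face_map_def f_inv_into_f)
qed

text \<open>The inclusion from right to left applies the inverse isometries to a chain of gluings.\<close>

lemma class_map:
  assumes p: "p \<in> tri_points T P"
  shows "face_map \<psi> ` ((glue_rel T P)\<^sup>* `` {p}) = (glue_rel T Q)\<^sup>* `` {face_map \<psi> p}"
proof (intro equalityI subsetI)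
  fix q assume "q \<in> face_map \<psi> ` ((glue_rel T P)\<^sup>* `` {p})"
  then show "q \<in> (glue_rel T Q)\<^sup>* `` {face_map \<psi> p}" using glue_rtrancl_map by auto
next
  interpret inv: matching T Q P "\<lambda>f. inv_into H2 (\<psi> f)" by (rule inverse_matching)
  fix q assume "q \<in> (glue_rel T Q)\<^sup>* `` {face_map \<psi> p}"
  then have q: "(face_map \<psi> p, q) \<in> (glue_rel T Q)\<^sup>*" by simp
  have "q \<in> tri_points T Q" by (rule inv.glue_rtrancl_tri_points[OF q tri_points_map[OF p]])
  then have "q = face_map \<psi> (face_map (\<lambda>f. inv_into H2 (\<psi> f)) q)" by (simp add: map_inverse)
  moreover have "(p, face_map (\<lambda>f. inv_into H2 (\<psi> f)) q) \<in> (glue_rel T P)\<^sup>*"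
    using inv.glue_rtrancl_map[OF q] inverse_map[OF p] by simp
  ultimately show "q \<in> face_map \<psi> ` ((glue_rel T P)\<^sup>* `` {p})" by blast
qed

lemma surface_points_subset: "A \<in> surface_points T P \<Longrightarrow> A \<subseteq> tri_points T P"
  using glue_rtrancl_tri_points by (auto simp: surface_points_def quotient_def)

lemma surface_points_map: "A \<in> surface_points T P \<Longrightarrow> face_map \<psi> ` A \<in> surface_points T Q"
  using class_map tri_points_map by (fastforce simp: surface_points_def quotient_def)

lemma image_inverse_map: "A \<subseteq> tri_points T P \<Longrightarrow> face_map (\<lambda>f. inv_into H2 (\<psi> f)) ` face_map \<psi> ` A = A"
  using inverse_map by (force simp: image_image)

lemma image_map_inverse: "A \<subseteq> tri_points T Q \<Longrightarrow> face_map \<psi> ` face_map (\<lambda>f. inv_into H2 (\<psi> f)) ` A = A"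
  using map_inverse by (force simp: image_image)

lemma surface_image_map:
  assumes f: "f \<in> Faces T" and S: "\<psi> f ` S = S'" "S \<subseteq> H2"
  shows "image (face_map \<psi>) ` surface_image T P f S = surface_image T Q f S'"
proof -
  have si: "surface_image T R f A = (\<lambda>x. (glue_rel T R)\<^sup>* `` {(f, x)}) ` (A \<inter> gen_triangle T R f)" for R :: "('v, 'f) packing" and A
    by (auto simp: surface_image_def)
  have "\<psi> f ` (S \<inter> gen_triangle T P f) = \<psi> f ` S \<inter> \<psi> f ` gen_triangle T P f"
    by (rule inj_on_image_Int[OF h_isometryD(2)[OF iso[OF f]] S(2) gen_triangle_subset_H2])
  also have "\<dots> = S' \<inter> gen_triangle T Q f" using S match[OF f] by (simp add: face_match_def)
  finally have im: "S' \<inter> gen_triangle T Q f = \<psi> f ` (S \<inter> gen_triangle T P f)" ..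
  have "face_map \<psi> ` ((glue_rel T P)\<^sup>* `` {(f, x)}) = (glue_rel T Q)\<^sup>* `` {(f, \<psi> f x)}" if "x \<in> S \<inter> gen_triangle T P f" for x
    using class_map[of "(f, x)"] f that by (simp add: tri_points_def face_map_def)
  then show ?thesis unfolding si im image_image by (intro image_cong) auto
qed

lemma surface_dist_map:
  assumes A: "A \<in> surface_points T P" and B: "B \<in> surface_points T P"
  shows "surface_dist T Q (face_map \<psi> ` A) (face_map \<psi> ` B) = surface_dist T P A B"
proof -
  interpret inv: matching T Q P "\<lambda>f. inv_into H2 (\<psi> f)" by (rule inverse_matching)
  have "{l. \<exists>p\<in>face_map \<psi> ` A. \<exists>q\<in>face_map \<psi> ` B. chain T Q p q l} = {l. \<exists>p\<in>A. \<exists>q\<in>B. chain T P p q l}"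
  proof (intro equalityI subsetI)
    fix l assume "l \<in> {l. \<exists>p\<in>face_map \<psi> ` A. \<exists>q\<in>face_map \<psi> ` B. chain T Q p q l}"
    then obtain p q where pq: "p \<in> A" "q \<in> B" "chain T Q (face_map \<psi> p) (face_map \<psi> q) l" by auto
    have "p \<in> tri_points T P" "q \<in> tri_points T P" using pq A B surface_points_subset by blast+
    then have "chain T P p q l" using inv.chain_map[OF pq(3)] by (simp add: inverse_map)
    then show "l \<in> {l. \<exists>p\<in>A. \<exists>q\<in>B. chain T P p q l}" using pq by blast
  qed (use chain_map in blast)
  then show ?thesis by (simp add: surface_dist_def)
qed

lemma packing_isometry_map: "packing_isometry T P Q (image (face_map \<psi>))"
  unfolding packing_isometry_def
proof (intro conjI ballI)
  interpret inv: matching T Q P "\<lambda>f. inv_into H2 (\<psi> f)" by (rule inverse_matching)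
  show "bij_betw (image (face_map \<psi>)) (surface_points T P) (surface_points T Q)"
  proof (rule bij_betw_byWitness[where f' = "image (face_map (\<lambda>f. inv_into H2 (\<psi> f)))"])
    show "\<forall>A\<in>surface_points T P. face_map (\<lambda>f. inv_into H2 (\<psi> f)) ` face_map \<psi> ` A = A"
      using image_inverse_map surface_points_subset by blast
    show "\<forall>A\<in>surface_points T Q. face_map \<psi> ` face_map (\<lambda>f. inv_into H2 (\<psi> f)) ` A = A"
      using image_map_inverse inv.surface_points_subset by blast
  qed (use surface_points_map inv.surface_points_map in auto)
  show "surface_dist T Q (face_map \<psi> ` A) (face_map \<psi> ` B) = surface_dist T P A B"
    if "A \<in> surface_points T P" "B \<in> surface_points T P" for A B by (rule surface_dist_map[OF that])
  fix f assume f: "f \<in> Faces T"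
  note m = match[OF f, unfolded face_match_def]
  show "image (face_map \<psi>) ` surface_image T P f (gen_triangle T P f) = surface_image T Q f (gen_triangle T Q f)"
    using m by (intro surface_image_map[OF f] gen_triangle_subset_H2) auto
  show "image (face_map \<psi>) ` surface_image T P f (curve (dual_circle P f)) = surface_image T Q f (curve (dual_circle Q f))"
    using m by (intro surface_image_map[OF f] curve_subset_H2) auto
  show "image (face_map \<psi>) ` surface_image T P f (sub_arc P f v) = surface_image T Q f (sub_arc Q f v)" if "v \<in> fverts T f" for v
    using m that by (intro surface_image_map[OF f] sub_arc_subset_H2) auto
qed

end

section \<open>Realization of prescribed curvatures\<close>

lemma total_curv_eq:
  assumes "gc_packing T P" "cell_complex T"
  shows "total_curv T P v = vertex_curv (fverts T) (Faces T) (curv P) v"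
  unfolding total_curv_def vertex_curv_def
  by (rule sum.cong[OF refl], rule face_total_curv_eq)
    (use assms in \<open>auto simp: gc_packing_def cell_complex_def\<close>)

lemma faces_at_eq: "faces_at T I = star_faces (fverts T) (Faces T) I"
  by (simp add: faces_at_def star_faces_def)

theorem theorem1p1:
  fixes T :: "('v, 'e, 'f) triangulation" and g n :: nat and k_hat T_hat :: "'v \<Rightarrow> real"
  assumes "n \<ge> 1" and "triangulates_S g n T"
    and "card (boundary_verts T) \<ge> 2"
    and "\<forall>f\<in>Faces T. card (fverts T f \<inter> boundary_verts T) \<le> 2"
    and "\<forall>v\<in>boundary_verts T. k_hat v > 0"
    and "\<forall>v\<in>interior_verts T. T_hat v > 0"
  shows "((\<exists>P :: ('v, 'f) packing. gc_packing T P \<and> realizes T P k_hat T_hat)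
            \<longleftrightarrow> T_hat \<in> feasible T) \<and>
         (\<forall>P Q :: ('v, 'f) packing.
            gc_packing T P \<and> realizes T P k_hat T_hat \<and>
            gc_packing T Q \<and> realizes T Q k_hat T_hat \<longrightarrow> packings_isometric T P Q)"
proof -
  let ?V = "interior_verts T" and ?fv = "fverts T" and ?F = "Faces T"
  have surf: "surface_complex T" using assms(2) by (simp add: triangulates_S_def)
  then have cell: "cell_complex T" by (simp add: surface_complex_def)
  have fin: "finite ?F" "finite ?V" using cell by (auto simp: cell_complex_def interior_verts_def)
  have c3: "\<And>f. f \<in> ?F \<Longrightarrow> card (?fv f) = 3" using cell by (auto simp: cell_complex_def)
  have fV: "\<And>f v. f \<in> ?F \<Longrightarrow> v \<in> ?fv f \<Longrightarrow> v \<in> Verts T" using cell by (auto simp: cell_complex_def)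
  have cover: "\<And>v. v \<in> ?V \<Longrightarrow> \<exists>f\<in>?F. v \<in> ?fv f" using surf by (auto simp: surface_complex_def interior_verts_def)
  have ends: "ends T e \<subseteq> ?fv f" if "f \<in> ?F" "e \<in> fedges T f" for f e
  proof -
    have "bij_betw (ends T) (fedges T f) {p. p \<subseteq> ?fv f \<and> card p = 2}" using cell that by (auto simp: cell_complex_def)
    then have "ends T e \<in> {p. p \<subseteq> ?fv f \<and> card p = 2}" using that(2) by (rule bij_betwE[THEN bspec])
    then show ?thesis by simp
  qed
  have split: "v \<in> Verts T \<Longrightarrow> v \<notin> ?V \<Longrightarrow> v \<in> boundary_verts T" for v by (simp add: interior_verts_def)
  note vc = fin c3 cover
  have feas: "T_hat \<in> feasible T \<longleftrightarrow>
      (\<forall>I. I \<subseteq> ?V \<longrightarrow> I \<noteq> {} \<longrightarrow> (\<Sum>v\<in>I. T_hat v) < pi * real (card (star_faces ?fv ?F I)))"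
    using assms(6) by (simp add: feasible_def faces_at_eq)
  have pos: "0 < curv P v" if "gc_packing T P" "f \<in> ?F" "v \<in> ?fv f" for P :: "('v, 'f) packing" and f v
    using that fV by (auto simp: gc_packing_def)
  have nec: "T_hat \<in> feasible T" if P: "gc_packing T P" "realizes T P k_hat T_hat" for P :: "('v, 'f) packing"
    unfolding feas
  proof (intro allI impI)
    fix I assume I: "I \<subseteq> ?V" "I \<noteq> {}"
    have "(\<Sum>v\<in>I. T_hat v) = (\<Sum>v\<in>I. vertex_curv ?fv ?F (curv P) v)"
      using P I by (intro sum.cong) (auto simp: realizes_def total_curv_eq[OF P(1) cell, symmetric])
    also have "\<dots> < pi * real (card (star_faces ?fv ?F I))"
      by (rule vertex_curv_sum_less[OF vc _ I]) (use pos[OF P(1)] in auto)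
    finally show "(\<Sum>v\<in>I. T_hat v) < pi * real (card (star_faces ?fv ?F I))" .
  qed
  have suff: "\<exists>P :: ('v, 'f) packing. gc_packing T P \<and> realizes T P k_hat T_hat" if feasible: "T_hat \<in> feasible T"
  proof -
    define kb where "kb v = (if v \<in> boundary_verts T then k_hat v else 1)" for v
    have "\<exists>k. (\<forall>v. 0 < k v) \<and> (\<forall>v. v \<notin> ?V \<longrightarrow> k v = kb v) \<and> (\<forall>v\<in>?V. vertex_curv ?fv ?F k v = T_hat v)"
      by (rule vertex_curv_exists[OF vc]) (use assms(5,6) feasible feas in \<open>auto simp: kb_def\<close>)
    then obtain k where k: "\<And>v. 0 < k v" "\<And>v. v \<notin> ?V \<Longrightarrow> k v = kb v" "\<And>v. v \<in> ?V \<Longrightarrow> vertex_curv ?fv ?F k v = T_hat v" by blast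
    define R where "R f G c r \<longleftrightarrow> (\<forall>v\<in>?fv f. gcircle_wf (G v) \<and> geod_curvature (G v) = k v) \<and>
     (\<forall>u\<in>?fv f. \<forall>v\<in>?fv f. u \<noteq> v \<longrightarrow> ext_tangent (G u) (G v)) \<and> gcircle_wf (Circle c r) \<and>
     (\<forall>v\<in>?fv f. perpendicular (curve (G v)) (curve (Circle c r))) \<and>
     (\<forall>u\<in>?fv f. \<forall>v\<in>?fv f. u \<noteq> v \<longrightarrow> curve (G u) \<inter> curve (G v) \<subseteq> curve (Circle c r))" for f G c r
    have "\<exists>G c r. R f G c r" if "f \<in> ?F" for f
      unfolding R_def by (rule face_packing_exists[OF c3[OF that]]) (simp add: k)
    then obtain G c r where G: "\<And>f. f \<in> ?F \<Longrightarrow> R f (G f) (c f) (r f)" by metis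
    define P where "P = \<lparr>curv = k, gcirc = G, dual_center = c, dual_radius = r\<rparr>"
    have "triangle_packing T P f" if "f \<in> ?F" for f
      unfolding triangle_packing_def dual_circle_def P_def packing.simps using G[OF that] unfolding R_def .
    then have gc: "gc_packing T P" using k(1) by (simp add: gc_packing_def P_def)
    have "total_curv T P v = T_hat v" if "v \<in> ?V" for v
      using total_curv_eq[OF gc cell] k(3)[OF that] by (simp add: P_def)
    moreover have "curv P v = k_hat v" if "v \<in> boundary_verts T" for v
      using k(2)[of v] that by (simp add: P_def kb_def interior_verts_def)
    ultimately have "realizes T P k_hat T_hat" by (simp add: realizes_def)
    then show ?thesis using gc by blast
  qed
  have uniq: "packings_isometric T P Q"
    if P: "gc_packing T P" "realizes T P k_hat T_hat" and Q: "gc_packing T Q" "realizes T Q k_hat T_hat" for P Q :: "('v, 'f) packing"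
  proof -
    have bd: "curv P v = curv Q v" if "v \<in> boundary_verts T" for v using P Q that by (simp add: realizes_def)
    have int: "curv P v = curv Q v" if "v \<in> ?V" for v
    proof (rule vertex_curv_inj[OF vc _ _ _ _ that])
      show "vertex_curv ?fv ?F (curv P) v = vertex_curv ?fv ?F (curv Q) v" if "v \<in> ?V" for v
        using P Q that by (simp add: realizes_def total_curv_eq[OF _ cell, symmetric])
    qed (use pos[OF P(1)] pos[OF Q(1)] bd split fV in auto)
    have "\<exists>\<psi>. face_match T P Q f \<psi>" if f: "f \<in> ?F" for f
    proof (rule face_match_exists[OF _ _ c3[OF f] _ ends[OF f]])
      show "triangle_packing T P f" "triangle_packing T Q f" using P(1) Q(1) f by (auto simp: gc_packing_def)
      show "\<forall>v\<in>?fv f. curv P v = curv Q v" using bd int split fV[OF f] by blast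
    qed
    then obtain \<psi> where \<psi>: "\<And>f. f \<in> ?F \<Longrightarrow> face_match T P Q f (\<psi> f)" by metis
    interpret matching T P Q \<psi> by unfold_locales (use \<psi> ends in auto)
    show ?thesis unfolding packings_isometric_def using packing_isometry_map by blast
  qed
  show ?thesis using nec suff uniq by blast
qed

end
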